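(* Let $n\ge1$ and let $\mathbf{i}=(i_1,\dots,i_k)$ be a (possibly empty) sequence of integers with $1\le i_1<i_2<\dots<i_k\le n-1$. Then there is an isomorphism of projective varieties $$\mathrm{Fl}_{n+1}^{\mathbf{i}}\;\xrightarrow{\ \sim\ }\;X_{w_{\mathbf{i}}},$$ where $\mathrm{Fl}^{\mathbf{i}}_{n+1}$ is the linear degenerate flag variety of the projection sequence $\mathrm{pr}_{\mathbf{i}}$ and $X_{w_{\mathbf{i}}}\subset\mathrm{SL}_{n+1+k}/P_{\rho_{\mathbf{i}}}$ is the Schubert variety associated to $w_{\mathbf{i}}$.
   Context: The base field is $\mathbb{C}$. Let $V$ be a vector space with basis $v_1,\dots,v_{n+1}$; $\mathrm{pr}_m:V\to V$ is the projection along $v_m$ ($v_m\mapsto0$, $v_j\mapsto v_j$ for $j\neq m$). The projection sequence is $\mathrm{pr}_{\mathbf{i}}=(f_1,\dots,f_{n-1})$ with $f_l=\mathrm{pr}_{l+1}$ if $l\in\{i_1,\dots,i_k\}$ and $f_l=\mathrm{id}_V$ otherwise. Define $$\mathrm{Fl}_{n+1}^{\mathbf{i}}=\{(U_1,\dots,U_n)\in\prod_{j=1}^n\mathrm{Gr}_j(V): f_j(U_j)\subset U_{j+1}\ \text{for } 1\le j\le n-1\}.$$ Put $h_1=0$, $h_s=\#\{t: 1\le t\le k,\ i_t<s\}$ for $s=2,\dots,n$, and $\ell_j=h_j+j$. Let $W_{\mathbf{i}}$ be the Weyl group (symmetric group) of $\mathfrak{sl}_{n+1+k}$ with simple reflections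 $s_1,\dots,s_{n+k}$. Define $w_{\mathbf{i}}=w_nw_{n-1}\cdots w_1\in W_{\mathbf{i}}$ with $w_j=s_{h_j+1}s_{h_j+2}\cdots s_{h_j+j}$. Let $\rho_{\mathbf{i}}=\varpi_{\ell_1}+\varpi_{\ell_2}+\dots+\varpi_{\ell_n}$ (a sum of fundamental weights of $\mathfrak{sl}_{n+1+k}$), let $P_{\rho_{\mathbf{i}}}\subset\mathrm{SL}_{n+1+k}$ be the standard parabolic subgroup (containing the upper triangular Borel subgroup $B$) stabilizing $\rho_{\mathbf{i}}$, i.e. stabilizing the highest weight line of weight $\rho_{\mathbf{i}}$ (so $\mathrm{SL}_{n+1+k}/P_{\rho_{\mathbf{i}}}$ is the variety of partial flags of dimensions $\ell_1<\dots<\ell_n$ in $\mathbb{C}^{n+1+k}$), and let $X_{w_{\mathbf{i}}}=\overline{Bw_{\mathbf{i}}P_{\rho_{\mathbf{i}}}/P_{\rho_{\mathbf{i}}}}$. *)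

theory Defs
  imports
    Complex_Main
    "HOL-Library.FuncSet"
    "HOL-Algebra.Left_Coset"
    "HOL-Combinatorics.Transposition"
    "Jordan_Normal_Form.Determinant"
    "Jordan_Normal_Form.DL_Submatrix"
begin

text \<open>
  Varieties are classical (reduced, not necessarily irreducible) varieties over the complex
  numbers. For a finite set \<open>A\<close> of coordinate indices, a vector of the coordinate space is a
  function supported in \<open>A\<close>, and a point of the projective space is a line, taken as a set of
  vectors (including 0).
\<close>

definition line :: "('i \<Rightarrow> complex) \<Rightarrow> ('i \<Rightarrow> complex) set"
  where "line x = {\<lambda>a. c * x a | c. True}"

definition proj_space :: "'i set \<Rightarrow> ('i \<Rightarrow> complex) set set"
  where "proj_space A = {line x | x. x \<noteq> (\<lambda>_. 0) \<and> (\<forall>a. a \<notin> A \<longrightarrow> x a = 0)}"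

text \<open>
  \<open>hform A d f\<close>: \<open>f\<close> is the function of a homogeneous polynomial of degree \<open>d\<close> in the coordinates
  indexed by \<open>A\<close> (over an infinite field a polynomial is determined by its function).
\<close>

inductive hform :: "'i set \<Rightarrow> nat \<Rightarrow> (('i \<Rightarrow> complex) \<Rightarrow> complex) \<Rightarrow> bool" for A where
  const: "hform A 0 (\<lambda>x. c)"
| coord: "a \<in> A \<Longrightarrow> hform A 1 (\<lambda>x. x a)"
| add: "hform A d f \<Longrightarrow> hform A d g \<Longrightarrow> hform A d (\<lambda>x. f x + g x)"
| mult: "hform A d f \<Longrightarrow> hform A e g \<Longrightarrow> hform A (d + e) (\<lambda>x. f x * g x)"

definition zariski_closed :: "'i set \<Rightarrow> ('i \<Rightarrow> complex) set set \<Rightarrow> bool"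
  where "zariski_closed A Z \<longleftrightarrow>
    (\<exists>S. (\<forall>f\<in>S. \<exists>d. hform A d f) \<and> Z = {p \<in> proj_space A. \<forall>f\<in>S. \<forall>x\<in>p. f x = 0})"

definition zariski_closure :: "'i set \<Rightarrow> ('i \<Rightarrow> complex) set set \<Rightarrow> ('i \<Rightarrow> complex) set set"
  where "zariski_closure A Z = \<Inter>{C. zariski_closed A C \<and> Z \<subseteq> C}"

text \<open>
  A variety is given by its set of points together with an embedding of this set into a
  projective space.
\<close>

record ('p, 'i) pvar =
  pv_points :: "'p set"
  pv_index :: "'i set"
  pv_emb :: "'p \<Rightarrow> ('i \<Rightarrow> complex) set"

definition projective_variety :: "('p, 'i) pvar \<Rightarrow> bool"
  where "projective_variety X \<longleftrightarrow>
    finite (pv_index X) \<and> inj_on (pv_emb X) (pv_points X) \<and>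
    zariski_closed (pv_index X) (pv_emb X ` pv_points X)"

text \<open>
  A morphism is a map which in a Zariski open neighbourhood of every point (the complement of
  the closed set \<open>C\<close>) is given by homogeneous forms \<open>F b\<close> of one common degree \<open>d\<close> without
  common zero there (\<open>line\<close> of the zero vector is not a point of projective space).
\<close>

definition pv_morphism :: "('p, 'i) pvar \<Rightarrow> ('q, 'j) pvar \<Rightarrow> ('p \<Rightarrow> 'q) \<Rightarrow> bool"
  where "pv_morphism X Y \<phi> \<longleftrightarrow>
    \<phi> ` pv_points X \<subseteq> pv_points Y \<and>
    (\<forall>p\<in>pv_points X. \<exists>C d F.
       zariski_closed (pv_index X) C \<and> pv_emb X p \<notin> C \<and>
       (\<forall>b\<in>pv_index Y. hform (pv_index X) d (F b)) \<and>
       (\<forall>q\<in>pv_points X. pv_emb X q \<notin> C \<longrightarrow>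
          (\<forall>x\<in>pv_emb X q. x \<noteq> (\<lambda>_. 0) \<longrightarrow>
             (\<exists>b\<in>pv_index Y. F b x \<noteq> 0) \<and>
             pv_emb Y (\<phi> q) = line (\<lambda>b. if b \<in> pv_index Y then F b x else 0))))"

definition pv_isomorphism :: "('p, 'i) pvar \<Rightarrow> ('q, 'j) pvar \<Rightarrow> ('p \<Rightarrow> 'q) \<Rightarrow> bool"
  where "pv_isomorphism X Y \<phi> \<longleftrightarrow>
    pv_morphism X Y \<phi> \<and>
    (\<exists>\<psi>. pv_morphism Y X \<psi> \<and>
      (\<forall>p\<in>pv_points X. \<psi> (\<phi> p) = p) \<and> (\<forall>q\<in>pv_points Y. \<phi> (\<psi> q) = q))"

text \<open>
  The standard basis of the tensor product over \<open>1 \<le> j \<le> n\<close> of the \<open>d j\<close>-th exterior powers of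
  an \<open>m\<close>-dimensional space with a chosen basis is indexed by the tuples \<open>(I\<^sub>1, ..., I\<^sub>n)\<close>
  with \<open>I\<^sub>j\<close> a \<open>d j\<close>-element set of basis positions. Positions are counted from 0, as are the
  rows and columns of matrices.
\<close>

definition multi_index :: "nat \<Rightarrow> nat \<Rightarrow> (nat \<Rightarrow> nat) \<Rightarrow> (nat \<Rightarrow> nat set) set"
  where "multi_index m n d = (\<Pi>\<^sub>E j\<in>{1..n}. {I. I \<subseteq> {0..<m} \<and> card I = d j})"

definition is_basis :: "(complex \<Rightarrow> 'v \<Rightarrow> 'v::ab_group_add) \<Rightarrow> nat \<Rightarrow> (nat \<Rightarrow> 'v) \<Rightarrow> bool"
  where "is_basis scale m v \<longleftrightarrow>
    inj_on v {1..m} \<and> \<not> module.dependent scale (v ` {1..m}) \<and>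
    module.span scale (v ` {1..m}) = UNIV"

definition Gr :: "(complex \<Rightarrow> 'v \<Rightarrow> 'v::ab_group_add) \<Rightarrow> nat \<Rightarrow> 'v set set"
  where "Gr scale d = {U. module.subspace scale U \<and> vector_space.dim scale U = d}"

definition coordinate :: "(complex \<Rightarrow> 'v \<Rightarrow> 'v::ab_group_add) \<Rightarrow> nat \<Rightarrow> (nat \<Rightarrow> 'v) \<Rightarrow> nat \<Rightarrow> 'v \<Rightarrow> complex"
  where "coordinate scale m v r x = module.representation scale (v ` {1..m}) x (v r)"

definition proj_along :: "(complex \<Rightarrow> 'v \<Rightarrow> 'v::ab_group_add) \<Rightarrow> nat \<Rightarrow> (nat \<Rightarrow> 'v) \<Rightarrow> nat \<Rightarrow> 'v \<Rightarrow> 'v"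
  where "proj_along scale m v r x = (\<Sum>s\<in>{1..m} - {r}. scale (coordinate scale m v s x) (v s))"

definition proj_seq ::
    "(complex \<Rightarrow> 'v \<Rightarrow> 'v::ab_group_add) \<Rightarrow> nat \<Rightarrow> (nat \<Rightarrow> 'v) \<Rightarrow> nat list \<Rightarrow> nat \<Rightarrow> 'v \<Rightarrow> 'v"
  where "proj_seq scale n v i l =
    (if l \<in> set i then proj_along scale (n + 1) v (l + 1) else id)"

definition deg_flags ::
    "(complex \<Rightarrow> 'v \<Rightarrow> 'v::ab_group_add) \<Rightarrow> nat \<Rightarrow> (nat \<Rightarrow> 'v) \<Rightarrow> nat list \<Rightarrow> (nat \<Rightarrow> 'v set) set"
  where "deg_flags scale n v i =
    {U \<in> (\<Pi>\<^sub>E j\<in>{1..n}. Gr scale j).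
       \<forall>j\<in>{1..n-1}. proj_seq scale n v i j ` U j \<subseteq> U (j + 1)}"

definition is_basis_of ::
    "(complex \<Rightarrow> 'v \<Rightarrow> 'v::ab_group_add) \<Rightarrow> 'v list \<Rightarrow> 'v set \<Rightarrow> bool"
  where "is_basis_of scale us U \<longleftrightarrow>
    distinct us \<and> \<not> module.dependent scale (set us) \<and> module.span scale (set us) = U"

definition coord_mat ::
    "(complex \<Rightarrow> 'v \<Rightarrow> 'v::ab_group_add) \<Rightarrow> nat \<Rightarrow> (nat \<Rightarrow> 'v) \<Rightarrow> 'v list \<Rightarrow> complex mat"
  where "coord_mat scale m v us =
    mat m (length us) (\<lambda>(r, c). coordinate scale m v (r + 1) (us ! c))"

text \<open>
  The Pluecker embeddings of the Grassmannians of \<open>j\<close>-dimensional subspaces, \<open>1 \<le> j \<le> n\<close>,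
  followed by the Segre embedding. The line does not depend on the chosen bases \<open>us j\<close>.
\<close>

definition plucker_segre ::
    "(complex \<Rightarrow> 'v \<Rightarrow> 'v::ab_group_add) \<Rightarrow> nat \<Rightarrow> nat \<Rightarrow> (nat \<Rightarrow> 'v) \<Rightarrow>
      (nat \<Rightarrow> 'v set) \<Rightarrow> ((nat \<Rightarrow> nat set) \<Rightarrow> complex) set"
  where "plucker_segre scale m n v U =
    (\<Union>us \<in> {us. \<forall>j\<in>{1..n}. is_basis_of scale (us j) (U j)}.
       line (\<lambda>I. if I \<in> multi_index m n (\<lambda>j. j)
                 then \<Prod>j=1..n. det (submatrix (coord_mat scale m v (us j)) (I j) UNIV)
                 else 0))"

definition deg_flag_variety ::
    "(complex \<Rightarrow> 'v \<Rightarrow> 'v::ab_group_add) \<Rightarrow> nat \<Rightarrow> (nat \<Rightarrow> 'v) \<Rightarrow> nat list \<Rightarrow>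
      (nat \<Rightarrow> 'v set, nat \<Rightarrow> nat set) pvar"
  where "deg_flag_variety scale n v i =
    \<lparr> pv_points = deg_flags scale n v i,
      pv_index = multi_index (n + 1) n (\<lambda>j. j),
      pv_emb = plucker_segre scale (n + 1) n v \<rparr>"

definition SL :: "nat \<Rightarrow> complex mat monoid"
  where "SL N = \<lparr> carrier = {g \<in> carrier_mat N N. det g = 1}, monoid.mult = (*), one = 1\<^sub>m N \<rparr>"

definition borel_subgroup :: "nat \<Rightarrow> complex mat set"
  where "borel_subgroup N = {g \<in> carrier (SL N). upper_triangular g}"

text \<open>The action of matrices on the tensor product of exterior powers, by products of minors.\<close>

definition tensor_act ::
    "nat \<Rightarrow> nat \<Rightarrow> (nat \<Rightarrow> nat) \<Rightarrow> complex mat \<Rightarrow>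
      ((nat \<Rightarrow> nat set) \<Rightarrow> complex) \<Rightarrow> (nat \<Rightarrow> nat set) \<Rightarrow> complex"
  where "tensor_act N n d g x I =
    (if I \<in> multi_index N n d
     then \<Sum>J\<in>multi_index N n d. (\<Prod>j=1..n. det (submatrix g (I j) (J j))) * x J
     else 0)"

text \<open>
  The tensor product over \<open>j\<close> of the vectors \<open>e\<^sub>1 \<and> ... \<and> e\<^bsub>d j\<^esub>\<close>: the highest weight vector,
  whose weight is the sum of the fundamental weights with the indices \<open>d 1, ..., d n\<close>.
\<close>

definition highest_weight_vector :: "nat \<Rightarrow> (nat \<Rightarrow> nat) \<Rightarrow> (nat \<Rightarrow> nat set) \<Rightarrow> complex"
  where "highest_weight_vector n d I = (if I = (\<lambda>j\<in>{1..n}. {0..<d j}) then 1 else 0)"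

definition parabolic :: "nat \<Rightarrow> nat \<Rightarrow> (nat \<Rightarrow> nat) \<Rightarrow> complex mat set"
  where "parabolic N n d =
    {g \<in> carrier (SL N).
       tensor_act N n d g ` line (highest_weight_vector n d) = line (highest_weight_vector n d)}"

text \<open>The class \<open>gP\<close> goes to the image under \<open>g\<close> of the highest weight line.\<close>

definition orbit_emb ::
    "nat \<Rightarrow> nat \<Rightarrow> (nat \<Rightarrow> nat) \<Rightarrow> complex mat set \<Rightarrow> ((nat \<Rightarrow> nat set) \<Rightarrow> complex) set"
  where "orbit_emb N n d C = (\<Union>g\<in>C. tensor_act N n d g ` line (highest_weight_vector n d))"

text \<open>
  The representatives in \<open>SL N\<close> of an element \<open>w\<close> of the Weyl group, the group of permutations of
  \<open>{0..<N}\<close>: the monomial matrices mapping the line of the \<open>b\<close>-th basis vector to that of the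
  \<open>w b\<close>-th.
\<close>

definition weyl_lifts :: "nat \<Rightarrow> (nat \<Rightarrow> nat) \<Rightarrow> complex mat set"
  where "weyl_lifts N w =
    {g \<in> carrier (SL N). \<forall>a<N. \<forall>b<N. a \<noteq> w b \<longrightarrow> g $$ (a, b) = 0}"

definition schubert_cell :: "nat \<Rightarrow> nat \<Rightarrow> (nat \<Rightarrow> nat) \<Rightarrow> (nat \<Rightarrow> nat) \<Rightarrow> complex mat set set"
  where "schubert_cell N n d w =
    {(b * u * p) <#\<^bsub>SL N\<^esub> parabolic N n d | b u p.
       b \<in> borel_subgroup N \<and> u \<in> weyl_lifts N w \<and> p \<in> parabolic N n d}"

definition schubert_variety ::
    "nat \<Rightarrow> nat \<Rightarrow> (nat \<Rightarrow> nat) \<Rightarrow> (nat \<Rightarrow> nat) \<Rightarrow> (complex mat set, nat \<Rightarrow> nat set) pvar"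
  where "schubert_variety N n d w =
    \<lparr> pv_points = {C \<in> lcosets\<^bsub>SL N\<^esub> (parabolic N n d).
         orbit_emb N n d C \<in>
           zariski_closure (multi_index N n d) (orbit_emb N n d ` schubert_cell N n d w)},
      pv_index = multi_index N n d,
      pv_emb = orbit_emb N n d \<rparr>"

text \<open>The clause \<open>h\<^sub>1 = 0\<close> is automatic, since all entries of \<open>i\<close> are at least 1.\<close>

definition h_num :: "nat list \<Rightarrow> nat \<Rightarrow> nat"
  where "h_num i s = card {t. t < length i \<and> i ! t < s}"

definition ell :: "nat list \<Rightarrow> nat \<Rightarrow> nat"
  where "ell i j = h_num i j + j"

text \<open>\<open>s\<^sub>r\<close> exchanges the \<open>r\<close>-th and \<open>(r + 1)\<close>-st position, counted from 1.\<close>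

definition simple_refl :: "nat \<Rightarrow> nat \<Rightarrow> nat"
  where "simple_refl r = transpose (r - 1) r"

definition w_factor :: "nat list \<Rightarrow> nat \<Rightarrow> nat \<Rightarrow> nat"
  where "w_factor i j = foldr (\<circ>) (map simple_refl [h_num i j + 1..<h_num i j + j + 1]) id"

definition w_elt :: "nat \<Rightarrow> nat list \<Rightarrow> nat \<Rightarrow> nat"
  where "w_elt n i = foldr (\<circ>) (map (w_factor i) (rev [1..<n + 1])) id"

end

theory Submission
  imports Defs
begin

text \<open>
  Place the basis vectors of \<open>V\<close> (some of them twice) in the \<open>n + 1 + k\<close> positions of the larger
  space so that each window of \<open>n + 1\<close> positions starting after \<open>h\<^sub>j\<close> contains every one of them once, the one
  leaving the window when \<open>h\<^sub>j\<close> jumps being the one killed by the projection. Sending \<open>U\<^sub>j\<close> to the sum of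
  \<open>\<langle>e\<^sub>1, ..., e\<^bsub>h\<^sub>j\<^esub>\<rangle>\<close> and the copy of \<open>U\<^sub>j\<close> in the \<open>j\<close>-th window turns the conditions
  \<open>f\<^sub>j U\<^sub>j \<subseteq> U\<^bsub>j+1\<^esub>\<close> into inclusions, and identifies the degenerate flag variety with the set of
  flags lying, in every step \<open>j\<close>, between the standard spaces of dimensions \<open>h\<^sub>j\<close> and
  \<open>h\<^sub>j + n + 1\<close>. In Pluecker-Segre coordinates this is, up to signs, an inclusion of coordinates.

  The Schubert cell lies in this closed set. Conversely, by the Bruhat decomposition every such
  flag is a translate under \<open>B\<close> of a coordinate flag satisfying the same bounds; if the latter
  differs from the flag of \<open>w\<close>, then a transposition of two positions moves it up within the bounds,
  and it is a limit of points in the \<open>B\<close>-orbit of the new coordinate flag. Hence a form vanishing on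
  the cell vanishes on all these flags.

  Closedness of the set of flags: where the coordinate \<open>K\<close> does not vanish, the spaces are
  recovered as column spaces of matrices linear in the coordinates (by Cramer's rule), and a point is
  a flag iff it is proportional to the Pluecker-Segre vector of these matrices and the latter satisfy
  the incidence conditions, which are homogeneous equations.
\<close>

section \<open>Minors\<close>

text \<open>Matrices are bare functions of row and column, the sizes being carried by each
  statement: one \<open>g\<close> can be read as an \<open>N\<close> by \<open>dm j\<close> matrix
  for every \<open>j\<close>. A subspace is a matrix of full column rank up to an invertible right
  factor, and an inclusion of subspaces is a factorisation.

  The closure of the cell is found by evaluating forms; neither irreducibility nor dimension is
  invoked. The obstacle is a transposition that keeps a coordinate flag within the bounds for all
  \<open>j\<close> at once. It is found by a count that rests on \<open>h\<close> growing by at most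
  one per step, that is, on the map at each step killing at most one basis vector. The flag of
  \<open>w\<close> is extremal because its \<open>j\<close>-th space takes the \<open>j\<close>
  highest positions of its window besides the forced ones.

  Equations are written down only for the small space. They are carried over along the inclusion of
  coordinates, whose inverse is linear too; so both directions of the isomorphism are given by
  linear forms on the whole variety.\<close>

definition mprod :: "nat \<Rightarrow> (nat \<Rightarrow> nat \<Rightarrow> complex) \<Rightarrow> (nat \<Rightarrow> nat \<Rightarrow> complex) \<Rightarrow> nat \<Rightarrow> nat \<Rightarrow> complex"
  where "mprod d a x r c = (\<Sum>k<d. a r k * x k c)"

text \<open>Rows are selected by a map instead of a set, so that exchanging one row is an update
  \<open>\<alpha>(s := r)\<close> even if the result is unsorted or has a repetition.\<close>

definition minor :: "nat \<Rightarrow> (nat \<Rightarrow> nat \<Rightarrow> complex) \<Rightarrow> (nat \<Rightarrow> nat) \<Rightarrow> complex"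
  where "minor d a \<alpha> = det (mat d d (\<lambda>(r, c). a (\<alpha> r) c))"

abbreviation fdet :: "nat \<Rightarrow> (nat \<Rightarrow> nat \<Rightarrow> complex) \<Rightarrow> complex"
  where "fdet d x \<equiv> minor d x (\<lambda>r. r)"

text \<open>The adjugate of the submatrix on the rows \<open>\<alpha>\<close>; hence the exchanged
  indices in \<open>cofactor\<close>.\<close>

definition cof :: "nat \<Rightarrow> (nat \<Rightarrow> nat \<Rightarrow> complex) \<Rightarrow> (nat \<Rightarrow> nat) \<Rightarrow> nat \<Rightarrow> nat \<Rightarrow> complex"
  where "cof d a \<alpha> k s = cofactor (mat d d (\<lambda>(r, c). a (\<alpha> r) c)) s k"

lemma minor_cong:
  assumes "\<And>r c. r < d \<Longrightarrow> c < d \<Longrightarrow> a (\<alpha> r) c = b (\<beta> r) c"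
  shows "minor d a \<alpha> = minor d b \<beta>"
  unfolding minor_def by (intro arg_cong[where f = det] eq_matI) (auto simp: assms)

text \<open>Multiplicativity of the determinant. A change of columns multiplies all minors by one
  factor, which is why a column space determines its Pluecker coordinates up to a scalar.\<close>

lemma minor_mprod: "minor d (mprod d a x) \<alpha> = minor d a \<alpha> * fdet d x"
proof -
  have "mat d d (\<lambda>(r, c). mprod d a x (\<alpha> r) c)
      = mat d d (\<lambda>(r, c). a (\<alpha> r) c) * mat d d (\<lambda>(r, c). x r c)"
    by (intro eq_matI) (auto simp: mprod_def scalar_prod_def atLeast0LessThan)
  then show ?thesis
    unfolding minor_def by (simp add: det_mult[of _ d])
qed

lemma minor_0 [simp]: "minor 0 a \<alpha> = 1"
  by (simp add: minor_def)

lemma minor_identical_rows: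
  assumes "q \<noteq> s" "q < d" "s < d" "\<alpha> q = \<alpha> s"
  shows "minor d a \<alpha> = 0"
  unfolding minor_def
  by (rule det_identical_rows[of _ d q s]) (use assms in \<open>auto intro!: eq_vecI\<close>)

lemma minor_nonzero_inj: "minor d a \<alpha> \<noteq> 0 \<Longrightarrow> inj_on \<alpha> {..<d}"
  using minor_identical_rows by (metis inj_onI lessThan_iff)

text \<open>Expansion along row \<open>s\<close>: the cofactors of this row do not involve it, so
  they are those of the unmodified submatrix. Read backwards, the entries of \<open>a\<close> times
  the adjugate are minors of \<open>a\<close> with one row exchanged.\<close>

lemma minor_laplace:
  assumes "s < d"
  shows "minor d a (\<alpha>(s := r)) = mprod d a (cof d a \<alpha>) r s"
proof -
  let ?A = "mat d d (\<lambda>(q, c). a ((\<alpha>(s := r)) q) c)" and ?B = "mat d d (\<lambda>(q, c). a (\<alpha> q) c)"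
  have "mat_delete ?A s k = mat_delete ?B s k" for k
    by (intro eq_matI) (auto simp: mat_delete_def)
  then have "cofactor ?A s k = cofactor ?B s k" for k
    by (simp add: cofactor_def)
  then show ?thesis
    unfolding minor_def using assms
    by (subst laplace_expansion_row[of _ d s]) (auto simp: mprod_def cof_def)
qed

lemma minor_zero_row:
  assumes "q < d" "\<And>c. c < d \<Longrightarrow> a (\<alpha> q) c = 0"
  shows "minor d a \<alpha> = 0"
  using minor_laplace[OF assms(1), of a \<alpha> "\<alpha> q"] assms(2) by (simp add: mprod_def)

text \<open>Cramer's rule: off the diagonal the exchange repeats a row.\<close>

lemma mprod_cof_self:
  assumes "q < d" "s < d"
  shows "mprod d a (cof d a \<alpha>) (\<alpha> q) s = (if q = s then minor d a \<alpha> else 0)"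
proof (cases "q = s")
  case True
  then show ?thesis using minor_laplace[OF assms(2), of a \<alpha> "\<alpha> q"] by simp
next
  case False
  have "minor d a (\<alpha>(s := \<alpha> q)) = 0"
    by (rule minor_identical_rows[of q s]) (use False assms in auto)
  then show ?thesis using minor_laplace[OF assms(2), of a \<alpha> "\<alpha> q"] False by simp
qed

lemma minor_scalar:
  assumes "\<And>r c. r < d \<Longrightarrow> c < d \<Longrightarrow> x (\<alpha> r) c = (if r = c then k else 0)"
  shows "minor d x \<alpha> = k ^ d"
proof -
  have "mat d d (\<lambda>(r, c). x (\<alpha> r) c) = k \<cdot>\<^sub>m 1\<^sub>m d"
    by (intro eq_matI) (auto simp: assms)
  then show ?thesis by (simp add: minor_def)
qed

lemma minor_scale:
  "minor d (\<lambda>r c. k * a r c) \<alpha> = k ^ d * minor d a \<alpha>"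
proof -
  have "mat d d (\<lambda>(r, c). k * a (\<alpha> r) c) = k \<cdot>\<^sub>m mat d d (\<lambda>(r, c). a (\<alpha> r) c)"
    by (intro eq_matI) auto
  then show ?thesis by (simp add: minor_def)
qed

lemma mprod_cong:
  assumes "\<And>k. k < d \<Longrightarrow> a r k = b r' k" "\<And>k. k < d \<Longrightarrow> x k c = y k c'"
  shows "mprod d a x r c = mprod d b y r' c'"
  unfolding mprod_def by (intro sum.cong) (auto simp: assms)

lemma mprod_assoc: "mprod d (mprod e a x) y r c = mprod e a (mprod d x y) r c"
proof -
  have "mprod d (mprod e a x) y r c = (\<Sum>k<d. \<Sum>l<e. a r l * x l k * y k c)"
    by (simp add: mprod_def sum_distrib_right)
  also have "\<dots> = (\<Sum>l<e. \<Sum>k<d. a r l * x l k * y k c)"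
    by (rule sum.swap)
  finally show ?thesis by (simp add: mprod_def sum_distrib_left mult.assoc)
qed

lemma mprod_delta_right:
  assumes "q < d" "\<And>k. k < d \<Longrightarrow> x k c = (if k = q then t else 0)"
  shows "mprod d a x r c = a r q * t"
proof -
  have "mprod d a x r c = (\<Sum>k<d. if k = q then a r k * t else 0)"
    unfolding mprod_def by (intro sum.cong) (auto simp: assms)
  then show ?thesis using assms(1) by simp
qed

lemma mprod_delta_left:
  assumes "q < d" "\<And>k. k < d \<Longrightarrow> a r k = (if k = q then t else 0)"
  shows "mprod d a x r c = t * x q c"
proof -
  have "mprod d a x r c = (\<Sum>k<d. if k = q then t * x k c else 0)"
    unfolding mprod_def by (intro sum.cong) (auto simp: assms)
  then show ?thesis using assms(1) by simp
qed

text \<open>The determinant of a matrix times that of its adjugate is the \<open>d\<close>-th power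
  of the former.\<close>

lemma fdet_cof:
  assumes "minor d a \<alpha> \<noteq> 0"
  shows "fdet d (cof d a \<alpha>) \<noteq> 0"
proof -
  have "minor d a \<alpha> * fdet d (cof d a \<alpha>) = minor d a \<alpha> ^ d"
    unfolding minor_mprod[symmetric] by (rule minor_scalar) (auto simp: mprod_cof_self)
  then show ?thesis using assms by auto
qed

lemma fdet_inverse:
  assumes "fdet d x \<noteq> 0"
  obtains y where "fdet d y \<noteq> 0"
    "\<And>r c. r < d \<Longrightarrow> c < d \<Longrightarrow> mprod d x y r c = (if r = c then 1 else 0)"
    "\<And>r c. r < d \<Longrightarrow> c < d \<Longrightarrow> mprod d y x r c = (if r = c then 1 else 0)"
proof -
  let ?X = "mat d d (\<lambda>(r, c). x r c)"
  define k where "k = fdet d x"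
  have k: "k \<noteq> 0" "det ?X = k" using assms by (auto simp: k_def minor_def)
  define y where "y r c = inverse k * adj_mat ?X $$ (r, c)" for r c
  have adj: "adj_mat ?X \<in> carrier_mat d d" "?X * adj_mat ?X = k \<cdot>\<^sub>m 1\<^sub>m d" "adj_mat ?X * ?X = k \<cdot>\<^sub>m 1\<^sub>m d"
    using adj_mat[of ?X d] k by auto
  have 1: "mprod d x y r c = (if r = c then 1 else 0)" if "r < d" "c < d" for r c
  proof -
    have "(?X * adj_mat ?X) $$ (r, c) = (\<Sum>l<d. x r l * adj_mat ?X $$ (l, c))"
      using that adj(1) by (simp add: scalar_prod_def atLeast0LessThan)
    then have "mprod d x y r c = inverse k * (?X * adj_mat ?X) $$ (r, c)"
      by (simp add: mprod_def y_def sum_distrib_left mult.left_commute)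
    then show ?thesis using that k adj(2) by auto
  qed
  have 2: "mprod d y x r c = (if r = c then 1 else 0)" if "r < d" "c < d" for r c
  proof -
    have "(adj_mat ?X * ?X) $$ (r, c) = (\<Sum>l<d. adj_mat ?X $$ (r, l) * x l c)"
      using that adj(1) by (simp add: scalar_prod_def atLeast0LessThan)
    then have "mprod d y x r c = inverse k * (adj_mat ?X * ?X) $$ (r, c)"
      by (simp add: mprod_def y_def sum_distrib_left mult.assoc)
    then show ?thesis using that k adj(3) by auto
  qed
  have "fdet d (mprod d x y) = 1"
    using minor_scalar[of d "mprod d x y" "\<lambda>r. r" 1] 1 by simp
  then have "fdet d y \<noteq> 0" by (auto simp: minor_mprod)
  with 1 2 that show ?thesis by blast
qed

section \<open>Full column rank\<close>

definition full_rank :: "nat \<Rightarrow> nat \<Rightarrow> (nat \<Rightarrow> nat \<Rightarrow> complex) \<Rightarrow> bool"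
  where "full_rank m d a \<longleftrightarrow> (\<exists>\<alpha>. (\<forall>r<d. \<alpha> r < m) \<and> minor d a \<alpha> \<noteq> 0)"

lemma minor_kernel:
  assumes "minor d a \<alpha> \<noteq> 0" "\<And>q. q < d \<Longrightarrow> (\<Sum>k<d. a (\<alpha> q) k * z k) = 0" "k < d"
  shows "z k = 0"
proof -
  have "fdet d (\<lambda>r. a (\<alpha> r)) \<noteq> 0"
    using assms(1) minor_cong[of d a \<alpha> "\<lambda>r. a (\<alpha> r)" "\<lambda>r. r"] by simp
  then obtain y where y: "\<And>r c. r < d \<Longrightarrow> c < d \<Longrightarrow> mprod d y (\<lambda>r. a (\<alpha> r)) r c = (if r = c then 1 else 0)"
    by (rule fdet_inverse) blast
  have "z k = mprod d (mprod d y (\<lambda>r. a (\<alpha> r))) (\<lambda>r c. z r) k 0"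
    by (subst mprod_delta_left[of k _ _ _ 1]) (use y assms(3) in auto)
  also have "\<dots> = mprod d y (mprod d (\<lambda>r. a (\<alpha> r)) (\<lambda>r c. z r)) k 0"
    by (rule mprod_assoc)
  also have "\<dots> = 0" using assms(2) by (simp add: mprod_def)
  finally show ?thesis .
qed

lemma full_rank_kernel:
  assumes "full_rank m d a" "\<And>r. r < m \<Longrightarrow> (\<Sum>k<d. a r k * z k) = 0" "k < d"
  shows "z k = 0"
  using assms minor_kernel unfolding full_rank_def by metis

text \<open>Induction on the number of columns. If a nonzero minor, bordered by the next column and
  an arbitrary row, always gave zero, then the cofactors along the added row would form a nonzero
  kernel vector.\<close>

lemma full_rankI:
  assumes "\<And>z. (\<And>r. r < m \<Longrightarrow> (\<Sum>k<d. a r k * z k) = 0) \<Longrightarrow> (\<And>k. k < d \<Longrightarrow> z k = 0)"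
  shows "full_rank m d a"
  using assms
proof (induction d)
  case 0
  then show ?case by (auto simp: full_rank_def)
next
  case (Suc d)
  have "full_rank m d a"
  proof (rule Suc.IH)
    fix z k assume z: "\<And>r. r < m \<Longrightarrow> (\<Sum>k<d. a r k * z k) = (0::complex)" and k: "k < d"
    \<comment> \<open>A kernel vector of the first \<open>d\<close> columns becomes one of
      \<open>Suc d\<close> columns by a final entry 0.\<close>
    have "(z(d := 0)) k = 0"
      by (rule Suc.prems) (use z k in \<open>auto intro!: trans[OF sum.cong z]\<close>)
    then show "z k = 0" using k by auto
  qed
  then obtain \<alpha> where \<alpha>: "\<And>r. r < d \<Longrightarrow> \<alpha> r < m" "minor d a \<alpha> \<noteq> 0"
    by (auto simp: full_rank_def)
  \<comment> \<open>Cofactors along the appended row; the value of \<open>\<alpha>\<close> at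
    \<open>d\<close> does not enter, and the last of them is the minor of size \<open>d\<close>
    given by the induction hypothesis.\<close>
  define z where "z k = cof (Suc d) a \<alpha> k d" for k
  have "z d = minor d a \<alpha>"
    unfolding z_def cof_def cofactor_def minor_def
    by (auto simp: mat_delete_def intro!: arg_cong[where f = det])
  then have "\<exists>r<m. (\<Sum>k<Suc d. a r k * z k) \<noteq> 0"
    using Suc.prems[of z d] \<alpha>(2) by auto
  then obtain r where r: "r < m" "(\<Sum>k<Suc d. a r k * z k) \<noteq> 0" by blast
  then have "minor (Suc d) a (\<alpha>(d := r)) \<noteq> 0"
    by (subst minor_laplace) (auto simp: mprod_def z_def)
  moreover have "\<forall>q<Suc d. (\<alpha>(d := r)) q < m" using \<alpha> r by auto
  ultimately show ?case unfolding full_rank_def by blast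
qed

section \<open>Sorted row selections\<close>

lemma pick_inj_on: "inj_on (pick I) {..<card I}"
  by (intro linorder_inj_onI) (auto dest: pick_mono_le[of _ I])

lemma pick_image: "finite I \<Longrightarrow> pick I ` {..<card I} = I"
  by (rule card_subset_eq) (auto simp: card_image pick_inj_on pick_in_set_le)

lemma pick_lessThan: "r < d \<Longrightarrow> pick {..<d} r = r"
proof -
  assume r: "r < d"
  have "card {a \<in> {..<d}. a < pick {..<d} r} = r" "pick {..<d} r \<in> {..<d}"
    using card_pick_le[of r "{..<d}"] pick_in_set_le[of r "{..<d}"] r by auto
  moreover have "{a \<in> {..<d}. a < pick {..<d} r} = {..<pick {..<d} r}"
    using \<open>pick {..<d} r \<in> {..<d}\<close> by auto
  ultimately show ?thesis by simp
qed

text \<open>The rows are sorted by a permutation, whose sign is the factor. It is obtained before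
  \<open>a\<close> because it depends on \<open>\<alpha>\<close> alone.\<close>

lemma minor_sort:
  assumes "inj_on \<alpha> {..<d}"
  obtains \<epsilon> :: complex where "\<epsilon> \<noteq> 0" "\<And>a. minor d a \<alpha> = \<epsilon> * minor d a (pick (\<alpha> ` {..<d}))"
proof -
  define I where "I = \<alpha> ` {..<d}"
  have I: "finite I" "card I = d" using assms by (auto simp: I_def card_image)
  define \<sigma> where "\<sigma> r = (if r < d then inv_into {..<d} (pick I) (\<alpha> r) else r)" for r
  have pI: "pick I ` {..<d} = I" "inj_on (pick I) {..<d}"
    using pick_image[of I] pick_inj_on[of I] I by auto
  have \<sigma>: "\<sigma> r < d" "pick I (\<sigma> r) = \<alpha> r" if "r < d" for r
  proof -
    have "\<alpha> r \<in> pick I ` {..<d}" unfolding pI(1) using that by (simp add: I_def)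
    from inv_into_into[OF this] f_inv_into_f[OF this] that show "\<sigma> r < d" "pick I (\<sigma> r) = \<alpha> r"
      by (auto simp: \<sigma>_def)
  qed
  have "inj_on \<sigma> {0..<d}"
    by (intro inj_onI) (metis \<sigma>(2) assms atLeast0LessThan inj_onD lessThan_iff)
  moreover have "\<sigma> ` {0..<d} \<subseteq> {0..<d}" using \<sigma> by auto
  ultimately have "bij_betw \<sigma> {0..<d} {0..<d}"
    by (simp add: bij_betw_def endo_inj_surj)
  then have perm: "\<sigma> permutes {0..<d}"
    by (intro bij_imp_permutes) (auto simp: \<sigma>_def)
  have "minor d a \<alpha> = signof \<sigma> * minor d a (pick I)" for a
  proof -
    have "mat d d (\<lambda>(r, c). a (\<alpha> r) c) = mat d d (\<lambda>(r, c). mat d d (\<lambda>(r, c). a (pick I r) c) $$ (\<sigma> r, c))"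
      by (intro eq_matI) (auto simp: \<sigma>)
    then show ?thesis
      unfolding minor_def by (simp only: det_permute_rows[OF mat_carrier perm])
  qed
  moreover have "signof \<sigma> \<noteq> (0::complex)" by (simp add: sign_def)
  ultimately show ?thesis using that unfolding I_def by blast
qed

lemma full_rank_square: "full_rank d d a \<longleftrightarrow> fdet d a \<noteq> 0"
proof
  assume "full_rank d d a"
  then obtain \<alpha> where \<alpha>: "\<And>r. r < d \<Longrightarrow> \<alpha> r < d" "minor d a \<alpha> \<noteq> 0"
    by (auto simp: full_rank_def)
  then have inj: "inj_on \<alpha> {..<d}" by (simp add: minor_nonzero_inj)
  then have "\<alpha> ` {..<d} = {..<d}" using \<alpha>(1) by (intro endo_inj_surj) auto
  moreover obtain \<epsilon> where "minor d a \<alpha> = \<epsilon> * minor d a (pick (\<alpha> ` {..<d}))"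
    using minor_sort[OF inj] by metis
  moreover have "minor d a (pick {..<d}) = fdet d a"
    by (rule minor_cong) (simp add: pick_lessThan)
  ultimately show "fdet d a \<noteq> 0" using \<alpha>(2) by auto
qed (auto simp: full_rank_def)

text \<open>The added columns are unit vectors at the rows outside a nonzero minor. They vanish on
  the rows of the minor, which kills the first \<open>d\<close> entries of a kernel vector; the
  other rows then kill the rest.\<close>

lemma full_rank_extend:
  assumes "full_rank m d a"
  obtains g where "fdet m g \<noteq> 0" "\<And>r c. c < d \<Longrightarrow> g r c = a r c"
proof -
  from assms obtain \<alpha> where \<alpha>: "\<And>r. r < d \<Longrightarrow> \<alpha> r < m" "minor d a \<alpha> \<noteq> 0"
    by (auto simp: full_rank_def)
  then have inj: "inj_on \<alpha> {..<d}" by (simp add: minor_nonzero_inj)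
  define R where "R = {..<m} - \<alpha> ` {..<d}"
  have sub: "\<alpha> ` {..<d} \<subseteq> {..<m}" using \<alpha> by auto
  have R: "finite R" "card R = m - d"
    unfolding R_def using sub inj by (auto simp: card_Diff_subset card_image)
  have dm: "d \<le> m" using card_mono[OF _ sub] inj by (simp add: card_image)
  define g where "g r c = (if c < d then a r c else if r = pick R (c - d) then 1 else 0)" for r c
  have "full_rank m m g"
  proof (rule full_rankI)
    fix z k assume z: "\<And>r. r < m \<Longrightarrow> (\<Sum>k<m. g r k * z k) = (0::complex)" and k: "k < m"
    have split: "(\<Sum>k<m. g r k * z k) = (\<Sum>k<d. a r k * z k) + (\<Sum>k\<in>{d..<m}. g r k * z k)" for r
    proof -
      have "{..<m} = {..<d} \<union> {d..<m}" using dm by auto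
      then have "(\<Sum>k<m. g r k * z k) = (\<Sum>k<d. g r k * z k) + (\<Sum>k\<in>{d..<m}. g r k * z k)"
        by (simp add: sum.union_disjoint ivl_disj_int)
      then show ?thesis by (simp add: g_def)
    qed
    have small: "z k = 0" if "k < d" for k
    proof (rule minor_kernel[OF \<alpha>(2) _ that])
      fix q assume q: "q < d"
      have "g (\<alpha> q) k = 0" if "k \<in> {d..<m}" for k
      proof -
        have "pick R (k - d) \<in> R" using that R dm by (intro pick_in_set_le) auto
        moreover have "\<alpha> q \<notin> R" using q by (simp add: R_def)
        ultimately show ?thesis using that by (auto simp: g_def)
      qed
      then show "(\<Sum>k<d. a (\<alpha> q) k * z k) = 0"
        using z[of "\<alpha> q"] \<alpha>(1)[OF q] split[of "\<alpha> q"] by simp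
    qed
    show "z k = 0"
    proof (cases "k < d")
      case False
      let ?r = "pick R (k - d)"
      have r: "?r \<in> R" using False k R dm by (intro pick_in_set_le) auto
      have "g ?r l = (if l = k then 1 else 0)" if "l \<in> {d..<m}" for l
      proof -
        have "?r = pick R (l - d) \<longleftrightarrow> k - d = l - d"
          using inj_on_eq_iff[OF pick_inj_on[of R], of "k - d" "l - d"] that k False R dm by auto
        then show ?thesis using that False by (auto simp: g_def)
      qed
      then have "(\<Sum>l\<in>{d..<m}. g ?r l * z l) = (\<Sum>l\<in>{d..<m}. if l = k then z l else 0)"
        by (intro sum.cong) auto
      also have "\<dots> = z k" using k False by simp
      finally show ?thesis
        using z[of ?r] r split[of ?r] small by (auto simp: R_def)
    qed (rule small)
  qed
  then show ?thesis using that full_rank_square g_def by auto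
qed

section \<open>Zariski closedness of the flags in Pluecker-Segre coordinates\<close>

lemma hform_scale: "hform A d f \<Longrightarrow> hform A d (\<lambda>x. c * f x)"
  using hform.mult[OF hform.const, of A d f c] by simp

lemma hform_diff: "hform A d f \<Longrightarrow> hform A d g \<Longrightarrow> hform A d (\<lambda>x. f x - g x)"
  using hform.add[of A d f "\<lambda>x. (-1) * g x"] hform_scale[of A d g "-1"] by simp

lemma hform_power: "hform A d f \<Longrightarrow> hform A (d * e) (\<lambda>x. f x ^ e)"
proof (induction e)
  case (Suc e)
  then show ?case using hform.mult[of A d f "d * e" "\<lambda>x. f x ^ e"] by simp
qed (auto intro: hform.const)

lemma hform_prod:
  "finite S \<Longrightarrow> (\<And>s. s \<in> S \<Longrightarrow> hform A (d s) (f s)) \<Longrightarrow> hform A (\<Sum>s\<in>S. d s) (\<lambda>x. \<Prod>s\<in>S. f s x)"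
  by (induction rule: finite_induct) (auto intro: hform.const hform.mult)

text \<open>Zero as a form of positive degree has to be built from a coordinate; this is where
  nonempty index sets come in.\<close>

lemma hform_zero: "a \<in> A \<Longrightarrow> hform A d (\<lambda>x. 0)"
  using hform_scale[OF hform_power[OF hform.coord], of a A d 0] by simp

lemma hform_sum:
  "finite S \<Longrightarrow> A \<noteq> {} \<Longrightarrow> (\<And>s. s \<in> S \<Longrightarrow> hform A d (f s)) \<Longrightarrow> hform A d (\<lambda>x. \<Sum>s\<in>S. f s x)"
  by (induction rule: finite_induct) (auto intro: hform_zero hform.add)

lemma hform_homogeneous: "hform A d f \<Longrightarrow> f (\<lambda>a. c * x a) = c ^ d * f x"
  by (induction rule: hform.induct) (auto simp: algebra_simps power_add)

lemma hform_subst: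
  "hform B d f \<Longrightarrow> (\<And>b. b \<in> B \<Longrightarrow> hform A 1 (\<lambda>x. L x b)) \<Longrightarrow> hform A d (\<lambda>x. f (L x))"
  by (induction rule: hform.induct) (auto intro: hform.const hform.add hform.mult)

text \<open>Leibniz formula: a sum of products of \<open>d\<close> forms of degree
  \<open>e\<close>.\<close>

lemma hform_minor:
  assumes "A \<noteq> {}" "\<And>r c. r < d \<Longrightarrow> c < d \<Longrightarrow> hform A e (\<lambda>x. L x (\<alpha> r) c)"
  shows "hform A (d * e) (\<lambda>x. minor d (L x) \<alpha>)"
proof -
  have "minor d (L x) \<alpha> = (\<Sum>p\<in>{p. p permutes {0..<d}}. signof p * (\<Prod>r\<in>{0..<d}. L x (\<alpha> r) (p r)))" for x
    unfolding minor_def by (subst det_def') (auto simp: permutes_in_image intro!: sum.cong prod.cong)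
  moreover have "hform A (d * e) (\<lambda>x. \<Prod>r\<in>{0..<d}. L x (\<alpha> r) (p r))" if "p permutes {0..<d}" for p
  proof -
    have "hform A (\<Sum>r\<in>{0..<d}. e) (\<lambda>x. \<Prod>r\<in>{0..<d}. L x (\<alpha> r) (p r))"
      by (rule hform_prod) (use assms(2) permutes_in_image[OF that] in auto)
    then show ?thesis by simp
  qed
  ultimately show ?thesis
    using assms(1) by (auto intro!: hform_sum hform_scale finite_permutations)
qed

section \<open>Lines and a criterion for closedness\<close>

lemma mem_line_self: "x \<in> line x"
  unfolding line_def by (auto intro: exI[of _ 1])

lemma line_scale: "c \<noteq> 0 \<Longrightarrow> line (\<lambda>a. c * x a) = line x"
proof -
  assume c: "c \<noteq> 0"
  have "(\<lambda>a. k * x a) \<in> line (\<lambda>a. c * x a)" for k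
    unfolding line_def using c by (auto intro!: exI[of _ "k / c"])
  moreover have "(\<lambda>a. k * (c * x a)) \<in> line x" for k
    unfolding line_def by (auto intro!: exI[of _ "k * c"])
  ultimately show ?thesis by (auto simp: line_def)
qed

lemma line_eqD:
  assumes "line x = line y" "x \<noteq> (\<lambda>_. 0)"
  obtains c where "c \<noteq> 0" "x = (\<lambda>a. c * y a)"
proof -
  obtain c where c: "x = (\<lambda>a. c * y a)" using mem_line_self[of x] assms(1) by (auto simp: line_def)
  with assms(2) have "c \<noteq> 0" by auto
  with c that show ?thesis by blast
qed

lemma mem_line_iff: "y \<in> line x \<longleftrightarrow> (\<exists>c. y = (\<lambda>a. c * x a))"
  by (auto simp: line_def)

text \<open>The equations are all homogeneous forms vanishing on \<open>V\<close>. It remains to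
  treat a common zero \<open>x\<close> of all of them, and the forms to be evaluated may be chosen
  depending on \<open>x\<close>.\<close>

lemma zariski_closed_lineI:
  assumes "\<And>y. y \<in> V \<Longrightarrow> y \<noteq> (\<lambda>_. 0) \<and> (\<forall>a. a \<notin> A \<longrightarrow> y a = 0)"
    and "\<And>x. \<lbrakk>x \<noteq> (\<lambda>_. 0); \<And>a. a \<notin> A \<Longrightarrow> x a = 0;
        \<And>f d. hform A d f \<Longrightarrow> (\<And>y. y \<in> V \<Longrightarrow> f y = 0) \<Longrightarrow> f x = 0\<rbrakk> \<Longrightarrow> line x \<in> line ` V"
  shows "zariski_closed A (line ` V)"
  unfolding zariski_closed_def
proof (intro exI[of _ "{f. (\<exists>d. hform A d f) \<and> (\<forall>y\<in>V. f y = 0)}"] conjI subset_antisym subsetI)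
  fix p assume "p \<in> line ` V"
  then obtain y where y: "y \<in> V" "p = line y" by blast
  then have "p \<in> proj_space A" using assms(1) unfolding proj_space_def by blast
  moreover have "f x = 0" if "hform A d f" "\<forall>y\<in>V. f y = 0" "x \<in> p" for f d x
    using that y hform_homogeneous[OF that(1)] by (auto simp: mem_line_iff)
  ultimately show "p \<in> {p \<in> proj_space A. \<forall>f\<in>{f. (\<exists>d. hform A d f) \<and> (\<forall>y\<in>V. f y = 0)}. \<forall>x\<in>p. f x = 0}"
    by blast
next
  fix p assume "p \<in> {p \<in> proj_space A. \<forall>f\<in>{f. (\<exists>d. hform A d f) \<and> (\<forall>y\<in>V. f y = 0)}. \<forall>x\<in>p. f x = 0}"
  then have p: "p \<in> proj_space A" "\<And>f d x. hform A d f \<Longrightarrow> \<forall>y\<in>V. f y = 0 \<Longrightarrow> x \<in> p \<Longrightarrow> f x = 0"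
    by blast+
  then obtain x where x: "p = line x" "x \<noteq> (\<lambda>_. 0)" "\<And>a. a \<notin> A \<Longrightarrow> x a = 0"
    unfolding proj_space_def by blast
  show "p \<in> line ` V"
    unfolding x(1) using p(2) x mem_line_self by (intro assms(2)) blast+
qed auto

section \<open>Pluecker-Segre vectors of families of matrices\<close>

definition plv :: "nat \<Rightarrow> nat \<Rightarrow> (nat \<Rightarrow> nat) \<Rightarrow> (nat \<Rightarrow> nat \<Rightarrow> nat \<Rightarrow> complex) \<Rightarrow> (nat \<Rightarrow> nat set) \<Rightarrow> complex"
  where "plv m n d a I = (if I \<in> multi_index m n d then \<Prod>j=1..n. minor (d j) (a j) (pick (I j)) else 0)"

text \<open>A choice as in \<open>minor_sort\<close>, made a function of \<open>\<alpha>\<close>.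
  Being independent of the matrix, it can be a coefficient of a linear form in the
  coordinates.\<close>

definition sort_sign :: "nat \<Rightarrow> (nat \<Rightarrow> nat) \<Rightarrow> complex"
  where "sort_sign d \<alpha> = (SOME \<epsilon>. \<epsilon> \<noteq> 0 \<and> (\<forall>a. minor d a \<alpha> = \<epsilon> * minor d a (pick (\<alpha> ` {..<d}))))"

lemma sort_sign:
  assumes "inj_on \<alpha> {..<d}"
  shows "sort_sign d \<alpha> \<noteq> 0" "minor d a \<alpha> = sort_sign d \<alpha> * minor d a (pick (\<alpha> ` {..<d}))"
proof -
  have "\<exists>\<epsilon>. \<epsilon> \<noteq> 0 \<and> (\<forall>a. minor d a \<alpha> = \<epsilon> * minor d a (pick (\<alpha> ` {..<d})))"
    by (rule minor_sort[OF assms]) blast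
  from someI_ex[OF this] show "sort_sign d \<alpha> \<noteq> 0"
    "minor d a \<alpha> = sort_sign d \<alpha> * minor d a (pick (\<alpha> ` {..<d}))"
    unfolding sort_sign_def by blast+
qed

text \<open>The factor is determined by any matrix with a nonzero minor on \<open>I\<close>; here
  the rows in \<open>I\<close> form the identity.\<close>

lemma sort_sign_pick:
  assumes "finite I" "card I = d"
  shows "sort_sign d (pick I) = 1"
proof -
  have inj: "inj_on (pick I) {..<d}" and im: "pick I ` {..<d} = I"
    using pick_inj_on[of I] pick_image[of I] assms by auto
  define a where "a r c = (if r = pick I c then 1 else (0::complex))" for r c
  have "a (pick I r) c = (if r = c then 1 else 0)" if "r < d" "c < d" for r c
    using inj_onD[OF inj, of r c] that by (auto simp: a_def)
  then have "minor d a (pick I) = 1 ^ d"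
    by (rule minor_scalar)
  moreover have "minor d a (pick I) = sort_sign d (pick I) * minor d a (pick I)"
    using sort_sign(2)[OF inj, of a] unfolding im .
  ultimately show ?thesis by (simp only: power_one mult_1_right)
qed

text \<open>For \<open>x\<close> the Pluecker-Segre vector of \<open>a\<close> and \<open>x K \<noteq> 0\<close>, the columns of \<open>bmat m d K j x\<close>
  span the same space as those of \<open>a j\<close>: this matrix is \<open>a j\<close> times a multiple of the
  adjugate of the submatrix of \<open>a j\<close> on the rows in \<open>K j\<close>.\<close>

definition bmat :: "nat \<Rightarrow> (nat \<Rightarrow> nat) \<Rightarrow> (nat \<Rightarrow> nat set) \<Rightarrow> nat \<Rightarrow> ((nat \<Rightarrow> nat set) \<Rightarrow> complex) \<Rightarrow> nat \<Rightarrow> nat \<Rightarrow> complex"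
  where "bmat m d K j x r s = (let \<alpha> = (pick (K j))(s := r) in
    if inj_on \<alpha> {..<d j} then sort_sign (d j) \<alpha> * x (K(j := \<alpha> ` {..<d j})) else 0)"

lemma multi_index_memD:
  assumes "I \<in> multi_index m n d" "j \<in> {1..n}"
  shows "I j \<subseteq> {..<m}" "finite (I j)" "card (I j) = d j"
  using assms unfolding multi_index_def PiE_def Pi_def
  by (auto simp: atLeast0LessThan intro: finite_subset)

lemma finite_multi_index: "finite (multi_index m n d)"
  unfolding multi_index_def by (intro finite_PiE) (auto intro: finite_subset[of _ "Pow {0..<m}"])

lemma pick_less:
  assumes "I \<in> multi_index m n d" "j \<in> {1..n}" "q < d j"
  shows "pick (I j) q < m"
  using multi_index_memD[OF assms(1,2)] assms(3) pick_in_set_le[of q "I j"] by auto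

lemma multi_index_upd:
  assumes "K \<in> multi_index m n d" "j \<in> {1..n}" "J \<subseteq> {..<m}" "card J = d j"
  shows "K(j := J) \<in> multi_index m n d"
  using assms unfolding multi_index_def by (auto simp: PiE_def Pi_def extensional_def)

lemma multi_index_exchange:
  assumes K: "K \<in> multi_index m n d" "j \<in> {1..n}" and r: "r < m"
    and inj: "inj_on ((pick (K j))(s := r)) {..<d j}"
  shows "K(j := ((pick (K j))(s := r)) ` {..<d j}) \<in> multi_index m n d"
  using r pick_less[OF K] inj by (intro multi_index_upd[OF K]) (auto simp del: fun_upd_apply simp: card_image, auto)

text \<open>Each entry is a coordinate up to a constant, or zero if the exchange repeats a
  row.\<close>

lemma hform_bmat:
  assumes "K \<in> multi_index m n d" "j \<in> {1..n}" "r < m"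
  shows "hform (multi_index m n d) 1 (\<lambda>x. bmat m d K j x r s)"
proof (cases "inj_on ((pick (K j))(s := r)) {..<d j}")
  case True
  show ?thesis unfolding bmat_def Let_def if_P[OF True]
    by (rule hform_scale[OF hform.coord[OF multi_index_exchange[OF assms True]]])
next
  case False
  then show ?thesis unfolding bmat_def Let_def using assms by (auto intro!: hform_zero)
qed

lemma bmat_diag:
  assumes K: "K \<in> multi_index m n d" "j \<in> {1..n}" and q: "q < d j" "s < d j"
  shows "bmat m d K j x (pick (K j) q) s = (if q = s then x K else 0)"
proof (cases "q = s")
  case True
  have "inj_on (pick (K j)) {..<d j}" "pick (K j) ` {..<d j} = K j" "sort_sign (d j) (pick (K j)) = 1"
    using pick_inj_on[of "K j"] pick_image[of "K j"] sort_sign_pick[of "K j"] multi_index_memD[OF K] by auto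
  with True show ?thesis by (simp add: bmat_def)
next
  case False
  then have "\<not> inj_on ((pick (K j))(s := pick (K j) q)) {..<d j}"
    using q by (auto dest: inj_onD[of _ _ q s])
  with False show ?thesis by (simp add: bmat_def)
qed

lemma plv_factor:
  assumes "K \<in> multi_index m n d" "j \<in> {1..n}" "J \<subseteq> {..<m}" "card J = d j"
  shows "plv m n d a (K(j := J)) =
    (\<Prod>l\<in>{1..n} - {j}. minor (d l) (a l) (pick (K l))) * minor (d j) (a j) (pick J)"
proof -
  have "plv m n d a (K(j := J)) = (\<Prod>l\<in>{1..n}. minor (d l) (a l) (pick ((K(j := J)) l)))"
    using multi_index_upd[OF assms] by (simp add: plv_def)
  also have "\<dots> = minor (d j) (a j) (pick J) * (\<Prod>l\<in>{1..n} - {j}. minor (d l) (a l) (pick ((K(j := J)) l)))"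
    using assms(2) by (subst prod.remove[of _ j]) auto
  also have "(\<Prod>l\<in>{1..n} - {j}. minor (d l) (a l) (pick ((K(j := J)) l)))
      = (\<Prod>l\<in>{1..n} - {j}. minor (d l) (a l) (pick (K l)))"
    by (intro prod.cong) auto
  finally show ?thesis by (simp only: mult.commute)
qed

text \<open>Changing only the set at \<open>j\<close> leaves the minors at the other indices as a
  common factor; the minor with one row exchanged is expanded by
  \<open>minor_laplace\<close>.\<close>

lemma bmat_plv:
  assumes K: "K \<in> multi_index m n d" "j \<in> {1..n}" and r: "r < m" and s: "s < d j"
  shows "bmat m d K j (plv m n d a) r s =
    (\<Prod>l\<in>{1..n} - {j}. minor (d l) (a l) (pick (K l))) * mprod (d j) (a j) (cof (d j) (a j) (pick (K j))) r s"
proof -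
  let ?\<alpha> = "(pick (K j))(s := r)"
  have "bmat m d K j (plv m n d a) r s =
    (\<Prod>l\<in>{1..n} - {j}. minor (d l) (a l) (pick (K l))) * minor (d j) (a j) ?\<alpha>"
  proof (cases "inj_on ?\<alpha> {..<d j}")
    case True
    have "?\<alpha> ` {..<d j} \<subseteq> {..<m}" using pick_less[OF K] r by auto
    moreover have "card (?\<alpha> ` {..<d j}) = d j" using True by (simp only: card_image card_lessThan)
    ultimately show ?thesis
      using True by (simp only: bmat_def Let_def if_True plv_factor[OF K] sort_sign(2)[OF True, of "a j"]) simp
  next
    case False
    then have "minor (d j) (a j) ?\<alpha> = 0" using minor_nonzero_inj by blast
    with False show ?thesis by (simp only: bmat_def Let_def if_False) simp
  qed
  then show ?thesis by (simp add: minor_laplace[OF s])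
qed

lemma plv_nonzero_minor:
  assumes "plv m n d a K \<noteq> 0"
  shows "K \<in> multi_index m n d" "j \<in> {1..n} \<Longrightarrow> minor (d j) (a j) (pick (K j)) \<noteq> 0"
  using assms by (auto simp: plv_def split: if_splits)

lemma bmat_plv_span:
  assumes K: "plv m n d a K \<noteq> 0" and j: "j \<in> {1..n}"
  obtains Y where "fdet (d j) Y \<noteq> 0"
    "\<And>r s. r < m \<Longrightarrow> s < d j \<Longrightarrow> bmat m d K j (plv m n d a) r s = mprod (d j) (a j) Y r s"
proof -
  note K' = plv_nonzero_minor[OF K]
  define C where "C = (\<Prod>l\<in>{1..n} - {j}. minor (d l) (a l) (pick (K l)))"
  have C: "C \<noteq> 0" using K' by (auto simp: C_def)
  define Y where "Y k s = C * cof (d j) (a j) (pick (K j)) k s" for k s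
  have "fdet (d j) Y \<noteq> 0"
    unfolding Y_def minor_scale using C fdet_cof[OF K'(2)[OF j]] by simp
  moreover have "bmat m d K j (plv m n d a) r s = mprod (d j) (a j) Y r s" if "r < m" "s < d j" for r s
    unfolding bmat_plv[OF K'(1) j that] by (simp add: mprod_def Y_def C_def sum_distrib_left mult.left_commute)
  ultimately show ?thesis using that by blast
qed

lemma plv_cong:
  assumes "\<And>j r c. j \<in> {1..n} \<Longrightarrow> r < m \<Longrightarrow> c < d j \<Longrightarrow> a j r c = b j r c"
  shows "plv m n d a = plv m n d b"
proof
  fix I
  show "plv m n d a I = plv m n d b I"
    using assms pick_less[of I m n d] by (auto simp: plv_def intro!: prod.cong minor_cong)
qed

lemma plv_mprod:
  assumes "\<And>j r c. j \<in> {1..n} \<Longrightarrow> r < m \<Longrightarrow> c < d j \<Longrightarrow> b j r c = mprod (d j) (a j) (X j) r c"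
  shows "plv m n d b = (\<lambda>I. (\<Prod>j=1..n. fdet (d j) (X j)) * plv m n d a I)"
proof -
  have "plv m n d b = plv m n d (\<lambda>j. mprod (d j) (a j) (X j))"
    by (rule plv_cong) (rule assms)
  then show ?thesis by (auto simp: plv_def minor_mprod prod.distrib fun_eq_iff)
qed

text \<open>The row sets for different \<open>j\<close> are independent, so one nonzero minor for
  each \<open>j\<close> combines to a nonzero coordinate.\<close>

lemma plv_nonzero_iff:
  "plv m n d a \<noteq> (\<lambda>_. 0) \<longleftrightarrow> (\<forall>j\<in>{1..n}. full_rank m (d j) (a j))"
proof
  assume "plv m n d a \<noteq> (\<lambda>_. 0)"
  then obtain K where K: "plv m n d a K \<noteq> 0" by auto
  then show "\<forall>j\<in>{1..n}. full_rank m (d j) (a j)"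
    using plv_nonzero_minor[OF K] pick_less unfolding full_rank_def by blast
next
  assume *: "\<forall>j\<in>{1..n}. full_rank m (d j) (a j)"
  have "\<exists>I. I \<subseteq> {..<m} \<and> card I = d j \<and> minor (d j) (a j) (pick I) \<noteq> 0" if j: "j \<in> {1..n}" for j
  proof -
    from bspec[OF * j] obtain \<alpha> where \<alpha>: "\<forall>r<d j. \<alpha> r < m" "minor (d j) (a j) \<alpha> \<noteq> 0" by (auto simp: full_rank_def)
    note inj = minor_nonzero_inj[OF \<alpha>(2)]
    show ?thesis
      using \<alpha> sort_sign(2)[OF inj, of "a j"] inj by (intro exI[of _ "\<alpha> ` {..<d j}"]) (auto simp: card_image)
  qed
  then obtain I where I: "\<And>j. j \<in> {1..n} \<Longrightarrow> I j \<subseteq> {..<m} \<and> card (I j) = d j \<and> minor (d j) (a j) (pick (I j)) \<noteq> 0"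
    by metis
  have "restrict I {1..n} \<in> multi_index m n d"
    using I by (auto simp: multi_index_def atLeast0LessThan)
  then have "plv m n d a (restrict I {1..n}) \<noteq> 0" using I by (auto simp: plv_def)
  then show "plv m n d a \<noteq> (\<lambda>_. 0)" by auto
qed

lemma plv_outside: "I \<notin> multi_index m n d \<Longrightarrow> plv m n d a I = 0"
  by (simp add: plv_def)

lemma mprod_right_cancel:
  assumes "fdet d Y \<noteq> 0"
  obtains W where "fdet d W \<noteq> 0" "\<And>a r c. c < d \<Longrightarrow> mprod d (mprod d a Y) W r c = a r c"
    "\<And>X r c. r < d \<Longrightarrow> mprod d Y (mprod d W X) r c = X r c"
proof -
  from fdet_inverse[OF assms] obtain W where W: "fdet d W \<noteq> 0"
    "\<And>r c. r < d \<Longrightarrow> c < d \<Longrightarrow> mprod d Y W r c = (if r = c then 1 else 0)" by metis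
  have "mprod d (mprod d a Y) W r c = a r c" if "c < d" for a r c
    unfolding mprod_assoc using W that by (subst mprod_delta_right[of c _ _ _ 1]) auto
  moreover have "mprod d Y (mprod d W X) r c = X r c" if "r < d" for X r c
    unfolding mprod_assoc[symmetric] using W that by (subst mprod_delta_left[of r _ _ _ 1]) auto
  ultimately show ?thesis using W that by blast
qed

text \<open>Injectivity of the embedding. Since \<open>bmat\<close> is linear in the coordinates,
  proportional vectors give proportional matrices at a common \<open>K\<close>; these are base
  changes of \<open>a j\<close> and of \<open>b j\<close>.\<close>

lemma plv_line_span:
  assumes "line (plv m n d a) = line (plv m n d b)" "\<forall>j\<in>{1..n}. full_rank m (d j) (a j)" "j \<in> {1..n}"
  obtains X where "fdet (d j) X \<noteq> 0" "\<And>r c. r < m \<Longrightarrow> c < d j \<Longrightarrow> b j r c = mprod (d j) (a j) X r c"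
proof -
  have "plv m n d a \<noteq> (\<lambda>_. 0)" using assms(2) plv_nonzero_iff by blast
  then obtain c K where c: "c \<noteq> 0" "plv m n d a = (\<lambda>I. c * plv m n d b I)" and K: "plv m n d a K \<noteq> 0"
    using line_eqD[OF assms(1)] by (metis ext)
  have Kb: "plv m n d b K \<noteq> 0" using K c by auto
  obtain Y where Y: "fdet (d j) Y \<noteq> 0"
    "\<And>r s. r < m \<Longrightarrow> s < d j \<Longrightarrow> bmat m d K j (plv m n d a) r s = mprod (d j) (a j) Y r s"
    using bmat_plv_span[OF K assms(3)] by metis
  obtain Z where Z: "fdet (d j) Z \<noteq> 0"
    "\<And>r s. r < m \<Longrightarrow> s < d j \<Longrightarrow> bmat m d K j (plv m n d b) r s = mprod (d j) (b j) Z r s"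
    using bmat_plv_span[OF Kb assms(3)] by metis
  obtain W where W: "fdet (d j) W \<noteq> 0" "\<And>a r c. c < d j \<Longrightarrow> mprod (d j) (mprod (d j) a Z) W r c = a r c"
    using mprod_right_cancel[OF Z(1)] by metis
  define X where "X = mprod (d j) Y (\<lambda>r s. inverse c * W r s)"
  have "fdet (d j) X \<noteq> 0" unfolding X_def minor_mprod minor_scale using Y(1) W(1) c(1) by simp
  moreover have "b j r s = mprod (d j) (a j) X r s" if rs: "r < m" "s < d j" for r s
  proof -
    have bm: "mprod (d j) (b j) Z r k = inverse c * mprod (d j) (a j) Y r k" if "k < d j" for k
    proof -
      have "bmat m d K j (plv m n d a) r k = c * bmat m d K j (plv m n d b) r k"
        unfolding c(2) bmat_def by (simp add: Let_def)
      then show ?thesis using Y(2)[OF rs(1) that] Z(2)[OF rs(1) that] c(1) by (simp add: field_simps)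
    qed
    have "b j r s = mprod (d j) (mprod (d j) (b j) Z) W r s" using W(2) rs by simp
    also have "\<dots> = mprod (d j) (mprod (d j) (a j) Y) (\<lambda>r s. inverse c * W r s) r s"
      using bm unfolding mprod_def[of "d j" "mprod _ _ _"] by (intro sum.cong) auto
    finally show ?thesis by (simp add: X_def mprod_assoc)
  qed
  ultimately show ?thesis using that by blast
qed

text \<open>The inclusion of the image of one column space under \<open>A j\<close> in the next
  column space, written as a factorisation: it becomes an equation once the factor \<open>X\<close>
  is known.\<close>

definition incident :: "nat \<Rightarrow> nat \<Rightarrow> (nat \<Rightarrow> nat) \<Rightarrow> (nat \<Rightarrow> nat \<Rightarrow> nat \<Rightarrow> complex) \<Rightarrow> (nat \<Rightarrow> nat \<Rightarrow> nat \<Rightarrow> complex) \<Rightarrow> bool"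
  where "incident m n d A a \<longleftrightarrow> (\<forall>j\<in>{1..<n}. \<exists>X. \<forall>r<m. \<forall>c<d j.
    mprod m (A j) (a j) r c = mprod (d (Suc j)) (a (Suc j)) X r c)"

section \<open>Equations for the flags\<close>

definition flag_vecs :: "nat \<Rightarrow> nat \<Rightarrow> (nat \<Rightarrow> nat) \<Rightarrow> (nat \<Rightarrow> nat \<Rightarrow> nat \<Rightarrow> complex) \<Rightarrow> ((nat \<Rightarrow> nat set) \<Rightarrow> complex) set"
  where "flag_vecs m n d A = {plv m n d a | a. (\<forall>j\<in>{1..n}. full_rank m (d j) (a j)) \<and> incident m n d A a}"

text \<open>The minors of \<open>bmat\<close> are those of \<open>a j\<close> times the determinant
  of a base change \<open>Y\<close>. The rows in \<open>K j\<close> of \<open>bmat\<close> form the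
  \<open>K\<close>-coordinate times the identity, which determines this determinant. Both sides are
  forms of the same degree in the vector.\<close>

lemma plucker_segre_relation:
  assumes K: "plv m n d a K \<noteq> 0" and I: "I \<in> multi_index m n d"
  shows "plv m n d a I * plv m n d a K ^ (\<Sum>j=1..n. d j)
    = plv m n d a K * (\<Prod>j=1..n. minor (d j) (bmat m d K j (plv m n d a)) (pick (I j)))"
proof -
  note K' = plv_nonzero_minor[OF K]
  let ?y = "plv m n d a"
  have *: "minor (d j) (bmat m d K j ?y) (pick (I j)) * minor (d j) (a j) (pick (K j))
      = minor (d j) (a j) (pick (I j)) * ?y K ^ d j" if j: "j \<in> {1..n}" for j
  proof -
    obtain Y where Y: "\<And>r s. r < m \<Longrightarrow> s < d j \<Longrightarrow> bmat m d K j ?y r s = mprod (d j) (a j) Y r s"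
      using bmat_plv_span[OF K j] by metis
    have "minor (d j) (bmat m d K j ?y) (pick (J j)) = minor (d j) (a j) (pick (J j)) * fdet (d j) Y"
      if "J \<in> multi_index m n d" for J
      unfolding minor_mprod[symmetric] by (rule minor_cong) (rule Y, use pick_less[OF that j] in auto)
    moreover have "minor (d j) (bmat m d K j ?y) (pick (K j)) = ?y K ^ d j"
      by (rule minor_scalar) (rule bmat_diag[OF K'(1) j])
    ultimately show ?thesis using I K'(1) by (simp add: ac_simps)
  qed
  have "(\<Prod>j=1..n. minor (d j) (bmat m d K j ?y) (pick (I j))) * ?y K
      = (\<Prod>j=1..n. minor (d j) (a j) (pick (I j)) * ?y K ^ d j)"
    using K' by (simp add: plv_def prod.distrib[symmetric] * plv_def[symmetric])
  also have "\<dots> = ?y I * ?y K ^ (\<Sum>j=1..n. d j)"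
    using I by (simp add: plv_def prod.distrib power_sum)
  finally show ?thesis by (simp add: mult.commute)
qed

text \<open>On the rows in \<open>K (Suc j)\<close> the matrix \<open>b (Suc j)\<close> is the
  \<open>K\<close>-coordinate times the identity, so the factor expressing \<open>A j\<close> times
  \<open>b j\<close> through \<open>b (Suc j)\<close> can be read off there. Clearing the
  denominator gives a quadratic equation in the coordinates.\<close>

lemma incidence_relation:
  assumes K: "plv m n d a K \<noteq> 0" and inc: "incident m n d A a" and j: "j \<in> {1..<n}"
    and r: "r < m" and s: "s < d j"
  defines "b \<equiv> \<lambda>j. bmat m d K j (plv m n d a)"
  shows "plv m n d a K * mprod m (A j) (b j) r s
    = (\<Sum>q<d (Suc j). b (Suc j) r q * mprod m (A j) (b j) (pick (K (Suc j)) q) s)"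
proof -
  let ?y = "plv m n d a" and ?e = "d (Suc j)"
  note K' = plv_nonzero_minor[OF K]
  have j1: "j \<in> {1..n}" and j2: "Suc j \<in> {1..n}" using j by auto
  obtain Y where Y: "\<And>r s. r < m \<Longrightarrow> s < d j \<Longrightarrow> b j r s = mprod (d j) (a j) Y r s"
    unfolding b_def using bmat_plv_span[OF K j1] by metis
  obtain Z where Z: "fdet ?e Z \<noteq> 0"
    "\<And>r s. r < m \<Longrightarrow> s < ?e \<Longrightarrow> b (Suc j) r s = mprod ?e (a (Suc j)) Z r s"
    unfolding b_def using bmat_plv_span[OF K j2] by metis
  from inc j obtain X where X: "\<And>r c. r < m \<Longrightarrow> c < d j \<Longrightarrow>
      mprod m (A j) (a j) r c = mprod ?e (a (Suc j)) X r c"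
    unfolding incident_def by blast
  obtain W where W: "\<And>X r c. r < ?e \<Longrightarrow> mprod ?e Z (mprod ?e W X) r c = X r c"
    using mprod_right_cancel[OF Z(1)] by metis
  \<comment> \<open>The factor \<open>X\<close> for \<open>a\<close>, transported by the base
    changes: the inverse of \<open>Z\<close>, then \<open>X\<close>, then \<open>Y\<close>.\<close>
  define V where "V = mprod ?e W (mprod (d j) X Y)"
  have AbV: "mprod m (A j) (b j) r s = mprod ?e (b (Suc j)) V r s" if r: "r < m" for r
  proof -
    have "mprod m (A j) (b j) r s = mprod m (A j) (mprod (d j) (a j) Y) r s"
      by (rule mprod_cong) (use Y s in auto)
    also have "\<dots> = mprod (d j) (mprod m (A j) (a j)) Y r s" by (simp add: mprod_assoc)
    also have "\<dots> = mprod (d j) (mprod ?e (a (Suc j)) X) Y r s"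
      by (rule mprod_cong) (use X r in auto)
    also have "\<dots> = mprod ?e (a (Suc j)) (mprod (d j) X Y) r s" by (rule mprod_assoc)
    also have "\<dots> = mprod ?e (a (Suc j)) (mprod ?e Z V) r s"
      unfolding V_def by (rule mprod_cong) (use W in auto)
    also have "\<dots> = mprod ?e (mprod ?e (a (Suc j)) Z) V r s" by (simp add: mprod_assoc)
    also have "\<dots> = mprod ?e (b (Suc j)) V r s"
      by (rule mprod_cong) (use Z r in auto)
    finally show ?thesis .
  qed
  have "mprod m (A j) (b j) (pick (K (Suc j)) q) s = ?y K * V q s" if q: "q < ?e" for q
  proof -
    have "mprod ?e (b (Suc j)) V (pick (K (Suc j)) q) s = ?y K * V q s"
      by (rule mprod_delta_left[OF q]) (use bmat_diag[OF K'(1) j2 q] in \<open>auto simp: b_def\<close>)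
    then show ?thesis using AbV[OF pick_less[OF K'(1) j2 q]] by simp
  qed
  then have "(\<Sum>q<?e. b (Suc j) r q * mprod m (A j) (b j) (pick (K (Suc j)) q) s)
      = (\<Sum>q<?e. ?y K * (b (Suc j) r q * V q s))"
    by (intro sum.cong) auto
  also have "\<dots> = ?y K * mprod m (A j) (b j) r s"
    unfolding AbV[OF r] by (simp add: mprod_def sum_distrib_left)
  finally show ?thesis by simp
qed

theorem zariski_closed_flag_vecs: "zariski_closed (multi_index m n d) (line ` flag_vecs m n d A)"
proof (rule zariski_closed_lineI)
  fix y assume "y \<in> flag_vecs m n d A"
  then show "y \<noteq> (\<lambda>_. 0) \<and> (\<forall>a. a \<notin> multi_index m n d \<longrightarrow> y a = 0)"
    unfolding flag_vecs_def using plv_nonzero_iff[of m n d] plv_outside by fastforce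
next
  let ?M = "multi_index m n d"
  fix x :: "(nat \<Rightarrow> nat set) \<Rightarrow> complex"
  assume x0: "x \<noteq> (\<lambda>_. 0)" and xs: "\<And>a. a \<notin> ?M \<Longrightarrow> x a = 0"
    and xv: "\<And>f e. hform ?M e f \<Longrightarrow> (\<And>y. y \<in> flag_vecs m n d A \<Longrightarrow> f y = 0) \<Longrightarrow> f x = 0"
  from x0 obtain K where xK: "x K \<noteq> 0" by auto
  then have K: "K \<in> ?M" using xs by blast
  then have ne: "?M \<noteq> {}" by auto
  define D where "D = (\<Sum>j=1..n. d j)"
  define b where "b j = bmat m d K j x" for j
  have rel: "x I * x K ^ D = x K * plv m n d b I" if I: "I \<in> ?M" for I
  proof -
    let ?f = "\<lambda>x. x K * (x I * x K ^ D - x K * (\<Prod>j=1..n. minor (d j) (bmat m d K j x) (pick (I j))))"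
    have "hform ?M (1 + (1 + 1 * D)) ?f"
    proof (intro hform.mult hform_diff hform_power hform.coord I K)
      have "hform ?M (\<Sum>j=1..n. d j * 1) (\<lambda>x. \<Prod>j=1..n. minor (d j) (bmat m d K j x) (pick (I j)))"
        using I by (intro hform_prod hform_minor ne hform_bmat K) (auto intro: pick_less)
      then show "hform ?M (1 * D) (\<lambda>x. \<Prod>j=1..n. minor (d j) (bmat m d K j x) (pick (I j)))"
        by (simp add: D_def)
    qed
    moreover have "?f y = 0" if "y \<in> flag_vecs m n d A" for y
      using that plucker_segre_relation[OF _ I, where K = K] by (auto simp: flag_vecs_def D_def)
    ultimately have "?f x = 0" by (rule xv)
    then show ?thesis using xK I by (simp add: plv_def b_def)
  qed
  have plvb: "plv m n d b = (\<lambda>I. (x K ^ D / x K) * x I)"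
  proof
    fix I show "plv m n d b I = (x K ^ D / x K) * x I"
      using rel[of I] xK xs plv_outside by (cases "I \<in> ?M") (auto simp: field_simps)
  qed
  have "line (plv m n d b) = line x"
    unfolding plvb by (rule line_scale) (use xK in simp)
  moreover have "plv m n d b \<in> flag_vecs m n d A"
    unfolding flag_vecs_def
  proof (intro CollectI exI[of _ b] conjI refl)
    have "plv m n d b K \<noteq> 0" using plvb xK by simp
    then have "plv m n d b \<noteq> (\<lambda>_. 0)" by auto
    then show "\<forall>j\<in>{1..n}. full_rank m (d j) (b j)" by (simp add: plv_nonzero_iff)
    show "incident m n d A b" unfolding incident_def
    proof
      fix j assume j: "j \<in> {1..<n}"
      then have j1: "j \<in> {1..n}" and j2: "Suc j \<in> {1..n}" by auto
      \<comment> \<open>The factor as read off from the rows in \<open>K (Suc j)\<close>, on which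
        \<open>b (Suc j)\<close> is \<open>x K\<close> times the identity.\<close>
      define X where "X q s = mprod m (A j) (b j) (pick (K (Suc j)) q) s / x K" for q s
      have "mprod m (A j) (b j) r s = mprod (d (Suc j)) (b (Suc j)) X r s" if r: "r < m" and s: "s < d j" for r s
      proof -
        let ?f = "\<lambda>x. x K * (x K * mprod m (A j) (bmat m d K j x) r s
          - (\<Sum>q<d (Suc j). bmat m d K (Suc j) x r q * mprod m (A j) (bmat m d K j x) (pick (K (Suc j)) q) s))"
        have lin: "hform ?M 1 (\<lambda>x. mprod m (A j) (bmat m d K j x) r s)" if "r < m" for r
          unfolding mprod_def by (intro hform_sum hform_scale ne hform_bmat K j1) auto
        have "hform ?M (1 + (1 + 1)) ?f"
          using r by (intro hform.mult hform_diff hform.coord K hform_sum ne hform_bmat j2 lin pick_less[OF K j2]) auto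
        moreover have "?f y = 0" if "y \<in> flag_vecs m n d A" for y
          using that incidence_relation[where d = d and K = K, OF _ _ j r s] by (auto simp: flag_vecs_def)
        ultimately have "?f x = 0" by (rule xv)
        then have "x K * mprod m (A j) (b j) r s = (\<Sum>q<d (Suc j). b (Suc j) r q * (x K * X q s))"
          using xK by (simp add: b_def X_def)
        also have "\<dots> = x K * mprod (d (Suc j)) (b (Suc j)) X r s"
          by (simp add: mprod_def sum_distrib_left mult.left_commute)
        finally show ?thesis using xK by simp
      qed
      then show "\<exists>X. \<forall>r<m. \<forall>c<d j. mprod m (A j) (b j) r c = mprod (d (Suc j)) (b (Suc j)) X r c" by blast
    qed
  qed
  ultimately show "line x \<in> line ` flag_vecs m n d A" by (metis imageI)
qed

section \<open>The flags in the larger space\<close>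

lemma sum_lessThan_add: "(\<Sum>k<h + j. f k) = (\<Sum>k<h. f k) + (\<Sum>k<j. f (h + k))" for f :: "nat \<Rightarrow> complex"
  by (induction j) auto

lemma pick_prefix:
  assumes "{..<h} \<subseteq> J" "r < h"
  shows "pick J r = r"
  using assms(2)
proof (induction r rule: less_induct)
  case (less r)
  show ?case
  proof (cases r)
    case 0
    then have "0 \<in> J" using less assms(1) by auto
    then show ?thesis using 0 by (auto intro!: Least_equality)
  next
    case (Suc q)
    moreover have "(LEAST a. a \<in> J \<and> a > q) = Suc q"
      by (rule Least_equality) (use less Suc assms(1) in auto)
    ultimately show ?thesis using less by simp
  qed
qed

text \<open>The image is cut out by the coordinates outside \<open>G\<close> together with the
  equations of the original set composed with the linear map \<open>T'\<close>.\<close>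

lemma zariski_closed_push:
  fixes V :: "('i \<Rightarrow> complex) set" and T :: "('i \<Rightarrow> complex) \<Rightarrow> ('j \<Rightarrow> complex)"
  assumes closed: "zariski_closed A (line ` V)"
    and V: "\<And>y. y \<in> V \<Longrightarrow> y \<noteq> (\<lambda>_. 0) \<and> (\<forall>a. a \<notin> A \<longrightarrow> y a = 0)"
    and T'T: "\<And>y. y \<in> V \<Longrightarrow> T' (T y) = y"
    and Tsupp: "\<And>y b. y \<in> V \<Longrightarrow> b \<notin> G \<Longrightarrow> T y b = 0"
    and G: "G \<subseteq> B"
    and TT': "\<And>x. (\<And>b. b \<notin> G \<Longrightarrow> x b = 0) \<Longrightarrow> T (T' x) = x"
    and T'supp: "\<And>x a. a \<notin> A \<Longrightarrow> T' x a = 0"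
    and T'lin: "\<And>a. a \<in> A \<Longrightarrow> hform B 1 (\<lambda>x. T' x a)"
    and Tscale: "\<And>c y. T (\<lambda>a. c * y a) = (\<lambda>b. c * T y b)"
  shows "zariski_closed B (line ` T ` V)"
proof (rule zariski_closed_lineI)
  fix y assume "y \<in> T ` V"
  then obtain v where v: "v \<in> V" "y = T v" by blast
  have "y \<noteq> (\<lambda>_. 0)"
  proof
    assume y0: "y = (\<lambda>_. 0)"
    have "v = T' (T v)" using T'T v by simp
    also have "T v = (\<lambda>b. 0)" using v y0 by simp
    also have "T' (\<lambda>b. 0) = (\<lambda>_. 0)"
    proof
      fix a show "T' (\<lambda>b. 0) a = 0"
      proof (cases "a \<in> A")
        case True
        then show ?thesis using hform_homogeneous[OF T'lin, of a 0 "\<lambda>_. 0"] by simp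
      qed (rule T'supp)
    qed
    finally show False using V v by blast
  qed
  then show "y \<noteq> (\<lambda>_. 0) \<and> (\<forall>a. a \<notin> B \<longrightarrow> y a = 0)" using Tsupp v G by blast
next
  fix x assume x0: "x \<noteq> (\<lambda>_. 0)" and xs: "\<And>b. b \<notin> B \<Longrightarrow> x b = 0"
    and xv: "\<And>f d. hform B d f \<Longrightarrow> (\<And>y. y \<in> T ` V \<Longrightarrow> f y = 0) \<Longrightarrow> f x = 0"
  have "x b = 0" if "b \<notin> G" for b
    using xs xv[OF hform.coord[of b B]] Tsupp that by (cases "b \<in> B") auto
  then have x: "T (T' x) = x" by (rule TT')
  have T'0: "T' x \<noteq> (\<lambda>_. 0)"
  proof
    assume "T' x = (\<lambda>_. 0)"
    then have "x = T (\<lambda>a. 0 * 0)" using x by simp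
    also have "\<dots> = (\<lambda>b. 0)" unfolding Tscale by simp
    finally show False using x0 by simp
  qed
  obtain S where S: "\<forall>f\<in>S. \<exists>d. hform A d f" "line ` V = {p \<in> proj_space A. \<forall>f\<in>S. \<forall>x\<in>p. f x = 0}"
    using closed unfolding zariski_closed_def by blast
  have "line (T' x) \<in> line ` V"
    unfolding S(2)
  proof (intro CollectI conjI ballI)
    show "line (T' x) \<in> proj_space A" using T'0 T'supp unfolding proj_space_def by blast
    fix f y assume f: "f \<in> S" and y: "y \<in> line (T' x)"
    obtain d where d: "hform A d f" using S(1) f by blast
    have "hform B d (\<lambda>x. f (T' x))" by (rule hform_subst[OF d T'lin])
    moreover have "f (T' y) = 0" if "y \<in> T ` V" for y
    proof -
      obtain v where v: "v \<in> V" "y = T v" using \<open>y \<in> T ` V\<close> by blast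
      then have "line v \<in> {p \<in> proj_space A. \<forall>f\<in>S. \<forall>x\<in>p. f x = 0}" using S(2) by blast
      then show ?thesis using f v T'T mem_line_self by fastforce
    qed
    ultimately have "f (T' x) = 0" by (rule xv)
    then show "f y = 0" using y hform_homogeneous[OF d] by (auto simp: mem_line_iff)
  qed
  then obtain v where v: "v \<in> V" "line (T' x) = line v" by blast
  obtain c where c: "c \<noteq> 0" "T' x = (\<lambda>a. c * v a)" using line_eqD[OF v(2) T'0] by blast
  then have "x = (\<lambda>b. c * T v b)" using x Tscale by metis
  then have "line x = line (T v)" using line_scale[OF c(1)] by metis
  then show "line x \<in> line ` T ` V" using v by blast
qed

text \<open>The placement of the basis vectors, abstracted from \<open>i\<close>: \<open>win\<close>
  takes a position of the larger space to the 0-based index of the vector put there, and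
  \<open>h j\<close> is where the window of \<open>j\<close> starts. For \<open>j\<close> in
  \<open>kill\<close>, the index \<open>j\<close> leaves at position \<open>h j\<close> and returns
  at \<open>h j + n + 1\<close>.\<close>

locale window =
  fixes n k :: nat and h win :: "nat \<Rightarrow> nat" and kill :: "nat set"
  assumes h_le: "j \<in> {1..n} \<Longrightarrow> h j \<le> k"
    and h_Suc: "j \<in> {1..<n} \<Longrightarrow> h (Suc j) = h j + (if j \<in> kill then 1 else 0)"
    and win_bij: "j \<in> {1..n} \<Longrightarrow> bij_betw win {h j..<h j + n + 1} {..<n + 1}"
    and win_kill: "j \<in> {1..<n} \<Longrightarrow> j \<in> kill \<Longrightarrow> win (h j) = j \<and> win (h j + n + 1) = j"
begin

definition "N = n + 1 + k"
definition dm :: "nat \<Rightarrow> nat" where "dm j = h j + j"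

lemma window_le: "j \<in> {1..n} \<Longrightarrow> h j + n + 1 \<le> N"
  using h_le[of j] by (simp add: N_def)

text \<open>A basis of the enlarged space: block diagonal, with the identity for the forced vectors
  and the rows of \<open>a\<close> rearranged by \<open>win\<close>, above zero rows.\<close>

definition flag_mat :: "nat \<Rightarrow> (nat \<Rightarrow> nat \<Rightarrow> complex) \<Rightarrow> nat \<Rightarrow> nat \<Rightarrow> complex"
  where "flag_mat j a r c = (if r < h j then if c = r then 1 else 0
     else if r < h j + n + 1 \<and> h j \<le> c then a (win r) (c - h j) else 0)"

text \<open>The matrix of \<open>f\<^sub>j\<close>. Indices count from 0, so \<open>j\<close> stands
  for the basis vector numbered \<open>j + 1\<close>.\<close>

definition kill_mat :: "nat \<Rightarrow> nat \<Rightarrow> nat \<Rightarrow> complex"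
  where "kill_mat j r s = (if r = s \<and> \<not> (j \<in> kill \<and> r = j) then 1 else 0)"

text \<open>The coordinates that can be nonzero on enlarged flags; the others vanish by
  \<open>minor_flag_mat_bad\<close>.\<close>

definition good :: "(nat \<Rightarrow> nat set) set"
  where "good = {J \<in> multi_index N n dm. \<forall>j\<in>{1..n}. {..<h j} \<subseteq> J j \<and> J j \<subseteq> {..<h j + n + 1}}"

definition down :: "(nat \<Rightarrow> nat set) \<Rightarrow> nat \<Rightarrow> nat set"
  where "down J = (\<lambda>j\<in>{1..n}. win ` (J j - {..<h j}))"

definition up :: "(nat \<Rightarrow> nat set) \<Rightarrow> nat \<Rightarrow> nat set"
  where "up I = (\<lambda>j\<in>{1..n}. {..<h j} \<union> {r \<in> {h j..<h j + n + 1}. win r \<in> I j})"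

text \<open>\<open>win\<close> does not preserve the order of positions, hence a sorting sign for
  each \<open>j\<close>.\<close>

definition sgn_up :: "(nat \<Rightarrow> nat set) \<Rightarrow> complex"
  where "sgn_up J = (\<Prod>j=1..n. sort_sign j (\<lambda>q. win (pick (J j) (h j + q))))"

definition T :: "((nat \<Rightarrow> nat set) \<Rightarrow> complex) \<Rightarrow> (nat \<Rightarrow> nat set) \<Rightarrow> complex"
  where "T x J = (if J \<in> good then sgn_up J * x (down J) else 0)"

definition T' :: "((nat \<Rightarrow> nat set) \<Rightarrow> complex) \<Rightarrow> (nat \<Rightarrow> nat set) \<Rightarrow> complex"
  where "T' y I = (if I \<in> multi_index (n + 1) n (\<lambda>j. j) then y (up I) / sgn_up (up I) else 0)"

lemma mprod_flag_mat:
  "mprod (h j + e) (flag_mat j b) X r c =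
    (if r < h j then X r c else if r < h j + n + 1 then mprod e b (\<lambda>q. X (h j + q)) (win r) c else 0)"
proof -
  have "(\<Sum>k<h j. flag_mat j b r k * X k c) = (if r < h j then X r c else 0)"
  proof -
    have "(\<Sum>k<h j. flag_mat j b r k * X k c) = (\<Sum>k<h j. if k = r then X k c else 0)"
      by (intro sum.cong) (auto simp: flag_mat_def)
    then show ?thesis by simp
  qed
  then show ?thesis
    unfolding mprod_def sum_lessThan_add by (auto simp: flag_mat_def)
qed

lemma win_less: "j \<in> {1..n} \<Longrightarrow> r \<in> {h j..<h j + n + 1} \<Longrightarrow> win r < n + 1"
  using win_bij[of j] by (auto simp: bij_betw_def)

lemma win_eq: "j \<in> {1..n} \<Longrightarrow> r \<in> {h j..<h j + n + 1} \<Longrightarrow> s \<in> {h j..<h j + n + 1} \<Longrightarrow> win r = win s \<longleftrightarrow> r = s"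
  using win_bij[of j] by (auto simp: bij_betw_def inj_on_eq_iff)

lemma win_surj: "j \<in> {1..n} \<Longrightarrow> s < n + 1 \<Longrightarrow> \<exists>r\<in>{h j..<h j + n + 1}. win r = s"
proof -
  assume "j \<in> {1..n}" "s < n + 1"
  then have "s \<in> win ` {h j..<h j + n + 1}"
    using bij_betw_imp_surj_on[OF win_bij[of j]] by simp
  then show ?thesis by blast
qed

lemma mprod_kill_mat:
  assumes "r < n + 1"
  shows "mprod (n + 1) (kill_mat j) a r c = (if j \<in> kill \<and> r = j then 0 else a r c)"
  by (subst mprod_delta_left[where t = "if j \<in> kill \<and> r = j then 0 else 1", OF assms]) (auto simp: kill_mat_def)

text \<open>The killed index occurs once in the next window, namely in the position just beyond the
  current one. If nothing is killed, the two windows coincide.\<close>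

lemma kill_iff:
  assumes j: "j \<in> {1..<n}" and r: "r \<in> {h (Suc j)..<h (Suc j) + n + 1}"
  shows "j \<in> kill \<and> win r = j \<longleftrightarrow> \<not> r < h j + n + 1"
proof (cases "j \<in> kill")
  case True
  have h: "h (Suc j) = h j + 1" "win (h j + n + 1) = j" using h_Suc[OF j] win_kill[OF j] True by simp_all
  have "win r = win (h j + n + 1) \<longleftrightarrow> r = h j + n + 1"
    by (rule win_eq[of "Suc j"]) (use r j h(1) in auto)
  moreover have "r = h j + n + 1 \<longleftrightarrow> \<not> r < h j + n + 1" using r h(1) by auto
  ultimately show ?thesis using True unfolding h(2) by blast
next
  case False
  then show ?thesis using h_Suc[OF j] r by auto
qed

text \<open>The unit vectors absorb the rows with index less than \<open>h (Suc j)\<close>, among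
  them the one leaving the window. On the rest of the next window, \<open>kill_iff\<close> makes the
  copy of the space at \<open>j\<close> agree with its image under
  \<open>kill_mat j\<close>.\<close>

lemma flag_mat_nested_iff:
  assumes j: "j \<in> {1..<n}"
  shows "(\<exists>X. \<forall>r<N. \<forall>c<dm j. flag_mat j a r c = mprod (dm (Suc j)) (flag_mat (Suc j) b) X r c)
    \<longleftrightarrow> (\<exists>X. \<forall>r<n + 1. \<forall>c<j. mprod (n + 1) (kill_mat j) a r c = mprod (Suc j) b X r c)"
proof (intro iffI; elim exE)
  fix X assume X: "\<forall>r<N. \<forall>c<dm j. flag_mat j a r c = mprod (dm (Suc j)) (flag_mat (Suc j) b) X r c"
  define X2 where "X2 q c = X (h (Suc j) + q) (h j + c)" for q c
  show "\<exists>X. \<forall>r<n + 1. \<forall>c<j. mprod (n + 1) (kill_mat j) a r c = mprod (Suc j) b X r c"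
  proof (intro exI[of _ X2] allI impI)
    fix s c assume s: "s < n + 1" and c: "c < j"
    obtain r where r: "r \<in> {h (Suc j)..<h (Suc j) + n + 1}" "win r = s"
      using win_surj[of "Suc j" s] j s by auto
    have "r < N" using r window_le[of "Suc j"] j by auto
    then have "flag_mat j a r (h j + c) = mprod (dm (Suc j)) (flag_mat (Suc j) b) X r (h j + c)"
      using X c by (auto simp: dm_def)
    also have "\<dots> = mprod (Suc j) b X2 s c"
      using r unfolding dm_def mprod_flag_mat by (auto simp: mprod_def X2_def)
    finally have "flag_mat j a r (h j + c) = mprod (Suc j) b X2 s c" .
    moreover have "h j \<le> r" using r h_Suc[OF j] by (auto split: if_splits)
    ultimately show "mprod (n + 1) (kill_mat j) a s c = mprod (Suc j) b X2 s c"
      unfolding mprod_kill_mat[OF s] using kill_iff[OF j r(1)] r by (auto simp: flag_mat_def)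
  qed
next
  fix X assume X: "\<forall>r<n + 1. \<forall>c<j. mprod (n + 1) (kill_mat j) a r c = mprod (Suc j) b X r c"
  \<comment> \<open>The coefficients of the unit vectors are the first rows of
    \<open>flag_mat j a\<close> themselves. The rest is \<open>X\<close>, moved past the unit
    vectors, and 0 for the columns that are already unit vectors.\<close>
  define X2 where "X2 q c = (if q < h (Suc j) then flag_mat j a q c
     else if c < h j then 0 else X (q - h (Suc j)) (c - h j))" for q c
  show "\<exists>X. \<forall>r<N. \<forall>c<dm j. flag_mat j a r c = mprod (dm (Suc j)) (flag_mat (Suc j) b) X r c"
  proof (intro exI[of _ X2] allI impI)
    fix r c assume r: "r < N" and c: "c < dm j"
    have hj: "h j \<le> h (Suc j)" "h (Suc j) \<le> h j + 1" using h_Suc[OF j] by auto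
    consider "r < h (Suc j)" | "r \<in> {h (Suc j)..<h (Suc j) + n + 1}" | "h (Suc j) + n + 1 \<le> r" by force
    then show "flag_mat j a r c = mprod (dm (Suc j)) (flag_mat (Suc j) b) X2 r c"
    proof cases
      case 1
      then show ?thesis unfolding dm_def mprod_flag_mat by (simp add: X2_def)
    next
      case 3
      then show ?thesis unfolding dm_def mprod_flag_mat using hj by (auto simp: flag_mat_def)
    next
      case 2
      have "mprod (dm (Suc j)) (flag_mat (Suc j) b) X2 r c = mprod (Suc j) b (\<lambda>q. X2 (h (Suc j) + q)) (win r) c"
        using 2 unfolding dm_def mprod_flag_mat by auto
      also have "\<dots> = (if c < h j then 0 else mprod (Suc j) b X (win r) (c - h j))"
        by (auto simp: mprod_def X2_def)
      also have "\<dots> = flag_mat j a r c"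
      proof (cases "c < h j")
        case True
        then show ?thesis using 2 hj by (auto simp: flag_mat_def)
      next
        case False
        have w: "win r < n + 1" using 2 j by (intro win_less[of "Suc j"]) auto
        have "mprod (Suc j) b X (win r) (c - h j) = mprod (n + 1) (kill_mat j) a (win r) (c - h j)"
          using X w c False by (auto simp: dm_def)
        then show ?thesis
          unfolding mprod_kill_mat[OF w] using kill_iff[OF j 2] False 2 hj by (auto simp: flag_mat_def)
      qed
      finally show ?thesis by simp
    qed
  qed
qed

text \<open>As \<open>J\<close> contains \<open>{..<h j}\<close>, \<open>pick J\<close> is the
  identity there and the submatrix is block diagonal. The second block consists of rows of
  \<open>a\<close> in the order given by \<open>win\<close>; sorting them costs the sign.\<close>

lemma minor_flag_mat_good:
  assumes j: "j \<in> {1..n}" and J: "{..<h j} \<subseteq> J" "J \<subseteq> {..<h j + n + 1}" "card J = dm j"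
  defines "\<alpha> \<equiv> \<lambda>q. win (pick J (h j + q))"
  shows "inj_on \<alpha> {..<j}" "\<alpha> ` {..<j} = win ` (J - {..<h j})"
    "minor (dm j) (flag_mat j a) (pick J) = sort_sign j \<alpha> * minor j a (pick (win ` (J - {..<h j})))"
proof -
  have fin: "finite J" using J(2) finite_subset by blast
  have pin: "pick J r \<in> J" if "r < dm j" for r using that J(3) by (intro pick_in_set_le) auto
  have inj: "inj_on (pick J) {..<dm j}" using pick_inj_on[of J] J(3) by simp
  have pre: "pick J r = r" if "r < h j" for r using pick_prefix[OF J(1) that] .
  have post: "h j \<le> pick J (h j + q)" if "q < j" for q
  proof (rule ccontr)
    assume "\<not> h j \<le> pick J (h j + q)"
    then have *: "pick J (pick J (h j + q)) = pick J (h j + q)" "pick J (h j + q) < h j" using pre by auto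
    then have "pick J (h j + q) = h j + q"
      using inj_onD[OF inj *(1)] that by (auto simp: dm_def)
    with * show False by simp
  qed
  have rng: "pick J (h j + q) \<in> {h j..<h j + n + 1}" if "q < j" for q
    using post[OF that] pin[of "h j + q"] that J(2) by (auto simp: dm_def)
  show injA: "inj_on \<alpha> {..<j}"
  proof (rule inj_onI)
    fix p q assume pq: "p \<in> {..<j}" "q \<in> {..<j}" "\<alpha> p = \<alpha> q"
    then have "pick J (h j + p) = pick J (h j + q)"
      using win_eq[OF j rng rng, of p q] by (auto simp: \<alpha>_def)
    then show "p = q" using inj_onD[OF inj, of "h j + p" "h j + q"] pq by (auto simp: dm_def)
  qed
  have im: "J - {..<h j} = (\<lambda>q. pick J (h j + q)) ` {..<j}"
  proof
    show "J - {..<h j} \<subseteq> (\<lambda>q. pick J (h j + q)) ` {..<j}"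
    proof
      fix r assume r: "r \<in> J - {..<h j}"
      have "pick J ` {..<dm j} = J" using pick_image[OF fin] J(3) by simp
      then obtain s where s: "s < dm j" "r = pick J s" using r by blast
      then have "\<not> s < h j" using pre r by auto
      then show "r \<in> (\<lambda>q. pick J (h j + q)) ` {..<j}"
        using s by (intro image_eqI[of _ _ "s - h j"]) (auto simp: dm_def)
    qed
    show "(\<lambda>q. pick J (h j + q)) ` {..<j} \<subseteq> J - {..<h j}"
    proof
      fix r assume "r \<in> (\<lambda>q. pick J (h j + q)) ` {..<j}"
      then obtain q where "q < j" "r = pick J (h j + q)" by blast
      then show "r \<in> J - {..<h j}" using post[of q] pin[of "h j + q"] by (auto simp: dm_def)
    qed
  qed
  show imA: "\<alpha> ` {..<j} = win ` (J - {..<h j})"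
    unfolding im image_image \<alpha>_def ..
  have "mat (dm j) (dm j) (\<lambda>(r, c). flag_mat j a (pick J r) c)
      = four_block_mat (1\<^sub>m (h j)) (0\<^sub>m (h j) j) (0\<^sub>m j (h j)) (mat j j (\<lambda>(r, c). a (\<alpha> r) c))" (is "?L = ?R")
  proof (rule eq_matI)
    fix r c assume rc: "r < dim_row ?R" "c < dim_col ?R"
    show "?L $$ (r, c) = ?R $$ (r, c)"
    proof (cases "r < h j")
      case True
      then show ?thesis using rc pre by (auto simp: flag_mat_def dm_def)
    next
      case False
      then have "pick J r \<in> {h j..<h j + n + 1}" using rng[of "r - h j"] rc by auto
      then show ?thesis using rc False by (auto simp: flag_mat_def dm_def \<alpha>_def)
    qed
  qed (auto simp: dm_def)
  moreover have "det ?R = 1 * minor j a \<alpha>"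
    unfolding minor_def by (subst det_four_block_mat_lower_left_zero[of _ "h j" _ j]) auto
  ultimately have "minor (dm j) (flag_mat j a) (pick J) = minor j a \<alpha>"
    unfolding minor_def by (simp only: mult_1)
  also have "\<dots> = sort_sign j \<alpha> * minor j a (pick (\<alpha> ` {..<j}))"
    by (rule sort_sign(2)[OF injA])
  finally show "minor (dm j) (flag_mat j a) (pick J) = sort_sign j \<alpha> * minor j a (pick (win ` (J - {..<h j})))"
    unfolding imA .
qed

text \<open>Rows beyond the window are zero. If some \<open>x < h j\<close> is missing from
  \<open>J\<close>, then column \<open>x\<close> of the submatrix is zero, since that column of
  \<open>flag_mat\<close> has its only nonzero entry in row \<open>x\<close>.\<close>

lemma minor_flag_mat_bad:
  assumes j: "j \<in> {1..n}" and J: "finite J" "card J = dm j" "\<not> ({..<h j} \<subseteq> J \<and> J \<subseteq> {..<h j + n + 1})"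
  shows "minor (dm j) (flag_mat j a) (pick J) = 0"
proof (cases "J \<subseteq> {..<h j + n + 1}")
  case False
  then obtain r where r: "r \<in> J" "h j + n + 1 \<le> r" by force
  have "pick J ` {..<dm j} = J" using pick_image[OF J(1)] J(2) by simp
  then obtain q where "q < dm j" "pick J q = r" using r by (metis imageE lessThan_iff)
  then show ?thesis using r by (intro minor_zero_row[of q]) (auto simp: flag_mat_def)
next
  case True
  then obtain x where x: "x < h j" "x \<notin> J" using J(3) by auto
  show ?thesis
  proof (rule ccontr)
    assume *: "minor (dm j) (flag_mat j a) (pick J) \<noteq> 0"
    \<comment> \<open>The entry at \<open>x\<close> of the unit vector that the zero column puts
      into the kernel.\<close>
    have "(if x = x then 1 else 0) = (0::complex)"
    proof (rule minor_kernel[OF *, of "\<lambda>l. if l = x then 1 else 0"])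
      fix q assume "q < dm j"
      then have "pick J q \<in> J" using J(2) by (intro pick_in_set_le) auto
      then have "pick J q \<noteq> x" using x by auto
      have "(\<Sum>k<dm j. flag_mat j a (pick J q) k * (if k = x then 1 else 0))
          = (\<Sum>k<dm j. if k = x then flag_mat j a (pick J q) k else 0)"
        by (intro sum.cong) auto
      also have "\<dots> = 0"
        using x \<open>pick J q \<noteq> x\<close> by (auto simp: flag_mat_def)
      finally show "(\<Sum>k<dm j. flag_mat j a (pick J q) k * (if k = x then 1 else 0)) = 0" .
    qed (use x in \<open>auto simp: dm_def\<close>)
    then show False by simp
  qed
qed

lemma sgn_up_nonzero:
  assumes "J \<in> good"
  shows "sgn_up J \<noteq> 0"
proof -
  have "sort_sign j (\<lambda>q. win (pick (J j) (h j + q))) \<noteq> 0" if j: "j \<in> {1..n}" for j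
    using assms j multi_index_memD[of J N n dm j]
    by (intro sort_sign(1) minor_flag_mat_good(1)[OF j]) (auto simp: good_def)
  then show ?thesis by (simp add: sgn_up_def)
qed

lemma win_image_preimage:
  assumes "j \<in> {1..n}" "S \<subseteq> {..<n + 1}"
  shows "win ` {r \<in> {h j..<h j + n + 1}. win r \<in> S} = S"
proof
  show "S \<subseteq> win ` {r \<in> {h j..<h j + n + 1}. win r \<in> S}"
  proof
    fix s assume "s \<in> S"
    moreover from this obtain r where "r \<in> {h j..<h j + n + 1}" "win r = s"
      using win_surj[OF assms(1), of s] assms(2) by blast
    ultimately show "s \<in> win ` {r \<in> {h j..<h j + n + 1}. win r \<in> S}" by blast
  qed
qed blast

lemma down_mem:
  assumes "J \<in> good"
  shows "down J \<in> multi_index (n + 1) n (\<lambda>j. j)"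
proof -
  have "win ` (J j - {..<h j}) \<subseteq> {..<n + 1} \<and> card (win ` (J j - {..<h j})) = j" if j: "j \<in> {1..n}" for j
  proof -
    have J: "{..<h j} \<subseteq> J j" "J j \<subseteq> {..<h j + n + 1}" "card (J j) = dm j"
      using assms j multi_index_memD[of J N n dm j] by (auto simp: good_def)
    have "J j - {..<h j} \<subseteq> {h j..<h j + n + 1}" using J by auto
    then have "win ` (J j - {..<h j}) \<subseteq> {..<n + 1}" using win_less[OF j] by blast
    moreover have "card (win ` (J j - {..<h j})) = card {..<j}"
      unfolding minor_flag_mat_good(2)[OF j J, symmetric] by (rule card_image[OF minor_flag_mat_good(1)[OF j J]])
    ultimately show ?thesis by simp
  qed
  then show ?thesis by (auto simp: multi_index_def down_def atLeast0LessThan)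
qed

lemma up_mem:
  assumes I: "I \<in> multi_index (n + 1) n (\<lambda>j. j)"
  shows "up I \<in> good"
proof -
  have 1: "card {r \<in> {h j..<h j + n + 1}. win r \<in> I j} = j" if j: "j \<in> {1..n}" for j
  proof -
    have "win ` {r \<in> {h j..<h j + n + 1}. win r \<in> I j} = I j"
      by (rule win_image_preimage[OF j multi_index_memD(1)[OF I j]])
    moreover have "inj_on win {r \<in> {h j..<h j + n + 1}. win r \<in> I j}"
      using win_eq[OF j] by (auto intro!: inj_onI)
    ultimately show ?thesis using multi_index_memD(3)[OF I j] card_image by fastforce
  qed
  have "card (up I j) = dm j" if j: "j \<in> {1..n}" for j
    using j 1[OF j] by (auto simp: up_def dm_def) (subst card_Un_disjoint, auto)
  moreover have "up I j \<subseteq> {..<h j + n + 1}" if "j \<in> {1..n}" for j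
    using that by (auto simp: up_def)
  ultimately show ?thesis
    using window_le by (fastforce simp: good_def multi_index_def up_def)
qed

lemma down_up:
  assumes I: "I \<in> multi_index (n + 1) n (\<lambda>j. j)"
  shows "down (up I) = I"
proof
  fix j
  show "down (up I) j = I j"
  proof (cases "j \<in> {1..n}")
    case True
    have "up I j - {..<h j} = {r \<in> {h j..<h j + n + 1}. win r \<in> I j}"
      using True by (auto simp: up_def)
    moreover have "win ` {r \<in> {h j..<h j + n + 1}. win r \<in> I j} = I j"
      by (rule win_image_preimage[OF True multi_index_memD(1)[OF I True]])
    ultimately show ?thesis using True by (simp add: down_def)
  next
    case False
    then show ?thesis using I by (auto simp: down_def multi_index_def PiE_def extensional_def)
  qed
qed

lemma up_down:
  assumes J: "J \<in> good"
  shows "up (down J) = J"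
proof
  fix j
  show "up (down J) j = J j"
  proof (cases "j \<in> {1..n}")
    case True
    have J': "{..<h j} \<subseteq> J j" "J j \<subseteq> {..<h j + n + 1}" using J True by (auto simp: good_def)
    have "r \<in> J j" if r: "r \<in> {h j..<h j + n + 1}" "win r \<in> win ` (J j - {..<h j})" for r
    proof -
      obtain s where s: "s \<in> J j - {..<h j}" "win r = win s" using r(2) by blast
      then have "r = s" using win_eq[OF True, of r s] r J' by auto
      with s show ?thesis by blast
    qed
    then show ?thesis using True J' by (auto simp: up_def down_def)
  next
    case False
    then show ?thesis using J by (auto simp: up_def good_def multi_index_def PiE_def extensional_def)
  qed
qed

text \<open>The purpose of \<open>T\<close>: it performs the enlargement of flags on Pluecker-Segre
  vectors. Each coordinate is a product of the minors computed in \<open>minor_flag_mat_good\<close>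
  and \<open>minor_flag_mat_bad\<close>.\<close>

lemma T_plv: "T (plv (n + 1) n (\<lambda>j. j) a) = plv N n dm (\<lambda>j. flag_mat j (a j))"
proof
  fix J
  show "T (plv (n + 1) n (\<lambda>j. j) a) J = plv N n dm (\<lambda>j. flag_mat j (a j)) J"
  proof (cases "J \<in> good")
    case True
    then have J: "J \<in> multi_index N n dm" by (auto simp: good_def)
    have "plv N n dm (\<lambda>j. flag_mat j (a j)) J = (\<Prod>j=1..n. minor (dm j) (flag_mat j (a j)) (pick (J j)))"
      using J by (simp add: plv_def)
    also have "\<dots> = (\<Prod>j=1..n. sort_sign j (\<lambda>q. win (pick (J j) (h j + q))) * minor j (a j) (pick (down J j)))"
    proof (intro prod.cong refl)
      fix j assume j: "j \<in> {1..n}"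
      then have "down J j = win ` (J j - {..<h j})" by (simp add: down_def)
      then show "minor (dm j) (flag_mat j (a j)) (pick (J j))
        = sort_sign j (\<lambda>q. win (pick (J j) (h j + q))) * minor j (a j) (pick (down J j))"
        using minor_flag_mat_good(3)[OF j, of "J j" "a j"] True j multi_index_memD(3)[OF J j]
        by (simp add: good_def)
    qed
    finally show ?thesis
      using True down_mem[OF True] by (simp add: T_def plv_def sgn_up_def prod.distrib)
  next
    case False
    have "plv N n dm (\<lambda>j. flag_mat j (a j)) J = 0"
    proof (cases "J \<in> multi_index N n dm")
      case True
      then obtain j where j: "j \<in> {1..n}" "\<not> ({..<h j} \<subseteq> J j \<and> J j \<subseteq> {..<h j + n + 1})"
        using False unfolding good_def by blast
      have "minor (dm j) (flag_mat j (a j)) (pick (J j)) = 0"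
        using minor_flag_mat_bad[OF j(1) _ _ j(2)] multi_index_memD(2,3)[OF True j(1)] by blast
      then show ?thesis using True j(1) by (auto simp: plv_def)
    qed (simp add: plv_def)
    with False show ?thesis by (simp add: T_def)
  qed
qed

lemma T'_T:
  assumes "\<And>I. I \<notin> multi_index (n + 1) n (\<lambda>j. j) \<Longrightarrow> x I = 0"
  shows "T' (T x) = x"
proof
  fix I show "T' (T x) I = x I"
    using assms up_mem[of I] down_up[of I] sgn_up_nonzero[of "up I"] by (auto simp: T'_def T_def)
qed

lemma T_T':
  assumes "\<And>J. J \<notin> good \<Longrightarrow> y J = 0"
  shows "T (T' y) = y"
proof
  fix J show "T (T' y) J = y J"
    using assms down_mem[of J] up_down[of J] sgn_up_nonzero[of J] by (auto simp: T'_def T_def)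
qed

lemma T_scale: "T (\<lambda>I. c * x I) = (\<lambda>J. c * T x J)"
  by (auto simp: T_def)

lemma T'_scale: "T' (\<lambda>I. c * x I) = (\<lambda>J. c * T' x J)"
  by (auto simp: T'_def)

lemma hform_T: "hform (multi_index (n + 1) n (\<lambda>j. j)) 1 (\<lambda>x. T x J)"
proof (cases "J \<in> good")
  case True
  then show ?thesis using hform_scale[OF hform.coord[OF down_mem[OF True]]] by (simp add: T_def)
next
  case False
  \<comment> \<open>Any index will do: the zero form of degree 1 is built from a coordinate.\<close>
  have "restrict (\<lambda>j. {..<j}) {1..n} \<in> multi_index (n + 1) n (\<lambda>j. j)"
    by (auto simp: multi_index_def)
  then show ?thesis using False by (auto simp: T_def intro!: hform_zero)
qed

lemma hform_T':
  assumes "I \<in> multi_index (n + 1) n (\<lambda>j. j)"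
  shows "hform (multi_index N n dm) 1 (\<lambda>y. T' y I)"
proof -
  have "hform (multi_index N n dm) 1 (\<lambda>y. (1 / sgn_up (up I)) * y (up I))"
    using up_mem[OF assms] by (intro hform_scale hform.coord) (auto simp: good_def)
  then show ?thesis using assms by (simp add: T'_def)
qed

definition deg_vecs :: "((nat \<Rightarrow> nat set) \<Rightarrow> complex) set"
  where "deg_vecs = flag_vecs (n + 1) n (\<lambda>j. j) kill_mat"

lemma deg_vecs_props:
  assumes "y \<in> deg_vecs"
  shows "y \<noteq> (\<lambda>_. 0)" "I \<notin> multi_index (n + 1) n (\<lambda>j. j) \<Longrightarrow> y I = 0"
proof -
  obtain a where a: "y = plv (n + 1) n (\<lambda>j. j) a" "\<forall>j\<in>{1..n}. full_rank (n + 1) j (a j)"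
    using assms by (auto simp: deg_vecs_def flag_vecs_def)
  then show "y \<noteq> (\<lambda>_. 0)" "I \<notin> multi_index (n + 1) n (\<lambda>j. j) \<Longrightarrow> y I = 0"
    using plv_nonzero_iff[of "n + 1" n "\<lambda>j. j" a] plv_outside by auto
qed

lemma zariski_closed_T: "zariski_closed (multi_index N n dm) (line ` T ` deg_vecs)"
proof (rule zariski_closed_push[where T' = T' and G = good and A = "multi_index (n + 1) n (\<lambda>j. j)"])
  show "zariski_closed (multi_index (n + 1) n (\<lambda>j. j)) (line ` deg_vecs)"
    unfolding deg_vecs_def by (rule zariski_closed_flag_vecs)
  show "T' (T y) = y" if "y \<in> deg_vecs" for y
    using T'_T[of y] deg_vecs_props(2)[OF that] by blast
  show "good \<subseteq> multi_index N n dm" by (auto simp: good_def)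
  show "T (T' x) = x" if "\<And>b. b \<notin> good \<Longrightarrow> x b = 0" for x
    using T_T'[of x] that by blast
  show "hform (multi_index N n dm) 1 (\<lambda>x. T' x a)" if "a \<in> multi_index (n + 1) n (\<lambda>j. j)" for a
    using that by (rule hform_T')
qed (auto simp: deg_vecs_props T_scale T_def T'_def)

section \<open>Flags as nested column spaces\<close>

definition flag_family :: "(nat \<Rightarrow> nat \<Rightarrow> nat \<Rightarrow> complex) \<Rightarrow> bool"
  where "flag_family g \<longleftrightarrow> (\<forall>j\<in>{1..n}. full_rank N (dm j) (g j)) \<and>
    (\<forall>j\<in>{1..<n}. \<exists>X. \<forall>r<N. \<forall>c<dm j. g j r c = mprod (dm (Suc j)) (g (Suc j)) X r c)"

lemma T_deg_vecs_flag_family: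
  assumes "y \<in> deg_vecs"
  obtains a where "T y = plv N n dm (\<lambda>j. flag_mat j (a j))" "flag_family (\<lambda>j. flag_mat j (a j))"
proof -
  obtain a where a: "y = plv (n + 1) n (\<lambda>j. j) a" "incident (n + 1) n (\<lambda>j. j) kill_mat a"
    using assms by (auto simp: deg_vecs_def flag_vecs_def)
  let ?g = "\<lambda>j. flag_mat j (a j)"
  have Ty: "T y = plv N n dm ?g" using a T_plv by simp
  have "T y \<noteq> (\<lambda>_. 0)"
  proof
    assume "T y = (\<lambda>_. 0)"
    then have "y = T' (\<lambda>_. 0)" using T'_T[of y] deg_vecs_props[OF assms] by simp
    also have "\<dots> = (\<lambda>_. 0)" by (auto simp: T'_def)
    finally show False using deg_vecs_props[OF assms] by simp
  qed
  then have "\<forall>j\<in>{1..n}. full_rank N (dm j) (?g j)" using Ty plv_nonzero_iff by metis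
  moreover have "\<exists>X. \<forall>r<N. \<forall>c<dm j. ?g j r c = mprod (dm (Suc j)) (?g (Suc j)) X r c" if "j \<in> {1..<n}" for j
    using a(2) that unfolding flag_mat_nested_iff[OF that] incident_def by blast
  ultimately show ?thesis using that Ty unfolding flag_family_def by blast
qed

text \<open>\<open>low\<close> and \<open>high\<close> are the two bounds on the column space of
  \<open>g\<close>. Column operations turn the first \<open>h j\<close> columns into unit vectors
  and clear the first \<open>h j\<close> rows of the others; what remains in the window is the copy
  of some \<open>a\<close>.\<close>

lemma flag_mat_normal_form:
  assumes j: "j \<in> {1..n}"
    and low: "\<And>x. x < h j \<Longrightarrow> \<exists>z. \<forall>r<N. (\<Sum>l<dm j. g r l * z l) = (if r = x then 1 else 0)"
    and high: "\<And>r c. h j + n + 1 \<le> r \<Longrightarrow> r < N \<Longrightarrow> c < dm j \<Longrightarrow> g r c = 0"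
  obtains a X where "fdet (dm j) X \<noteq> 0" "\<And>r c. r < N \<Longrightarrow> c < dm j \<Longrightarrow> flag_mat j a r c = mprod (dm j) g X r c"
proof -
  let ?d = "dm j"
  obtain z where z: "\<And>x r. x < h j \<Longrightarrow> r < N \<Longrightarrow> (\<Sum>l<?d. g r l * z x l) = (if r = x then 1 else 0)"
    using low by metis
  have hN: "h j < N" using window_le[OF j] by simp
  define Z where "Z q x = z x q" for q x
  have gZ: "mprod ?d g Z r x = (if r = x then 1 else 0)" if "x < h j" "r < N" for r x
    using z that by (simp add: mprod_def Z_def)
  have "full_rank ?d (h j) Z"
  proof (rule full_rankI)
    fix w x assume w: "\<And>r. r < ?d \<Longrightarrow> (\<Sum>l<h j. Z r l * w l) = (0::complex)" and x: "x < h j"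
    have "mprod (h j) (mprod ?d g Z) (\<lambda>l _. w l) x 0 = mprod ?d g (mprod (h j) Z (\<lambda>l _. w l)) x 0"
      by (rule mprod_assoc)
    also have "\<dots> = 0" using w by (simp add: mprod_def)
    also have "mprod (h j) (mprod ?d g Z) (\<lambda>l _. w l) x 0 = 1 * w x"
      by (rule mprod_delta_left) (use x gZ hN in auto)
    finally show "w x = 0" by simp
  qed
  then obtain Z' where Z': "fdet ?d Z' \<noteq> 0" "\<And>r c. c < h j \<Longrightarrow> Z' r c = Z r c"
    by (rule full_rank_extend) blast
  define G where "G = mprod ?d g Z'"
  have G1: "G r c = (if r = c then 1 else 0)" if "c < h j" "r < N" for r c
  proof -
    have "G r c = mprod ?d g Z r c" unfolding G_def by (rule mprod_cong) (use Z' that in auto)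
    then show ?thesis using gZ that by simp
  qed
  have G2: "G r c = 0" if "h j + n + 1 \<le> r" "r < N" for r c
    using high that by (simp add: G_def mprod_def)
  obtain wi where wi: "\<And>s. s < n + 1 \<Longrightarrow> wi s \<in> {h j..<h j + n + 1} \<and> win (wi s) = s"
    using win_surj[OF j] by metis
  have wi_win: "wi (win r) = r" if "r \<in> {h j..<h j + n + 1}" for r
    using wi[of "win r"] win_less[OF j that] win_eq[OF j _ that] by auto
  define a where "a s q = G (wi s) (h j + q)" for s q
  \<comment> \<open>Block unitriangular: it restores the entries in the first \<open>h j\<close>
    rows that \<open>flag_mat\<close> has cleared.\<close>
  define Y where "Y q c = (if q < h j then G q c else if q = c then 1 else 0)" for q c
  have flagY: "mprod ?d (flag_mat j a) Y r c = G r c" if r: "r < N" and c: "c < ?d" for r c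
  proof -
    consider "r < h j" | "r \<in> {h j..<h j + n + 1}" | "h j + n + 1 \<le> r" by force
    then show ?thesis
    proof cases
      case 1
      then show ?thesis unfolding dm_def mprod_flag_mat by (simp add: Y_def)
    next
      case 3
      then show ?thesis unfolding dm_def mprod_flag_mat using G2 r by simp
    next
      case 2
      have "mprod ?d (flag_mat j a) Y r c = mprod j a (\<lambda>q. Y (h j + q)) (win r) c"
        unfolding dm_def mprod_flag_mat using 2 by simp
      also have "\<dots> = G r c"
      proof (cases "c < h j")
        case True
        then show ?thesis using G1[of c r] 2 r by (auto simp: mprod_def Y_def)
      next
        case False
        have "mprod j a (\<lambda>q. Y (h j + q)) (win r) c = a (win r) (c - h j) * 1"
          by (rule mprod_delta_right) (use False c in \<open>auto simp: Y_def dm_def\<close>)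
        then show ?thesis using False wi_win[OF 2] by (simp add: a_def)
      qed
      finally show ?thesis .
    qed
  qed
  have "fdet ?d Y \<noteq> 0"
  proof -
    have "full_rank ?d ?d Y"
    proof (rule full_rankI)
      fix w q assume w: "\<And>r. r < ?d \<Longrightarrow> (\<Sum>l<?d. Y r l * w l) = (0::complex)" and q: "q < ?d"
      have big: "w q = 0" if "h j \<le> q" "q < ?d" for q
      proof -
        have "(\<Sum>l<?d. Y q l * w l) = (\<Sum>l<?d. if l = q then w l else 0)"
          using that by (intro sum.cong) (auto simp: Y_def)
        then show ?thesis using w that by simp
      qed
      show "w q = 0"
      proof (cases "q < h j")
        case True
        have "Y q l * w l = (if l = q then w l else 0)" if "l < ?d" for l
          using True big[of l] G1[of l q] hN that by (cases "l < h j") (auto simp: Y_def)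
        then have "(\<Sum>l<?d. Y q l * w l) = (\<Sum>l<?d. if l = q then w l else 0)"
          by (intro sum.cong) auto
        then show ?thesis using w[OF q] q by simp
      qed (use big q in auto)
    qed
    then show ?thesis by (simp add: full_rank_square)
  qed
  then obtain W where W: "fdet ?d W \<noteq> 0" "\<And>a r c. c < ?d \<Longrightarrow> mprod ?d (mprod ?d a Y) W r c = a r c"
    by (metis mprod_right_cancel)
  show ?thesis
  proof (rule that[of "mprod ?d Z' W" a])
    show "fdet ?d (mprod ?d Z' W) \<noteq> 0" using Z'(1) W(1) by (simp add: minor_mprod)
    fix r c assume rc: "r < N" "c < ?d"
    have "flag_mat j a r c = mprod ?d (mprod ?d (flag_mat j a) Y) W r c" using W(2) rc by simp
    also have "\<dots> = mprod ?d G W r c" by (rule mprod_cong) (use flagY rc in auto)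
    finally show "flag_mat j a r c = mprod ?d g (mprod ?d Z' W) r c" by (simp add: G_def mprod_assoc)
  qed
qed

text \<open>Surjectivity: every flag within the bounds comes from a degenerate flag. The base
  changes to the normal form are absorbed into the factors of the nested inclusions, after which
  \<open>flag_mat_nested_iff\<close> applies.\<close>

lemma flag_family_in_T_deg_vecs:
  assumes fam: "flag_family g"
    and low: "\<And>j x. j \<in> {1..n} \<Longrightarrow> x < h j \<Longrightarrow> \<exists>z. \<forall>r<N. (\<Sum>l<dm j. g j r l * z l) = (if r = x then 1 else 0)"
    and high: "\<And>j r c. j \<in> {1..n} \<Longrightarrow> h j + n + 1 \<le> r \<Longrightarrow> r < N \<Longrightarrow> c < dm j \<Longrightarrow> g j r c = 0"
  shows "line (plv N n dm g) \<in> line ` T ` deg_vecs"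
proof -
  have "\<exists>a X. fdet (dm j) X \<noteq> 0 \<and> (\<forall>r<N. \<forall>c<dm j. flag_mat j a r c = mprod (dm j) (g j) X r c)" if j: "j \<in> {1..n}" for j
    by (rule flag_mat_normal_form[OF j low[OF j] high[OF j]]) (assumption+, blast)
  then obtain a X where X: "\<And>j. j \<in> {1..n} \<Longrightarrow> fdet (dm j) (X j) \<noteq> 0"
    "\<And>j r c. j \<in> {1..n} \<Longrightarrow> r < N \<Longrightarrow> c < dm j \<Longrightarrow> flag_mat j (a j) r c = mprod (dm j) (g j) (X j) r c"
    by metis
  define u where "u = (\<Prod>j=1..n. fdet (dm j) (X j))"
  have u: "u \<noteq> 0" using X(1) by (simp add: u_def)
  have eq: "plv N n dm (\<lambda>j. flag_mat j (a j)) = (\<lambda>I. u * plv N n dm g I)"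
    unfolding u_def by (rule plv_mprod) (rule X(2))
  have g0: "plv N n dm g \<noteq> (\<lambda>_. 0)" using fam unfolding flag_family_def plv_nonzero_iff by blast
  let ?y = "plv (n + 1) n (\<lambda>j. j) a"
  have Ty: "T ?y = (\<lambda>I. u * plv N n dm g I)" using T_plv eq by simp
  have "?y \<in> deg_vecs"
    unfolding deg_vecs_def flag_vecs_def
  proof (intro CollectI exI[of _ a] conjI refl)
    have "?y \<noteq> (\<lambda>_. 0)"
    proof
      assume "?y = (\<lambda>_. 0)"
      then have "T ?y = (\<lambda>_. 0)" by (auto simp: T_def)
      then show False using Ty u g0 by (auto simp: fun_eq_iff)
    qed
    then show "\<forall>j\<in>{1..n}. full_rank (n + 1) j (a j)" by (simp add: plv_nonzero_iff)
    show "incident (n + 1) n (\<lambda>j. j) kill_mat a"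
      unfolding incident_def
    proof
      fix j assume j: "j \<in> {1..<n}"
      then have j1: "j \<in> {1..n}" and j2: "Suc j \<in> {1..n}" by auto
      let ?d = "dm j" and ?e = "dm (Suc j)"
      obtain Q where Q: "\<And>r c. r < N \<Longrightarrow> c < ?d \<Longrightarrow> g j r c = mprod ?e (g (Suc j)) Q r c"
        using fam j unfolding flag_family_def by blast
      obtain W where W: "\<And>Y r c. r < ?e \<Longrightarrow> mprod ?e (X (Suc j)) (mprod ?e W Y) r c = Y r c"
        using mprod_right_cancel[OF X(1)[OF j2]] by metis
      define Y where "Y = mprod ?e W (mprod ?d Q (X j))"
      have "flag_mat j (a j) r c = mprod ?e (flag_mat (Suc j) (a (Suc j))) Y r c" if rc: "r < N" "c < ?d" for r c
      proof -
        have "flag_mat j (a j) r c = mprod ?d (mprod ?e (g (Suc j)) Q) (X j) r c"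
          unfolding X(2)[OF j1 rc] by (rule mprod_cong) (use Q rc in auto)
        also have "\<dots> = mprod ?e (g (Suc j)) (mprod ?d Q (X j)) r c" by (rule mprod_assoc)
        also have "\<dots> = mprod ?e (g (Suc j)) (mprod ?e (X (Suc j)) Y) r c"
          unfolding Y_def by (rule mprod_cong) (use W in auto)
        also have "\<dots> = mprod ?e (mprod ?e (g (Suc j)) (X (Suc j))) Y r c" by (simp add: mprod_assoc)
        also have "\<dots> = mprod ?e (flag_mat (Suc j) (a (Suc j))) Y r c"
          by (rule mprod_cong) (use X(2)[OF j2] rc in auto)
        finally show ?thesis .
      qed
      then have "\<exists>Y. \<forall>r<N. \<forall>c<?d. flag_mat j (a j) r c = mprod ?e (flag_mat (Suc j) (a (Suc j))) Y r c" by blast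
      then show "\<exists>X. \<forall>r<n + 1. \<forall>c<j. mprod (n + 1) (kill_mat j) (a j) r c = mprod (Suc j) (a (Suc j)) X r c"
        unfolding flag_mat_nested_iff[OF j] .
    qed
  qed
  then have "line (T ?y) \<in> line ` T ` deg_vecs" by (intro imageI)
  then show ?thesis unfolding Ty line_scale[OF u] .
qed

end

section \<open>Cosets of the parabolic subgroup and completion of flags\<close>

abbreviation entries :: "complex mat \<Rightarrow> nat \<Rightarrow> nat \<Rightarrow> complex"
  where "entries g r c \<equiv> g $$ (r, c)"

abbreviation unit_mat :: "nat \<Rightarrow> nat \<Rightarrow> complex"
  where "unit_mat r c \<equiv> (if r = c then 1 else 0)"

text \<open>One matrix for all \<open>j\<close>: the \<open>j\<close>-th space is spanned by its
  first \<open>d j\<close> columns.\<close>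

abbreviation orbit_vec :: "nat \<Rightarrow> nat \<Rightarrow> (nat \<Rightarrow> nat) \<Rightarrow> (nat \<Rightarrow> nat \<Rightarrow> complex) \<Rightarrow> (nat \<Rightarrow> nat set) \<Rightarrow> complex"
  where "orbit_vec N n d g \<equiv> plv N n d (\<lambda>_. g)"

lemma fdet_entries: "g \<in> carrier_mat N N \<Longrightarrow> fdet N (entries g) = det g"
  unfolding minor_def by (intro arg_cong[where f = det] eq_matI) auto

lemma entries_mult:
  "g \<in> carrier_mat N N \<Longrightarrow> h \<in> carrier_mat N N \<Longrightarrow> r < N \<Longrightarrow> c < N \<Longrightarrow>
    (g * h) $$ (r, c) = mprod N (entries g) (entries h) r c"
  by (simp add: mprod_def scalar_prod_def atLeast0LessThan)

lemma det_submatrix_minor: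
  assumes g: "g \<in> carrier_mat m e" and I: "I \<subseteq> {..<m}" "card I = d"
    and J: "card {j. j < e \<and> j \<in> J} = d" "\<And>c. c < d \<Longrightarrow> pick J c = c"
  shows "det (submatrix g I J) = minor d (entries g) (pick I)"
proof -
  have "{i. i < dim_row g \<and> i \<in> I} = I" using g I by auto
  then have "submatrix g I J = mat d d (\<lambda>(r, c). g $$ (pick I r, pick J c))"
    unfolding submatrix_def using g I J by auto
  also have "\<dots> = mat d d (\<lambda>(r, c). g $$ (pick I r, c))"
    by (intro eq_matI) (auto simp: J(2))
  finally show ?thesis by (simp add: minor_def)
qed

lemma highest_index:
  assumes "\<forall>j\<in>{1..n}. d j \<le> N"
  shows "(\<lambda>j\<in>{1..n}. {0..<d j}) \<in> multi_index N n d"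
  using assms by (auto simp: multi_index_def)

text \<open>Only the index of the highest weight vector contributes to the sum, and it selects the
  first \<open>d j\<close> columns of \<open>g\<close>.\<close>

lemma tensor_act_highest:
  assumes d: "\<forall>j\<in>{1..n}. d j \<le> N" and g: "g \<in> carrier_mat N N"
  shows "tensor_act N n d g (\<lambda>I. c * highest_weight_vector n d I) = (\<lambda>I. c * orbit_vec N n d (entries g) I)"
proof
  fix I
  let ?K = "\<lambda>j\<in>{1..n}. {0..<d j}"
  show "tensor_act N n d g (\<lambda>I. c * highest_weight_vector n d I) I = c * orbit_vec N n d (entries g) I"
  proof (cases "I \<in> multi_index N n d")
    case True
    have "(\<Sum>J\<in>multi_index N n d. (\<Prod>j=1..n. det (submatrix g (I j) (J j))) * (c * highest_weight_vector n d J))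
        = (\<Sum>J\<in>multi_index N n d. if J = ?K then (\<Prod>j=1..n. det (submatrix g (I j) (J j))) * c else 0)"
      by (intro sum.cong) (auto simp: highest_weight_vector_def)
    also have "\<dots> = (\<Prod>j=1..n. det (submatrix g (I j) (?K j))) * c"
      using highest_index[OF d] by (simp add: finite_multi_index)
    also have "(\<Prod>j=1..n. det (submatrix g (I j) (?K j))) = (\<Prod>j=1..n. minor (d j) (entries g) (pick (I j)))"
    proof (intro prod.cong refl)
      fix j assume j: "j \<in> {1..n}"
      have "det (submatrix g (I j) {..<d j}) = minor (d j) (entries g) (pick (I j))"
      proof (rule det_submatrix_minor[OF g])
        have "{c. c < N \<and> c \<in> {..<d j}} = {..<d j}" using bspec[OF d j] by auto
        then show "card {c. c < N \<and> c \<in> {..<d j}} = d j" by simp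
      qed (use multi_index_memD[OF True j] pick_lessThan in auto)
      then show "det (submatrix g (I j) (?K j)) = minor (d j) (entries g) (pick (I j))"
        using j by (simp add: atLeast0LessThan)
    qed
    finally show ?thesis using True by (simp add: tensor_act_def plv_def)
  qed (simp add: tensor_act_def plv_def)
qed

lemma tensor_act_line:
  assumes d: "\<forall>j\<in>{1..n}. d j \<le> N" and g: "g \<in> carrier_mat N N"
  shows "tensor_act N n d g ` line (highest_weight_vector n d) = line (orbit_vec N n d (entries g))"
proof -
  have "tensor_act N n d g ` line (highest_weight_vector n d)
      = (\<lambda>c. tensor_act N n d g (\<lambda>I. c * highest_weight_vector n d I)) ` UNIV"
    by (auto simp: line_def)
  also have "\<dots> = line (orbit_vec N n d (entries g))"
  proof -
    have "tensor_act N n d g (\<lambda>I. c * highest_weight_vector n d I) = (\<lambda>I. c * orbit_vec N n d (entries g) I)" for c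
      by (rule tensor_act_highest) (use d g in auto)
    then show ?thesis by (auto simp: line_def)
  qed
  finally show ?thesis .
qed

text \<open>A set \<open>I j\<close> other than \<open>{..<d j}\<close> has an element not less than
  \<open>d j\<close>, whose row is zero in the first \<open>d j\<close> columns of the identity.
  This exhibits the highest weight line itself as the line of an \<open>orbit_vec\<close>.\<close>

lemma tensor_act_one:
  assumes d: "\<forall>j\<in>{1..n}. d j \<le> N"
  shows "tensor_act N n d (1\<^sub>m N) ` line (highest_weight_vector n d) = line (highest_weight_vector n d)"
proof -
  let ?K = "\<lambda>j\<in>{1..n}. {0..<d j}"
  have "orbit_vec N n d (entries (1\<^sub>m N)) I = highest_weight_vector n d I" for I
  proof (cases "I = ?K")
    case True
    have "minor (d j) (entries (1\<^sub>m N)) (pick (?K j)) = 1 ^ d j" if j: "j \<in> {1..n}" for j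
      by (rule minor_scalar) (use j bspec[OF d j] in \<open>auto simp: pick_lessThan atLeast0LessThan\<close>)
    then have "(\<Prod>j=1..n. minor (d j) (entries (1\<^sub>m N)) (pick (?K j))) = 1"
      by (intro prod.neutral) auto
    then show ?thesis
      using highest_index[OF d] unfolding True by (simp add: plv_def highest_weight_vector_def)
  next
    case False
    show ?thesis
    proof (cases "I \<in> multi_index N n d")
      case True
      have "\<exists>j\<in>{1..n}. I j \<noteq> {..<d j}"
      proof (rule ccontr)
        assume *: "\<not> (\<exists>j\<in>{1..n}. I j \<noteq> {..<d j})"
        have "I = ?K"
        proof (rule ext)
          fix j show "I j = ?K j"
            using * True by (cases "j \<in> {1..n}") (auto simp: multi_index_def PiE_def extensional_def atLeast0LessThan)
        qed
        with False show False by simp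
      qed
      then obtain j where j: "j \<in> {1..n}" "I j \<noteq> {..<d j}" by blast
      note I = multi_index_memD[OF True j(1)]
      have "\<not> I j \<subseteq> {..<d j}" using I j(2) card_subset_eq[of "{..<d j}" "I j"] by auto
      then obtain r where r: "r \<in> I j" "d j \<le> r" by (auto simp: subset_iff not_less)
      have "r \<in> pick (I j) ` {..<d j}" using pick_image[OF I(2)] I(3) r(1) by simp
      then obtain q where q: "q < d j" "pick (I j) q = r" by blast
      have "minor (d j) (entries (1\<^sub>m N)) (pick (I j)) = 0"
        by (rule minor_zero_row[OF q(1)]) (use q r I(1) bspec[OF d j(1)] in auto)
      then have "(\<Prod>j=1..n. minor (d j) (entries (1\<^sub>m N)) (pick (I j))) = 0"
        using j(1) by (intro prod_zero) auto
      then show ?thesis using True False by (simp add: plv_def highest_weight_vector_def)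
    qed (use False in \<open>simp add: plv_def highest_weight_vector_def\<close>)
  qed
  then have "orbit_vec N n d (entries (1\<^sub>m N)) = highest_weight_vector n d" by (rule ext)
  moreover have "tensor_act N n d (1\<^sub>m N) ` line (highest_weight_vector n d) = line (orbit_vec N n d (entries (1\<^sub>m N)))"
    by (rule tensor_act_line) (use d in auto)
  ultimately show ?thesis by simp
qed

lemma full_rank_columns:
  assumes "fdet N g \<noteq> 0" "d \<le> N"
  shows "full_rank N d g"
proof (rule full_rankI)
  fix z k assume z: "\<And>r. r < N \<Longrightarrow> (\<Sum>k<d. g r k * z k) = (0::complex)" and k: "k < d"
  have "(if k < d then z k else 0) = 0"
  proof (rule minor_kernel[OF assms(1), of "\<lambda>k. if k < d then z k else 0"])
    fix r assume r: "r < N"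
    have "(\<Sum>k<N. g r k * (if k < d then z k else 0)) = (\<Sum>k\<in>{..<d}. g r k * (if k < d then z k else 0))"
      by (rule sum.mono_neutral_right) (use assms in auto)
    then show "(\<Sum>k<N. g r k * (if k < d then z k else 0)) = 0" using z[OF r] by simp
  qed (use k assms in auto)
  then show "z k = 0" using k by simp
qed

lemma orbit_vec_nonzero:
  assumes "fdet N g \<noteq> 0" "\<forall>j\<in>{1..n}. d j \<le> N"
  shows "orbit_vec N n d g \<noteq> (\<lambda>_. 0)"
  unfolding plv_nonzero_iff using full_rank_columns[OF assms(1)] assms(2) by blast

lemma SL_carrier: "g \<in> carrier (SL N) \<longleftrightarrow> g \<in> carrier_mat N N \<and> det g = 1"
  by (simp add: SL_def)

lemma SL_mult: "g \<in> carrier (SL N) \<Longrightarrow> h \<in> carrier (SL N) \<Longrightarrow> g * h \<in> carrier (SL N)"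
  by (auto simp: SL_carrier det_mult)

lemma SL_inverse:
  assumes "g \<in> carrier (SL N)"
  obtains g' where "g' \<in> carrier (SL N)" "g * g' = 1\<^sub>m N" "g' * g = 1\<^sub>m N"
proof -
  have g: "g \<in> carrier_mat N N" "det g = 1" using assms by (auto simp: SL_carrier)
  have adj: "adj_mat g \<in> carrier_mat N N" "g * adj_mat g = 1\<^sub>m N" "adj_mat g * g = 1\<^sub>m N"
    using adj_mat[OF g(1)] g(2) by auto
  have "det g * det (adj_mat g) = 1" using det_mult[OF g(1) adj(1)] adj(2) by simp
  then show ?thesis using that adj g by (auto simp: SL_carrier)
qed

text \<open>If \<open>x\<close> has the block form, the first \<open>d j\<close> columns of
  \<open>g * x\<close> are those of \<open>g\<close> times a square block of \<open>x\<close>.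
  Conversely \<open>plv_line_span\<close> provides such a block, and injectivity of \<open>g\<close>
  identifies it, padded by zeros, with the columns of \<open>x\<close>.\<close>

lemma line_orbit_vec_eq_iff:
  assumes d: "\<forall>j\<in>{1..n}. d j \<le> N"
    and g: "g \<in> carrier_mat N N" "det g \<noteq> 0" and x: "x \<in> carrier_mat N N" "det x \<noteq> 0"
  shows "line (orbit_vec N n d (entries (g * x))) = line (orbit_vec N n d (entries g)) \<longleftrightarrow>
    (\<forall>j\<in>{1..n}. \<forall>r<N. \<forall>c<d j. d j \<le> r \<longrightarrow> x $$ (r, c) = 0)"
proof
  assume *: "\<forall>j\<in>{1..n}. \<forall>r<N. \<forall>c<d j. d j \<le> r \<longrightarrow> x $$ (r, c) = 0"
  have "entries (g * x) r c = mprod (d j) (entries g) (entries x) r c" if "j \<in> {1..n}" "r < N" "c < d j" for j r c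
  proof -
    have "entries (g * x) r c = mprod N (entries g) (entries x) r c"
      using entries_mult[OF g(1) x(1)] that bspec[OF d that(1)] by simp
    also have "\<dots> = mprod (d j) (entries g) (entries x) r c"
      unfolding mprod_def by (rule sum.mono_neutral_right) (use * that bspec[OF d that(1)] in auto)
    finally show ?thesis .
  qed
  then have eq: "orbit_vec N n d (entries (g * x)) =
      (\<lambda>I. (\<Prod>j=1..n. fdet (d j) (entries x)) * orbit_vec N n d (entries g) I)"
    by (rule plv_mprod)
  have "orbit_vec N n d (entries (g * x)) \<noteq> (\<lambda>_. 0)"
    by (rule orbit_vec_nonzero[OF _ d]) (use g x in \<open>auto simp: fdet_entries det_mult\<close>)
  then have "(\<Prod>j=1..n. fdet (d j) (entries x)) \<noteq> 0" unfolding eq by (auto simp: fun_eq_iff)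
  then show "line (orbit_vec N n d (entries (g * x))) = line (orbit_vec N n d (entries g))"
    unfolding eq by (rule line_scale)
next
  assume eq: "line (orbit_vec N n d (entries (g * x))) = line (orbit_vec N n d (entries g))"
  show "\<forall>j\<in>{1..n}. \<forall>r<N. \<forall>c<d j. d j \<le> r \<longrightarrow> x $$ (r, c) = 0"
  proof (intro ballI allI impI)
    fix j r c assume j: "j \<in> {1..n}" and r: "r < N" and c: "c < d j" and rd: "d j \<le> r"
    have gd: "fdet N (entries g) \<noteq> 0" using g by (simp add: fdet_entries)
    have "\<forall>j\<in>{1..n}. full_rank N (d j) (entries g)" using full_rank_columns[OF gd] d by blast
    then obtain X where X: "\<And>r c. r < N \<Longrightarrow> c < d j \<Longrightarrow> entries (g * x) r c = mprod (d j) (entries g) X r c"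
      using plv_line_span[OF eq[symmetric] _ j] by metis
    have "entries x r c - (if r < d j then X r c else 0) = 0"
    proof (rule minor_kernel[OF gd, of "\<lambda>k. entries x k c - (if k < d j then X k c else 0)"])
      fix q assume q: "q < N"
      have "(\<Sum>k<N. entries g q k * (if k < d j then X k c else 0)) = (\<Sum>k<d j. entries g q k * (if k < d j then X k c else 0))"
        by (rule sum.mono_neutral_right) (use bspec[OF d j] in auto)
      also have "\<dots> = mprod (d j) (entries g) X q c" by (simp add: mprod_def)
      also have "\<dots> = entries (g * x) q c" using X[OF q c] by simp
      also have "\<dots> = (\<Sum>k<N. entries g q k * entries x k c)"
        using entries_mult[OF g(1) x(1) q] c bspec[OF d j] by (simp add: mprod_def)
      finally show "(\<Sum>k<N. entries g q k * (entries x k c - (if k < d j then X k c else 0))) = 0"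
        by (simp only: right_diff_distrib sum_subtractf) simp
    qed (rule r)
    then show "x $$ (r, c) = 0" using rd by simp
  qed
qed

lemma parabolic_iff:
  assumes d: "\<forall>j\<in>{1..n}. d j \<le> N"
  shows "p \<in> parabolic N n d \<longleftrightarrow> p \<in> carrier (SL N) \<and>
    (\<forall>j\<in>{1..n}. \<forall>r<N. \<forall>c<d j. d j \<le> r \<longrightarrow> p $$ (r, c) = 0)"
proof (cases "p \<in> carrier (SL N)")
  case True
  then have p: "p \<in> carrier_mat N N" "det p \<noteq> 0" by (auto simp: SL_carrier)
  have 1: "line (orbit_vec N n d (entries (1\<^sub>m N))) = line (highest_weight_vector n d)"
    using tensor_act_line[OF d one_carrier_mat] tensor_act_one[OF d] by simp
  have "p \<in> parabolic N n d \<longleftrightarrow> line (orbit_vec N n d (entries (1\<^sub>m N * p))) = line (orbit_vec N n d (entries (1\<^sub>m N)))"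
    unfolding 1 parabolic_def using True tensor_act_line[OF d p(1)] p by simp
  also have "\<dots> \<longleftrightarrow> (\<forall>j\<in>{1..n}. \<forall>r<N. \<forall>c<d j. d j \<le> r \<longrightarrow> p $$ (r, c) = 0)"
    by (rule line_orbit_vec_eq_iff[OF d _ _ p]) auto
  finally show ?thesis using True by simp
qed (auto simp: parabolic_def)

text \<open>Cosets are the fibres of the orbit map. Hence \<open>orbit_emb\<close> is the line of
  any representative, and it separates cosets.\<close>

lemma parabolic_coset:
  assumes d: "\<forall>j\<in>{1..n}. d j \<le> N" and g: "g \<in> carrier (SL N)"
  shows "g <#\<^bsub>SL N\<^esub> parabolic N n d =
    {x \<in> carrier (SL N). line (orbit_vec N n d (entries x)) = line (orbit_vec N n d (entries g))}"
proof (intro equalityI subsetI)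
  have g': "g \<in> carrier_mat N N" "det g \<noteq> 0" using g by (auto simp: SL_carrier)
  {
    fix x assume "x \<in> g <#\<^bsub>SL N\<^esub> parabolic N n d"
    then obtain p where p: "p \<in> parabolic N n d" "x = g * p" by (auto simp: l_coset_def SL_def)
    then have "p \<in> carrier_mat N N" "det p \<noteq> 0" "x \<in> carrier (SL N)"
      using parabolic_iff[OF d] g SL_mult by (auto simp: SL_carrier)
    then show "x \<in> {x \<in> carrier (SL N). line (orbit_vec N n d (entries x)) = line (orbit_vec N n d (entries g))}"
      using p parabolic_iff[OF d] line_orbit_vec_eq_iff[where x = p, OF d g'] by auto
  next
    fix x assume x: "x \<in> {x \<in> carrier (SL N). line (orbit_vec N n d (entries x)) = line (orbit_vec N n d (entries g))}"
    obtain i where i: "i \<in> carrier (SL N)" "g * i = 1\<^sub>m N" using SL_inverse[OF g] by metis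
    have c: "x \<in> carrier_mat N N" "i \<in> carrier_mat N N" using x i by (auto simp: SL_carrier)
    have "g * (i * x) = (g * i) * x" by (rule assoc_mult_mat[symmetric, OF g'(1) c(2,1)])
    then have gx: "g * (i * x) = x" using i c by simp
    have ix: "i * x \<in> carrier (SL N)" using i x SL_mult by auto
    then have "i * x \<in> carrier_mat N N" "det (i * x) \<noteq> 0" by (auto simp: SL_carrier)
    then have "i * x \<in> parabolic N n d"
      using x ix parabolic_iff[OF d] line_orbit_vec_eq_iff[where x = "i * x", OF d g'] unfolding gx by auto
    then have "g * (i * x) \<in> g <#\<^bsub>SL N\<^esub> parabolic N n d" by (auto simp: l_coset_def SL_def)
    then show "x \<in> g <#\<^bsub>SL N\<^esub> parabolic N n d" unfolding gx .
  }
qed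

lemma orbit_emb_coset:
  assumes d: "\<forall>j\<in>{1..n}. d j \<le> N" and g: "g \<in> carrier (SL N)"
  shows "orbit_emb N n d (g <#\<^bsub>SL N\<^esub> parabolic N n d) = line (orbit_vec N n d (entries g))"
proof -
  have "orbit_emb N n d (g <#\<^bsub>SL N\<^esub> parabolic N n d) =
      (\<Union>x\<in>{x \<in> carrier (SL N). line (orbit_vec N n d (entries x)) = line (orbit_vec N n d (entries g))}.
        line (orbit_vec N n d (entries x)))"
    unfolding orbit_emb_def parabolic_coset[OF d g]
    by (intro SUP_cong refl tensor_act_line) (auto simp: SL_carrier d)
  also have "\<dots> = line (orbit_vec N n d (entries g))" using g by blast
  finally show ?thesis .
qed

lemma orbit_emb_inj:
  assumes d: "\<forall>j\<in>{1..n}. d j \<le> N"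
  shows "inj_on (orbit_emb N n d) (lcosets\<^bsub>SL N\<^esub> (parabolic N n d))"
proof (rule inj_onI)
  fix C D assume "C \<in> lcosets\<^bsub>SL N\<^esub> (parabolic N n d)" "D \<in> lcosets\<^bsub>SL N\<^esub> (parabolic N n d)"
    and eq: "orbit_emb N n d C = orbit_emb N n d D"
  then obtain g h where g: "g \<in> carrier (SL N)" "C = g <#\<^bsub>SL N\<^esub> parabolic N n d"
    and h: "h \<in> carrier (SL N)" "D = h <#\<^bsub>SL N\<^esub> parabolic N n d"
    by (auto simp: LCOSETS_def)
  have "line (orbit_vec N n d (entries g)) = line (orbit_vec N n d (entries h))"
    using eq unfolding g(2) h(2) orbit_emb_coset[OF d g(1)] orbit_emb_coset[OF d h(1)] .
  then show "C = D"
    unfolding g(2) h(2) parabolic_coset[OF d g(1)] parabolic_coset[OF d h(1)] by simp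
qed

text \<open>The factor \<open>p\<close> on the right disappears because it does not change the
  line.\<close>

lemma orbit_emb_cell:
  assumes d: "\<forall>j\<in>{1..n}. d j \<le> N"
  shows "orbit_emb N n d ` schubert_cell N n d w =
    {line (orbit_vec N n d (entries (b * u))) | b u. b \<in> borel_subgroup N \<and> u \<in> weyl_lifts N w}"
proof -
  have *: "orbit_emb N n d ((b * u * p) <#\<^bsub>SL N\<^esub> parabolic N n d) = line (orbit_vec N n d (entries (b * u)))"
    if "b \<in> borel_subgroup N" "u \<in> weyl_lifts N w" "p \<in> parabolic N n d" for b u p
  proof -
    have S: "b \<in> carrier (SL N)" "u \<in> carrier (SL N)" "p \<in> carrier (SL N)"
      using that by (auto simp: borel_subgroup_def weyl_lifts_def parabolic_def)
    then have bu: "b * u \<in> carrier (SL N)" "b * u * p \<in> carrier (SL N)" using SL_mult by auto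
    have "line (orbit_vec N n d (entries (b * u * p))) = line (orbit_vec N n d (entries (b * u)))"
      using line_orbit_vec_eq_iff[where g = "b * u" and x = p and d = d and n = n and N = N, OF d] bu S(3) parabolic_iff[OF d] that(3)
      by (auto simp: SL_carrier)
    then show ?thesis using orbit_emb_coset[OF d bu(2)] by simp
  qed
  have one: "1\<^sub>m N \<in> parabolic N n d" unfolding parabolic_iff[OF d] using d by (auto simp: SL_carrier)
  show ?thesis
  proof (intro equalityI subsetI)
    fix l assume "l \<in> orbit_emb N n d ` schubert_cell N n d w"
    then obtain b u p where bup: "b \<in> borel_subgroup N" "u \<in> weyl_lifts N w" "p \<in> parabolic N n d"
      "l = orbit_emb N n d ((b * u * p) <#\<^bsub>SL N\<^esub> parabolic N n d)"
      unfolding schubert_cell_def by blast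
    then show "l \<in> {line (orbit_vec N n d (entries (b * u))) | b u. b \<in> borel_subgroup N \<and> u \<in> weyl_lifts N w}"
      using *[OF bup(1-3)] by blast
  next
    fix l assume "l \<in> {line (orbit_vec N n d (entries (b * u))) | b u. b \<in> borel_subgroup N \<and> u \<in> weyl_lifts N w}"
    then obtain b u where bu: "b \<in> borel_subgroup N" "u \<in> weyl_lifts N w" "l = line (orbit_vec N n d (entries (b * u)))"
      by blast
    have "(b * u * 1\<^sub>m N) <#\<^bsub>SL N\<^esub> parabolic N n d \<in> schubert_cell N n d w"
      unfolding schubert_cell_def using bu one by blast
    then show "l \<in> orbit_emb N n d ` schubert_cell N n d w"
      unfolding bu(3) *[OF bu(1,2) one, symmetric] by (rule imageI)
  qed
qed

text \<open>The scalar \<open>s\<close> is a complex \<open>N\<close>-th root of the inverse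
  determinant. A flag does not see scalars, so invertible matrices can stand in for elements of
  \<open>SL N\<close>.\<close>

lemma SL_rescale:
  assumes "fdet N g \<noteq> 0"
  obtains G s where "G \<in> carrier (SL N)" "s \<noteq> 0" "\<And>r c. r < N \<Longrightarrow> c < N \<Longrightarrow> G $$ (r, c) = s * g r c"
proof -
  obtain s where s: "s ^ N = inverse (fdet N g)"
  proof (cases "N = 0")
    case False
    then have "card {z. z ^ N = inverse (fdet N g)} = N"
      using assms by (intro card_nth_roots) auto
    then have "{z. z ^ N = inverse (fdet N g)} \<noteq> {}" using False by (metis card.empty)
    then show ?thesis using that by blast
  qed (use that in auto)
  show ?thesis
  proof (cases "N = 0")
    case True
    then show ?thesis using that[of "1\<^sub>m 0" 1] by (auto simp: SL_carrier)
  next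
    case False
    then have "s \<noteq> 0" using s assms by (auto simp: power_0_left)
    have "det (mat N N (\<lambda>(r, c). s * g r c)) = fdet N (\<lambda>r c. s * g r c)" by (simp add: minor_def)
    also have "\<dots> = s ^ N * fdet N g" by (rule minor_scale)
    finally have "mat N N (\<lambda>(r, c). s * g r c) \<in> carrier (SL N)" using s assms by (simp add: SL_carrier)
    then show ?thesis using that \<open>s \<noteq> 0\<close> by auto
  qed
qed

lemma orbit_vec_scale:
  assumes "s \<noteq> 0" "\<And>r c. r < N \<Longrightarrow> c < N \<Longrightarrow> G r c = s * g r c" "\<forall>j\<in>{1..n}. d j \<le> N"
  shows "line (orbit_vec N n d G) = line (orbit_vec N n d g)"
proof -
  have "G r c = mprod (d j) g (\<lambda>k c. if k = c then s else 0) r c" if "j \<in> {1..n}" "r < N" "c < d j" for j r c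
  proof -
    have "mprod (d j) g (\<lambda>k c. if k = c then s else 0) r c = g r c * s"
      by (rule mprod_delta_right) (use that in auto)
    then show ?thesis using assms(2)[of r c] bspec[OF assms(3) that(1)] that by simp
  qed
  then have eq: "orbit_vec N n d G = (\<lambda>I. (\<Prod>j=1..n. fdet (d j) (\<lambda>k c. if k = c then s else 0)) * orbit_vec N n d g I)"
    by (rule plv_mprod)
  have "fdet e (\<lambda>k c. if k = c then s else 0) = s ^ e" for e
    by (rule minor_scalar) auto
  then have "(\<Prod>j=1..n. fdet (d j) (\<lambda>k c. if k = c then s else 0)) \<noteq> 0" using assms(1) by simp
  then show ?thesis unfolding eq by (rule line_scale)
qed

lemma orbit_emb_lcosets:
  assumes d: "\<forall>j\<in>{1..n}. d j \<le> N" and g: "fdet N g \<noteq> 0"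
  shows "line (orbit_vec N n d g) \<in> orbit_emb N n d ` (lcosets\<^bsub>SL N\<^esub> (parabolic N n d))"
proof -
  obtain G s where G: "G \<in> carrier (SL N)" "s \<noteq> 0" "\<And>r c. r < N \<Longrightarrow> c < N \<Longrightarrow> G $$ (r, c) = s * g r c"
    using SL_rescale[OF g] by metis
  have "line (orbit_vec N n d g) = orbit_emb N n d (G <#\<^bsub>SL N\<^esub> parabolic N n d)"
    unfolding orbit_emb_coset[OF d G(1)] by (rule orbit_vec_scale[symmetric, OF G(2,3) d])
  moreover have "G <#\<^bsub>SL N\<^esub> parabolic N n d \<in> lcosets\<^bsub>SL N\<^esub> (parabolic N n d)"
    using G(1) by (auto simp: LCOSETS_def)
  ultimately show ?thesis by blast
qed

section \<open>Completion of a flag to one invertible matrix\<close>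

context window
begin

text \<open>The second bound, written without subtraction, expresses that \<open>h\<close> grows by
  at most one per step; the count in \<open>admissible_step\<close> rests on it.\<close>

lemma h_mono:
  assumes "1 \<le> j" "j \<le> l" "l \<le> n"
  shows "h j \<le> h l" "h l + j \<le> h j + l"
proof -
  have "h j \<le> h l \<and> h l + j \<le> h j + l"
    using assms(2,3)
  proof (induction l rule: dec_induct)
    case (step l)
    then show ?case using h_Suc[of l] assms(1) by auto
  qed simp
  then show "h j \<le> h l" "h l + j \<le> h j + l" by auto
qed

lemma dm_mono: "1 \<le> j \<Longrightarrow> j \<le> l \<Longrightarrow> l \<le> n \<Longrightarrow> dm j \<le> dm l"
  using h_mono(1)[of j l] by (simp add: dm_def)

lemma dm_le: "j \<in> {1..n} \<Longrightarrow> dm j \<le> N"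
  using window_le[of j] by (simp add: dm_def)

text \<open>A basis \<open>u\<close> adapted to the first spaces is extended within the next one, by
  completing its coefficient matrix \<open>W\<close> with respect to \<open>a (Suc m)\<close> to an
  invertible matrix. The old columns stay, so the base changes \<open>X j\<close> found earlier
  remain valid. After the last space, \<open>full_rank_extend\<close> adds the remaining
  columns.\<close>

lemma flag_completion:
  assumes fam: "flag_family a" and n: "1 \<le> n"
  obtains g X where "fdet N g \<noteq> 0" "\<And>j. j \<in> {1..n} \<Longrightarrow> fdet (dm j) (X j) \<noteq> 0"
    "\<And>j r c. j \<in> {1..n} \<Longrightarrow> r < N \<Longrightarrow> c < dm j \<Longrightarrow> a j r c = mprod (dm j) g (X j) r c"
proof -
  define spans where "spans m u X \<longleftrightarrow> (\<forall>j\<in>{1..m}. fdet (dm j) (X j) \<noteq> 0 \<and>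
      (\<forall>r<N. \<forall>c<dm j. a j r c = mprod (dm j) u (X j) r c))" for m u X
  have part: "m \<le> n \<longrightarrow> (\<exists>u X. spans m u X)" if "1 \<le> m" for m
    using that
  proof (induction m rule: dec_induct)
    case base
    have "a 1 r c = mprod (dm 1) (a 1) unit_mat r c" if "c < dm 1" for r c
    proof -
      have "mprod (dm 1) (a 1) unit_mat r c = a 1 r c * 1"
        by (rule mprod_delta_right) (use that in auto)
      then show ?thesis by simp
    qed
    moreover have "fdet (dm 1) unit_mat = 1 ^ dm 1" by (rule minor_scalar) simp
    ultimately have "spans 1 (a 1) (\<lambda>_. unit_mat)" unfolding spans_def by simp
    then show ?case by blast
  next
    case (step m)
    show ?case
    proof
      assume m: "Suc m \<le> n"
      then obtain u X where "spans m u X" using step.IH by auto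
      then have u: "\<And>j. j \<in> {1..m} \<Longrightarrow> fdet (dm j) (X j) \<noteq> 0"
        "\<And>j r c. j \<in> {1..m} \<Longrightarrow> r < N \<Longrightarrow> c < dm j \<Longrightarrow> a j r c = mprod (dm j) u (X j) r c"
        unfolding spans_def by blast+
      have mm: "m \<in> {1..m}" "m \<in> {1..n}" "m \<in> {1..<n}" "Suc m \<in> {1..n}" using step.hyps m by auto
      let ?d = "dm m" and ?e = "dm (Suc m)"
      obtain Q where Q: "\<And>r c. r < N \<Longrightarrow> c < ?d \<Longrightarrow> a m r c = mprod ?e (a (Suc m)) Q r c"
        using fam mm(3) unfolding flag_family_def by blast
      obtain Y where Y: "\<And>b r c. c < ?d \<Longrightarrow> mprod ?d (mprod ?d b (X m)) Y r c = b r c"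
        using mprod_right_cancel[OF u(1)[OF mm(1)]] by metis
      define W where "W = mprod ?d Q Y"
      have uW: "u r c = mprod ?e (a (Suc m)) W r c" if "r < N" "c < ?d" for r c
      proof -
        have "u r c = mprod ?d (mprod ?d u (X m)) Y r c" using Y that by simp
        also have "\<dots> = mprod ?d (mprod ?e (a (Suc m)) Q) Y r c"
          by (rule mprod_cong) (use u(2)[OF mm(1)] Q that in auto)
        finally show ?thesis by (simp add: W_def mprod_assoc)
      qed
      have ur: "full_rank N ?d u"
      proof -
        obtain \<alpha> where \<alpha>: "\<forall>r<?d. \<alpha> r < N" "minor ?d (a m) \<alpha> \<noteq> 0"
          using fam mm(2) unfolding flag_family_def full_rank_def by blast
        have "minor ?d (a m) \<alpha> = minor ?d (mprod ?d u (X m)) \<alpha>"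
          by (rule minor_cong) (use u(2)[OF mm(1)] \<alpha> in auto)
        then show ?thesis using \<alpha> by (auto simp: full_rank_def minor_mprod)
      qed
      \<comment> \<open>A kernel vector of \<open>W\<close> is one of \<open>u\<close>, whose
        columns are independent.\<close>
      have "full_rank ?e ?d W"
      proof (rule full_rankI)
        fix z k assume z: "\<And>r. r < ?e \<Longrightarrow> (\<Sum>k<?d. W r k * z k) = (0::complex)" and k: "k < ?d"
        show "z k = 0"
        proof (rule full_rank_kernel[OF ur _ k])
          fix r assume r: "r < N"
          have "(\<Sum>k<?d. u r k * z k) = mprod ?d (mprod ?e (a (Suc m)) W) (\<lambda>k _. z k) r 0"
            unfolding mprod_def[of ?d] by (intro sum.cong) (use uW r in auto)
          also have "\<dots> = mprod ?e (a (Suc m)) (mprod ?d W (\<lambda>k _. z k)) r 0" by (rule mprod_assoc)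
          also have "\<dots> = 0" using z by (simp add: mprod_def)
          finally show "(\<Sum>k<?d. u r k * z k) = 0" .
        qed
      qed
      then obtain W' where W': "fdet ?e W' \<noteq> 0" "\<And>r c. c < ?d \<Longrightarrow> W' r c = W r c"
        by (rule full_rank_extend) blast
      obtain V where V: "fdet ?e V \<noteq> 0" "\<And>b r c. c < ?e \<Longrightarrow> mprod ?e (mprod ?e b W') V r c = b r c"
        using mprod_right_cancel[OF W'(1)] by metis
      define u' where "u' = mprod ?e (a (Suc m)) W'"
      have uu': "u' r c = u r c" if "r < N" "c < ?d" for r c
      proof -
        have "u' r c = mprod ?e (a (Suc m)) W r c" unfolding u'_def by (rule mprod_cong) (use W' that in auto)
        then show ?thesis using uW that by simp
      qed
      have "spans (Suc m) u' (X(Suc m := V))"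
        unfolding spans_def
      proof
        fix j assume j: "j \<in> {1..Suc m}"
        show "fdet (dm j) ((X(Suc m := V)) j) \<noteq> 0 \<and> (\<forall>r<N. \<forall>c<dm j. a j r c = mprod (dm j) u' ((X(Suc m := V)) j) r c)"
        proof (cases "j = Suc m")
          case True
          then show ?thesis using V by (simp add: u'_def)
        next
          case False
          then have j': "j \<in> {1..m}" using j by auto
          have "mprod (dm j) u (X j) r c = mprod (dm j) u' (X j) r c" if "r < N" for r c
            by (rule mprod_cong) (use uu' that dm_mono[of j m] j' m in auto)
          then show ?thesis using u[OF j'] False by simp
        qed
      qed
      then show "\<exists>u X. spans (Suc m) u X" by blast
    qed
  qed
  obtain u X where "spans n u X" using part[OF n] by auto
  then have u: "\<And>j. j \<in> {1..n} \<Longrightarrow> fdet (dm j) (X j) \<noteq> 0"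
    "\<And>j r c. j \<in> {1..n} \<Longrightarrow> r < N \<Longrightarrow> c < dm j \<Longrightarrow> a j r c = mprod (dm j) u (X j) r c"
    unfolding spans_def by blast+
  have nn: "n \<in> {1..n}" using n by simp
  have "full_rank N (dm n) u"
  proof -
    obtain \<alpha> where \<alpha>: "\<forall>r<dm n. \<alpha> r < N" "minor (dm n) (a n) \<alpha> \<noteq> 0"
      using fam nn unfolding flag_family_def full_rank_def by blast
    have "minor (dm n) (a n) \<alpha> = minor (dm n) (mprod (dm n) u (X n)) \<alpha>"
      by (rule minor_cong) (use u(2)[OF nn] \<alpha> in auto)
    then show ?thesis using \<alpha> by (auto simp: full_rank_def minor_mprod)
  qed
  then obtain g where g: "fdet N g \<noteq> 0" "\<And>r c. c < dm n \<Longrightarrow> g r c = u r c"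
    by (rule full_rank_extend) blast
  show ?thesis
  proof (rule that[OF g(1) u(1)])
    fix j r c assume j: "j \<in> {1..n}" "r < N" "c < dm j"
    have "mprod (dm j) u (X j) r c = mprod (dm j) g (X j) r c"
      by (rule mprod_cong) (use g(2) dm_mono[of j n] j in auto)
    then show "a j r c = mprod (dm j) g (X j) r c" using u(2) j by simp
  qed
qed

lemma flag_family_invertible:
  assumes "fdet N g \<noteq> 0"
  shows "flag_family (\<lambda>_. g)"
  unfolding flag_family_def
proof (intro conjI ballI)
  fix j assume "j \<in> {1..n}"
  then show "full_rank N (dm j) g" by (intro full_rank_columns[OF assms] dm_le)
next
  fix j assume j: "j \<in> {1..<n}"
  show "\<exists>X. \<forall>r<N. \<forall>c<dm j. g r c = mprod (dm (Suc j)) g X r c"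
  proof (intro exI[of _ unit_mat] allI impI)
    fix r c assume "c < dm j"
    then have "c < dm (Suc j)" using dm_mono[of j "Suc j"] j by auto
    then have "mprod (dm (Suc j)) g unit_mat r c = g r c * 1"
      by (rule mprod_delta_right) auto
    then show "g r c = mprod (dm (Suc j)) g unit_mat r c" by simp
  qed
qed

end

section \<open>The closure of the Schubert cell\<close>

text \<open>Forms are polynomials, hence continuous in the usual topology; this allows closures of
  orbits to be studied through limits along curves.\<close>

lemma hform_tendsto:
  "hform A d f \<Longrightarrow> (\<And>a. a \<in> A \<Longrightarrow> ((\<lambda>t. x t a) \<longlongrightarrow> y a) F) \<Longrightarrow> ((\<lambda>t. f (x t)) \<longlongrightarrow> f y) F"
  by (induction rule: hform.induct) (auto intro: tendsto_intros)

lemma minor_tendsto: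
  assumes "\<And>r c. r < d \<Longrightarrow> c < d \<Longrightarrow> ((\<lambda>t. a t (\<alpha> r) c) \<longlongrightarrow> b (\<alpha> r) c) F"
  shows "((\<lambda>t. minor d (a t) \<alpha>) \<longlongrightarrow> minor d b \<alpha>) F"
proof -
  have eq: "minor d c \<alpha> = (\<Sum>p\<in>{p. p permutes {0..<d}}. signof p * (\<Prod>r\<in>{0..<d}. c (\<alpha> r) (p r)))" for c
    unfolding minor_def by (subst det_def') (auto simp: permutes_in_image intro!: sum.cong prod.cong)
  show ?thesis
    unfolding eq
    by (intro tendsto_sum tendsto_mult tendsto_const tendsto_prod assms) (auto simp: permutes_in_image)
qed

lemma plv_tendsto:
  assumes "\<And>j r c. j \<in> {1..n} \<Longrightarrow> r < m \<Longrightarrow> c < d j \<Longrightarrow> ((\<lambda>t. a t j r c) \<longlongrightarrow> b j r c) F"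
  shows "((\<lambda>t. plv m n d (a t) I) \<longlongrightarrow> plv m n d b I) F"
  unfolding plv_def using assms pick_less[of I m n d]
  by (auto intro!: tendsto_prod minor_tendsto)

text \<open>The Borel subgroup with the determinant left free; \<open>SL_rescale\<close> normalises
  it when the cell is reached.\<close>

definition upper_mat :: "nat \<Rightarrow> (nat \<Rightarrow> nat \<Rightarrow> complex) \<Rightarrow> bool"
  where "upper_mat N b \<longleftrightarrow> (\<forall>r<N. \<forall>c<r. b r c = 0) \<and> (\<forall>c<N. b c c \<noteq> 0)"

lemma fdet_upper_mat:
  assumes "upper_mat N b"
  shows "fdet N b \<noteq> 0"
proof -
  have "upper_triangular (mat N N (\<lambda>(r, c). b r c))"
    using assms by (auto simp: upper_mat_def)
  then show ?thesis
    unfolding minor_def using upper_triangular_imp_det_eq_0_iff[of "mat N N (\<lambda>(r, c). b r c)" N] assms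
    by (auto simp: upper_mat_def diag_mat_def)
qed

text \<open>Among the vectors in \<open>g\<^sub>c + span {g\<^sub>0, ..., g\<^bsub>c-1\<^esub>}\<close>, \<open>g\<^sub>c\<close> being the columns of \<open>g\<close>, choose
  one whose last nonzero entry is as high as possible. These pivots are distinct, since otherwise
  subtracting a multiple of one of two such vectors from the other would move its pivot up.\<close>

lemma bruhat_columns:
  assumes g: "fdet N g \<noteq> 0"
  obtains u \<pi> where "\<And>c. c < N \<Longrightarrow> u c c = 1" "\<And>c k. c < N \<Longrightarrow> c < k \<Longrightarrow> u k c = 0"
    "bij_betw \<pi> {..<N} {..<N}" "\<And>c. c < N \<Longrightarrow> mprod N g u (\<pi> c) c \<noteq> 0"
    "\<And>r c. r < N \<Longrightarrow> c < N \<Longrightarrow> \<pi> c < r \<Longrightarrow> mprod N g u r c = 0"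
proof -
  define v where "v z r = (\<Sum>k<N. g r k * z k)" for z r
  define Z where "Z c = {z :: nat \<Rightarrow> complex. z c = 1 \<and> (\<forall>k>c. z k = 0)}" for c
  define P where "P c p \<longleftrightarrow> (\<exists>z\<in>Z c. \<forall>r<N. p < r \<longrightarrow> v z r = 0)" for c p
  define \<pi> where "\<pi> c = (LEAST p. P c p)" for c
  have ex: "P c (N - 1)" for c
    unfolding P_def by (rule bexI[of _ "\<lambda>k. if k = c then 1 else 0"]) (auto simp: Z_def)
  have P\<pi>: "P c (\<pi> c)" for c unfolding \<pi>_def by (rule LeastI[of "P c", OF ex])
  have lt: "\<pi> c < N" if "c < N" for c
    unfolding \<pi>_def using Least_le[of "P c", OF ex] that by simp
  have min: "\<not> (\<forall>r<N. \<pi> c \<le> r \<longrightarrow> v z r = 0)" if z: "z \<in> Z c" and c: "c < N" for z c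
  proof
    assume *: "\<forall>r<N. \<pi> c \<le> r \<longrightarrow> v z r = 0"
    show False
    proof (cases "\<pi> c")
      case 0
      have "z c = 0" by (rule minor_kernel[OF g _ c]) (use * 0 in \<open>auto simp: v_def\<close>)
      then show False using z by (simp add: Z_def)
    next
      case (Suc p)
      then have "P c p" unfolding P_def using * z by (intro bexI[of _ z]) auto
      then show False using not_less_Least[of p "P c"] Suc unfolding \<pi>_def by simp
    qed
  qed
  obtain z where z: "\<And>c. z c \<in> Z c" "\<And>c r. r < N \<Longrightarrow> \<pi> c < r \<Longrightarrow> v (z c) r = 0"
    using P\<pi> unfolding P_def by metis
  have nz: "v (z c) (\<pi> c) \<noteq> 0" if "c < N" for c
  proof
    assume "v (z c) (\<pi> c) = 0"
    then have "\<forall>r<N. \<pi> c \<le> r \<longrightarrow> v (z c) r = 0" using z(2) le_neq_implies_less by metis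
    then show False using min[OF z(1) that] by blast
  qed
  have dist: "\<pi> c \<noteq> \<pi> c'" if cc: "c < c'" "c' < N" for c c'
  proof
    assume eq: "\<pi> c = \<pi> c'"
    define l where "l = v (z c') (\<pi> c) / v (z c) (\<pi> c)"
    define x where "x k = z c' k - l * z c k" for k
    have vx: "v x r = v (z c') r - l * v (z c) r" for r
      by (simp add: v_def x_def algebra_simps sum_subtractf sum_distrib_left)
    have "x \<in> Z c'" using z(1)[of c] z(1)[of c'] cc by (auto simp: Z_def x_def)
    moreover have "v x r = 0" if "r < N" "\<pi> c' \<le> r" for r
    proof (cases "r = \<pi> c")
      case True
      then show ?thesis using nz[of c] cc unfolding vx by (simp add: l_def)
    next
      case False
      then show ?thesis using z(2)[of r c] z(2)[of r c'] that eq unfolding vx by simp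
    qed
    ultimately show False using min[of x c'] cc by blast
  qed
  have "inj_on \<pi> {..<N}"
    using dist by (intro linorder_inj_onI) auto
  moreover have "\<pi> ` {..<N} \<subseteq> {..<N}" using lt by auto
  ultimately have "bij_betw \<pi> {..<N} {..<N}" by (simp add: bij_betw_def endo_inj_surj)
  moreover have "mprod N g (\<lambda>k c. z c k) r c = v (z c) r" for r c by (simp add: mprod_def v_def)
  ultimately show ?thesis
    using z nz by (intro that[of "\<lambda>k c. z c k" \<pi>]) (auto simp: Z_def)
qed

text \<open>\<open>w_image\<close> describes the coordinate flag of \<open>w\<close>: besides the
  forced positions, each space takes the last \<open>j\<close> positions of its window, the highest
  ones that the bounds allow.\<close>

locale schubert_window = window +
  fixes w :: "nat \<Rightarrow> nat"
  assumes n_pos: "1 \<le> n"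
    and w_bij: "bij_betw w {..<N} {..<N}"
    and w_image: "j \<in> {1..n} \<Longrightarrow> w ` {..<dm j} = {..<h j} \<union> {h j + n + 1 - j..<h j + n + 1}"
begin

lemma dm_le_all: "\<forall>j\<in>{1..n}. dm j \<le> N"
  using dm_le by blast

abbreviation cell_lines :: "((nat \<Rightarrow> nat set) \<Rightarrow> complex) set set"
  where "cell_lines \<equiv> {line (orbit_vec N n dm (entries (b * u))) | b u. b \<in> borel_subgroup N \<and> u \<in> weyl_lifts N w}"

text \<open>The triangular matrix and the permutation matrix of \<open>w\<close> are rescaled
  separately to determinant 1; their product changes by a scalar only.\<close>

lemma upper_mat_in_cell:
  assumes b: "upper_mat N b"
  shows "line (orbit_vec N n dm (\<lambda>r c. b r (w c))) \<in> cell_lines"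
proof -
  define p where "p r c = (if r = w c then 1 else 0 :: complex)" for r c
  obtain B s where B: "B \<in> carrier (SL N)" "s \<noteq> 0" "\<And>r c. r < N \<Longrightarrow> c < N \<Longrightarrow> B $$ (r, c) = s * b r c"
    using SL_rescale[OF fdet_upper_mat[OF b]] by metis
  have wlt: "w c < N" if "c < N" for c using w_bij that by (auto simp: bij_betw_def)
  have "full_rank N N p"
  proof (rule full_rankI)
    fix z k assume z: "\<And>r. r < N \<Longrightarrow> (\<Sum>k<N. p r k * z k) = (0::complex)" and k: "k < N"
    have "w k = w l \<longleftrightarrow> l = k" if "l < N" for l
      using bij_betw_imp_inj_on[OF w_bij] that k by (auto dest: inj_onD)
    then have "(\<Sum>l<N. p (w k) l * z l) = (\<Sum>l<N. if l = k then z l else 0)"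
      by (intro sum.cong) (auto simp: p_def)
    then show "z k = 0" using z[OF wlt[OF k]] k by simp
  qed
  then have "fdet N p \<noteq> 0" by (simp add: full_rank_square)
  then obtain U t where U: "U \<in> carrier (SL N)" "t \<noteq> 0" "\<And>r c. r < N \<Longrightarrow> c < N \<Longrightarrow> U $$ (r, c) = t * p r c"
    using SL_rescale by metis
  have "B \<in> borel_subgroup N"
    using B b by (auto simp: borel_subgroup_def SL_carrier upper_mat_def)
  moreover have "U \<in> weyl_lifts N w"
    using U by (auto simp: weyl_lifts_def p_def)
  moreover have "line (orbit_vec N n dm (entries (B * U))) = line (orbit_vec N n dm (\<lambda>r c. b r (w c)))"
  proof (rule orbit_vec_scale)
    fix r c assume rc: "r < N" "c < N"
    have "entries (B * U) r c = mprod N (entries B) (entries U) r c"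
      using B U rc by (intro entries_mult) (auto simp: SL_carrier)
    also have "\<dots> = entries B r (w c) * t"
      by (rule mprod_delta_right) (use U(3) rc wlt in \<open>auto simp: p_def\<close>)
    finally show "entries (B * U) r c = (s * t) * b r (w c)" using B(3) rc wlt by simp
  qed (use B U dm_le_all in auto)
  ultimately show ?thesis by blast
qed

lemma w_less_iff: "l < N \<Longrightarrow> j \<in> {1..n} \<Longrightarrow> w l < h j \<Longrightarrow> l < dm j"
proof -
  assume l: "l < N" "j \<in> {1..n}" "w l < h j"
  then have "w l \<in> w ` {..<dm j}" using w_image by blast
  then obtain k where k: "k < dm j" "w l = w k" by blast
  then have "l = k" using bij_betw_imp_inj_on[OF w_bij] l dm_le[OF l(2)] by (auto dest: inj_onD)
  then show ?thesis using k by simp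
qed

text \<open>An upper triangular invertible matrix preserves each span of the first few standard
  vectors, so the bounds satisfied by the flag of \<open>w\<close> persist.\<close>

lemma cell_in_T_deg_vecs:
  assumes b: "b \<in> borel_subgroup N" and u: "u \<in> weyl_lifts N w"
  shows "line (orbit_vec N n dm (entries (b * u))) \<in> line ` T ` deg_vecs"
proof (rule flag_family_in_T_deg_vecs)
  have bc: "b \<in> carrier_mat N N" "det b = 1" and uc: "u \<in> carrier_mat N N" "det u = 1"
    using b u by (auto simp: borel_subgroup_def weyl_lifts_def SL_carrier)
  have wlt: "w c < N" if "c < N" for c using w_bij that by (auto simp: bij_betw_def)
  have bu: "entries (b * u) r c = entries b r (w c) * entries u (w c) c" if "r < N" "c < N" for r c
  proof -
    have "entries (b * u) r c = mprod N (entries b) (entries u) r c"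
      using that by (intro entries_mult bc uc)
    also have "\<dots> = entries b r (w c) * entries u (w c) c"
      by (rule mprod_delta_right) (use u that wlt in \<open>auto simp: weyl_lifts_def\<close>)
    finally show ?thesis .
  qed
  have fb: "fdet N (entries b) \<noteq> 0" "fdet N (entries (b * u)) \<noteq> 0"
    using bc uc by (auto simp: fdet_entries det_mult)
  have ub: "entries b r c = 0" if "c < r" "r < N" for r c
    using b bc that by (auto simp: borel_subgroup_def)
  have u0: "entries u (w c) c \<noteq> 0" if c: "c < N" for c
  proof
    assume "entries u (w c) c = 0"
    then have "entries (b * u) r c = 0" if "r < N" for r using bu that c by simp
    then have *: "(\<Sum>k<N. entries (b * u) r k * (if k = c then 1 else 0)) = 0" if "r < N" for r
      using that by (intro sum.neutral) auto
    have "(if c = c then 1 else 0) = (0::complex)"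
      by (rule minor_kernel[OF fb(2) _ c, of "\<lambda>k. if k = c then 1 else 0"]) (use * in blast)
    then show False by simp
  qed
  have diag: "entries b c c \<noteq> 0" if "c < N" for c
    using bc b that upper_triangular_imp_det_eq_0_iff[of b N]
    by (auto simp: borel_subgroup_def diag_mat_def)
  show "flag_family (\<lambda>_. entries (b * u))" by (rule flag_family_invertible[OF fb(2)])
  fix j assume j: "j \<in> {1..n}"
  {
    fix r c assume rc: "h j + n + 1 \<le> r" "r < N" "c < dm j"
    have "w c \<in> w ` {..<dm j}" using rc by blast
    then have "w c < h j + n + 1" using w_image[OF j] j by auto
    then show "entries (b * u) r c = 0" using bu[of r c] ub[of "w c" r] rc dm_le[OF j] by simp
  next
    fix x assume x: "x < h j"
    have hN: "h j \<le> N" using window_le[OF j] by simp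
    have "upper_mat (h j) (entries b)" using ub diag hN by (auto simp: upper_mat_def)
    then obtain y where y: "\<And>r c. r < h j \<Longrightarrow> c < h j \<Longrightarrow> mprod (h j) (entries b) y r c = (if r = c then 1 else 0)"
      using fdet_inverse[OF fdet_upper_mat] by metis
    \<comment> \<open>Column \<open>l\<close> of \<open>b * u\<close> is column \<open>w l\<close>
      of \<open>b\<close> times the entry of \<open>u\<close> at \<open>(w l, l)\<close>. Division
      by that entry reduces the equation to the leading block of \<open>b\<close>, whose inverse is
      \<open>y\<close>.\<close>
    define z where "z l = (if w l < h j then y (w l) x / entries u (w l) l else 0)" for l
    have z0: "z l = 0" if "l < N" "\<not> l < dm j" for l
      using w_less_iff[OF that(1) j] that(2) by (auto simp: z_def)
    have "(\<Sum>l<dm j. entries (b * u) r l * z l) = (if r = x then 1 else 0)" if r: "r < N" for r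
    proof -
      have "(\<Sum>l<dm j. entries (b * u) r l * z l) = (\<Sum>l<N. entries (b * u) r l * z l)"
        by (rule sum.mono_neutral_left) (use dm_le[OF j] z0 in auto)
      also have "\<dots> = (\<Sum>l<N. (if w l < h j then entries b r (w l) * y (w l) x else 0))"
        by (intro sum.cong) (use bu[OF r] u0 in \<open>auto simp: z_def\<close>)
      also have "\<dots> = (\<Sum>s<N. (if s < h j then entries b r s * y s x else 0))"
        by (rule sum.reindex_bij_betw[OF w_bij, of "\<lambda>s. if s < h j then entries b r s * y s x else 0"])
      also have "\<dots> = (\<Sum>s<h j. if s < h j then entries b r s * y s x else 0)"
        by (rule sum.mono_neutral_right) (use hN in auto)
      also have "\<dots> = mprod (h j) (entries b) y r x" by (simp add: mprod_def)
      also have "\<dots> = (if r = x then 1 else 0)"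
      proof (cases "r < h j")
        case True
        then show ?thesis using y x by simp
      next
        case False
        then show ?thesis using ub[of _ r] r x by (auto simp: mprod_def)
      qed
      finally show ?thesis .
    qed
    then show "\<exists>z. \<forall>r<N. (\<Sum>l<dm j. entries (b * u) r l * z l) = (if r = x then 1 else 0)" by blast
  }
qed

section \<open>Coordinate flags within the bounds\<close>

definition admissible :: "(nat \<Rightarrow> nat) \<Rightarrow> bool"
  where "admissible \<pi> \<longleftrightarrow> bij_betw \<pi> {..<N} {..<N} \<and>
    (\<forall>j\<in>{1..n}. {..<h j} \<subseteq> \<pi> ` {..<dm j} \<and> \<pi> ` {..<dm j} \<subseteq> {..<h j + n + 1})"

text \<open>It is bounded and grows with every transposition used, so its distance from the bound is
  the measure for the induction in \<open>form_vanishes\<close>.\<close>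

definition weight :: "(nat \<Rightarrow> nat) \<Rightarrow> nat"
  where "weight \<pi> = (\<Sum>j=1..n. \<Sum>c<dm j. \<pi> c)"

lemma weight_le:
  assumes "admissible \<pi>"
  shows "weight \<pi> \<le> n * (N * N)"
proof -
  have "(\<Sum>c<dm j. \<pi> c) \<le> N * N" if j: "j \<in> {1..n}" for j
  proof -
    have "\<pi> c \<le> N" if "c < N" for c
      using assms that by (auto simp: admissible_def bij_betw_def intro: less_imp_le)
    then have "(\<Sum>c<dm j. \<pi> c) \<le> of_nat (card {..<dm j}) * N"
      using dm_le[OF j] by (intro sum_bounded_above) auto
    also have "\<dots> \<le> N * N" using dm_le[OF j] by simp
    finally show ?thesis .
  qed
  then have "weight \<pi> \<le> of_nat (card {1..n}) * (N * N)"
    unfolding weight_def by (intro sum_bounded_above) auto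
  then show ?thesis by simp
qed

lemma transpose_image:
  assumes "inj_on \<pi> {..<N}" "ca < cb" "cb < N" "d \<le> N"
  shows "(\<pi> \<circ> transpose ca cb) ` {..<d} =
    (if ca < d \<and> d \<le> cb then insert (\<pi> cb) (\<pi> ` {..<d} - {\<pi> ca}) else \<pi> ` {..<d})"
proof (cases "ca < d \<and> d \<le> cb")
  case True
  have "(\<pi> \<circ> transpose ca cb) ` {..<d} = insert (\<pi> cb) (\<pi> ` ({..<d} - {ca}))"
  proof -
    have "{..<d} = insert ca ({..<d} - {ca})" using True by auto
    moreover have "(\<pi> \<circ> transpose ca cb) ` ({..<d} - {ca}) = \<pi> ` ({..<d} - {ca})"
      by (rule image_cong) (use True in \<open>auto simp: transpose_def\<close>)
    ultimately show ?thesis by (metis comp_apply image_insert transpose_apply_first)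
  qed
  also have "\<pi> ` ({..<d} - {ca}) = \<pi> ` {..<d} - {\<pi> ca}"
    by (subst inj_on_image_set_diff[OF assms(1)]) (use True assms in auto)
  finally show ?thesis using True by simp
next
  case False
  then have "transpose ca cb ` {..<d} = {..<d}"
    using assms(2) by (cases "cb < d") (auto simp: transpose_image_eq intro!: image_cong[of _ _ _ id, simplified] simp: transpose_def)
  then have "(\<pi> \<circ> transpose ca cb) ` {..<d} = \<pi> ` {..<d}" by (simp only: image_comp[symmetric])
  then show ?thesis unfolding if_not_P[OF False] .
qed

lemma weight_transpose:
  assumes inj: "inj_on \<pi> {..<N}" and c: "ca < cb" "cb < N" "\<pi> ca < \<pi> cb"
    and j: "j \<in> {1..n}" "ca < dm j" "dm j \<le> cb"
  shows "weight \<pi> < weight (\<pi> \<circ> transpose ca cb)"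
proof -
  have *: "(\<Sum>c<dm l. \<pi> c) \<le> (\<Sum>c<dm l. (\<pi> \<circ> transpose ca cb) c)" for l
  proof (cases "cb < dm l")
    case True
    then have "transpose ca cb permutes {..<dm l}" using c by (intro permutes_swap_id) auto
    from sum.permute[OF this, of \<pi>] show ?thesis by simp
  next
    case False
    then show ?thesis using c by (intro sum_mono) (auto simp: transpose_def)
  qed
  have **: "(\<Sum>c<dm j. \<pi> c) < (\<Sum>c<dm j. (\<pi> \<circ> transpose ca cb) c)"
    by (rule sum_strict_mono_ex1) (use j c in \<open>auto simp: transpose_def intro!: bexI[of _ ca]\<close>)
  show ?thesis
    unfolding weight_def by (rule sum_strict_mono_ex1) (use * ** j in auto)
qed

text \<open>At the first \<open>j\<close> where the flag differs from that of \<open>w\<close>, some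
  \<open>a\<close> in its space could be higher. It is exchanged with the value of the earliest
  column outside the space whose value is above \<open>a\<close> and below the end of the window of
  \<open>j\<close>. Taking the earliest one keeps the spaces in between within their bounds.\<close>

lemma admissible_step:
  assumes adm: "admissible \<pi>" and not_top: "\<exists>j\<in>{1..n}. \<pi> ` {..<dm j} \<noteq> w ` {..<dm j}"
  obtains ca cb where "ca < cb" "cb < N" "\<pi> ca < \<pi> cb"
    "admissible (\<pi> \<circ> transpose ca cb)" "weight \<pi> < weight (\<pi> \<circ> transpose ca cb)"
proof -
  define S where "S j = \<pi> ` {..<dm j}" for j
  have bij: "bij_betw \<pi> {..<N} {..<N}" and lo: "\<And>j. j \<in> {1..n} \<Longrightarrow> {..<h j} \<subseteq> S j"
    and hi: "\<And>j. j \<in> {1..n} \<Longrightarrow> S j \<subseteq> {..<h j + n + 1}"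
    using adm by (auto simp: admissible_def S_def)
  have inj: "inj_on \<pi> {..<N}" using bij by (simp add: bij_betw_def)
  have fin: "finite (S j)" for j by (simp add: S_def)
  have cardS: "card (S j) = dm j" if "j \<in> {1..n}" for j
    unfolding S_def using inj_on_subset[OF inj, of "{..<dm j}"] dm_le[OF that] by (simp add: card_image)
  have memS: "\<pi> c \<in> S j \<longleftrightarrow> c < dm j" if "c < N" "j \<in> {1..n}" for c j
    using inj_on_image_mem_iff[OF inj, of c "{..<dm j}"] that dm_le[OF that(2)] by (auto simp: S_def)
  have Smono: "S j \<subseteq> S l" if "1 \<le> j" "j \<le> l" "l \<le> n" for j l
    unfolding S_def using dm_mono[OF that] by (intro image_mono) auto
  define top where "top j = w ` {..<dm j}" for j
  have top: "top j = {..<h j} \<union> {h j + n + 1 - j..<h j + n + 1}" if "j \<in> {1..n}" for j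
    using w_image[OF that] by (simp add: top_def)
  have cardtop: "card (top j) = dm j" if "j \<in> {1..n}" for j
    unfolding top_def using inj_on_subset[OF bij_betw_imp_inj_on[OF w_bij], of "{..<dm j}"] dm_le[OF that]
    by (simp add: card_image)
  define j where "j = (LEAST j. j \<in> {1..n} \<and> S j \<noteq> top j)"
  have "\<exists>j. j \<in> {1..n} \<and> S j \<noteq> top j" using not_top unfolding S_def top_def by blast
  then have j: "j \<in> {1..n}" "S j \<noteq> top j" unfolding j_def by (metis (mono_tags, lifting) LeastI_ex)+
  have jmin: "S l = top l" if "1 \<le> l" "l < j" for l
    using not_less_Least[of l "\<lambda>j. j \<in> {1..n} \<and> S j \<noteq> top j"] that j unfolding j_def by auto
  have "\<not> S j \<subseteq> top j" using card_subset_eq[of "top j" "S j"] j cardS cardtop by (auto simp: top)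
  then obtain a where a: "a \<in> S j" "a \<notin> top j" by blast
  \<comment> \<open>Outside \<open>top j\<close>, the value \<open>a\<close> is not forced and not
    among the last \<open>j\<close> positions of the window.\<close>
  have ah: "h j \<le> a" "a < h j + n + 1 - j" using a hi[OF j(1)] top[OF j(1)] by auto
  have "\<not> top j \<subseteq> S j" using card_subset_eq[of "S j" "top j"] j cardS cardtop fin by auto
  then obtain b0 where b0: "b0 \<in> top j" "b0 \<notin> S j" by blast
  have b0h: "a < b0" "b0 < h j + n + 1" using b0 lo[OF j(1)] top[OF j(1)] ah by auto
  define Q where "Q c \<longleftrightarrow> c < N \<and> \<pi> c \<notin> S j \<and> a < \<pi> c \<and> \<pi> c < h j + n + 1" for c
  have "b0 \<in> \<pi> ` {..<N}" using bij_betw_imp_surj_on[OF bij] b0h window_le[OF j(1)] by simp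
  then have "\<exists>c. Q c" using b0 b0h by (auto simp: Q_def)
  define cb where "cb = (LEAST c. Q c)"
  have Qcb: "Q cb" unfolding cb_def by (rule LeastI_ex) fact
  have cbmin: "cb \<le> c" if "Q c" for c unfolding cb_def by (rule Least_le) fact
  obtain ca where ca: "ca < dm j" "\<pi> ca = a" using a by (auto simp: S_def)
  have caN: "ca < N" using ca dm_le[OF j(1)] by simp
  have cbN: "cb < N" and cbj: "dm j \<le> cb" using Qcb memS[OF _ j(1), of cb] by (auto simp: Q_def)
  have cacb: "ca < cb" using ca cbj by simp
  \<comment> \<open>The top part of the window at \<open>l < j\<close> begins no earlier than the
    one at \<open>j\<close>, so it does not contain \<open>a\<close> either.\<close>
  have anS: "a \<notin> S l" if l: "1 \<le> l" "l < j" for l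
  proof -
    have "l \<in> {1..n}" using l j by auto
    have "h l \<le> h j" "h j + l \<le> h l + j" using h_mono[of l j] l j by auto
    then show ?thesis using jmin[OF l] top[OF \<open>l \<in> {1..n}\<close>] ah l by auto
  qed
  have key: "h l \<le> a \<and> \<pi> cb < h l + n + 1" if l: "l \<in> {1..n}" "ca < dm l" "dm l \<le> cb" for l
  proof -
    have "a \<in> S l" using memS[OF caN l(1)] l ca by simp
    then have jl: "j \<le> l" using anS[of l] l by force
    have hm: "h j \<le> h l" "h l + j \<le> h j + l" using h_mono[of j l] jl l j by auto
    have "h l \<le> a"
    proof (rule ccontr)
      assume al: "\<not> h l \<le> a"
      \<comment> \<open>If \<open>a\<close> were a forced position at \<open>l\<close>, minimality
        of \<open>cb\<close> would confine the new values in \<open>S l\<close> to positions below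
        \<open>a\<close> or beyond the window of \<open>j\<close>. These are fewer than
        \<open>2 * (h l - h j)\<close>, whereas \<open>dm l - dm j\<close> is at least that, as
        \<open>h l - h j\<close> is at most \<open>l - j\<close>.\<close>
      have sub: "S l - S j \<subseteq> {h j..<a} \<union> {h j + n + 1..<h l + n + 1}"
      proof
        fix x assume x: "x \<in> S l - S j"
        then obtain c where c: "c < dm l" "x = \<pi> c" by (auto simp: S_def)
        then have "\<not> Q c" using cbmin[of c] l by auto
        then have "\<not> (a < x \<and> x < h j + n + 1)" using c x dm_le[OF l(1)] by (auto simp: Q_def)
        moreover have "x \<noteq> a" using x a by auto
        moreover have "h j \<le> x" using x lo[OF j(1)] by (meson DiffD2 lessThan_iff not_le subsetD)
        moreover have "x < h l + n + 1" using x hi[OF l(1)] by auto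
        ultimately show "x \<in> {h j..<a} \<union> {h j + n + 1..<h l + n + 1}" by auto
      qed
      have "card (S l - S j) = dm l - dm j"
        using card_Diff_subset[OF fin Smono[of j l]] jl j l cardS by auto
      moreover have "card (S l - S j) \<le> card ({h j..<a} \<union> {h j + n + 1..<h l + n + 1})"
        by (rule card_mono[OF _ sub]) simp
      moreover have "\<dots> \<le> (a - h j) + (h l - h j)"
        by (rule order_trans[OF card_Un_le]) simp
      ultimately show False using al hm ah jl by (simp add: dm_def)
    qed
    moreover have "\<pi> cb < h l + n + 1" using Qcb hm by (auto simp: Q_def)
    ultimately show ?thesis by blast
  qed
  have ab: "\<pi> ca < \<pi> cb" using Qcb ca by (simp add: Q_def)
  have "bij_betw (\<pi> \<circ> transpose ca cb) {..<N} {..<N}"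
    using bij_betw_trans[OF permutes_imp_bij[OF permutes_swap_id] bij, of ca cb] caN cbN by simp
  moreover have "{..<h l} \<subseteq> (\<pi> \<circ> transpose ca cb) ` {..<dm l} \<and> (\<pi> \<circ> transpose ca cb) ` {..<dm l} \<subseteq> {..<h l + n + 1}"
    if l: "l \<in> {1..n}" for l
  proof (cases "ca < dm l \<and> dm l \<le> cb")
    case True
    then have eq: "(\<pi> \<circ> transpose ca cb) ` {..<dm l} = insert (\<pi> cb) (S l - {a})"
      unfolding S_def transpose_image[OF inj cacb cbN dm_le[OF l]] ca(2) by (rule if_P)
    show ?thesis unfolding eq using key[OF l] True lo[OF l] hi[OF l] by auto
  next
    case False
    then have eq: "(\<pi> \<circ> transpose ca cb) ` {..<dm l} = S l"
      unfolding S_def transpose_image[OF inj cacb cbN dm_le[OF l]] by (rule if_not_P)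
    show ?thesis unfolding eq using lo[OF l] hi[OF l] by simp
  qed
  ultimately have "admissible (\<pi> \<circ> transpose ca cb)" by (simp add: admissible_def)
  moreover have "weight \<pi> < weight (\<pi> \<circ> transpose ca cb)"
    by (rule weight_transpose[OF inj cacb cbN ab j(1) ca(1) cbj])
  ultimately show ?thesis using that cacb cbN ab by blast
qed

text \<open>The \<open>B\<close>-orbit of \<open>\<pi>\<close> is in the closure of that of \<open>\<pi> \<circ> transpose ca cb\<close>, along the curve obtained
  by adding \<open>t\<close> times column \<open>cb\<close> to column \<open>ca\<close>, for \<open>t\<close> tending to 0.\<close>

lemma form_vanishes:
  assumes f: "hform (multi_index N n dm) e f"
    and cell: "\<And>b. upper_mat N b \<Longrightarrow> f (orbit_vec N n dm (\<lambda>r c. b r (w c))) = 0"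
  shows "admissible \<pi> \<Longrightarrow> upper_mat N b \<Longrightarrow> f (orbit_vec N n dm (\<lambda>r c. b r (\<pi> c))) = 0"
proof (induction "n * (N * N) - weight \<pi>" arbitrary: \<pi> b rule: less_induct)
  case less
  have bij: "bij_betw \<pi> {..<N} {..<N}" using less.prems by (simp add: admissible_def)
  show ?case
  proof (cases "\<exists>j\<in>{1..n}. \<pi> ` {..<dm j} \<noteq> w ` {..<dm j}")
    case False
    \<comment> \<open>Both flags consist of the same coordinate spaces; \<open>X\<close> rearranges
      their basis vectors.\<close>
    define X where "X k c = (if w k = \<pi> c then 1 else 0 :: complex)" for k c
    have "b r (\<pi> c) = mprod (dm j) (\<lambda>r c. b r (w c)) X r c" if j: "j \<in> {1..n}" and c: "c < dm j" for j r c
    proof -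
      have "\<pi> c \<in> w ` {..<dm j}" using False j c by blast
      then obtain k where k: "k < dm j" "w k = \<pi> c" by auto
      have "mprod (dm j) (\<lambda>r c. b r (w c)) X r c = b r (w k) * 1"
      proof (rule mprod_delta_right[OF k(1)])
        fix l assume "l < dm j"
        then have "w l = w k \<longleftrightarrow> l = k"
          by (intro inj_on_eq_iff[OF bij_betw_imp_inj_on[OF w_bij]]) (use k dm_le[OF j] in auto)
        then show "X l c = (if l = k then 1 else 0)" using k by (simp add: X_def)
      qed
      then show ?thesis using k by simp
    qed
    then have "orbit_vec N n dm (\<lambda>r c. b r (\<pi> c)) =
        (\<lambda>I. (\<Prod>j=1..n. fdet (dm j) X) * orbit_vec N n dm (\<lambda>r c. b r (w c)) I)"
      by (intro plv_mprod) auto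
    then show ?thesis using hform_homogeneous[OF f] cell[OF less.prems(2)] by simp
  next
    case True
    obtain ca cb where cc: "ca < cb" "cb < N" "\<pi> ca < \<pi> cb"
      and adm: "admissible (\<pi> \<circ> transpose ca cb)" and wt: "weight \<pi> < weight (\<pi> \<circ> transpose ca cb)"
      by (rule admissible_step[OF less.prems(1) True])
    define \<sigma> where "\<sigma> = \<pi> \<circ> transpose ca cb"
    have \<sigma>: "\<sigma> c = (if c = ca then \<pi> cb else if c = cb then \<pi> ca else \<pi> c)" for c
      by (simp add: \<sigma>_def transpose_def)
    have IH: "f (orbit_vec N n dm (\<lambda>r c. b r (\<sigma> c))) = 0" if "upper_mat N b" for b
      unfolding \<sigma>_def by (rule less.hyps[OF _ adm that]) (use wt weight_le[OF adm] in linarith)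
    define g where "g t r c = b r (\<pi> c) + (if c = ca then b r (\<pi> cb) else 0) * t" for t r c
    have van: "f (orbit_vec N n dm (g t)) = 0" if t: "t \<noteq> 0" for t
    proof -
      \<comment> \<open>For \<open>t \<noteq> 0\<close>, \<open>g t\<close> has, up to column
        operations, the flag of \<open>B\<close> with columns permuted by \<open>\<sigma>\<close>.
        Column \<open>\<pi> cb\<close> of \<open>B\<close> is the new column \<open>ca\<close> of
        \<open>g t\<close>; it fits the triangular shape because \<open>\<pi> ca < \<pi> cb\<close>,
        and its diagonal entry is a multiple of \<open>t\<close>.\<close>
      define B where "B r c = (if c = \<pi> cb then b r (\<pi> ca) + t * b r (\<pi> cb) else b r c)" for r c
      have b: "b r c = 0" if "r < N" "c < r" for r c
        using less.prems(2) that by (auto simp: upper_mat_def)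
      have b0: "b c c \<noteq> 0" if "c < N" for c
        using less.prems(2) that by (auto simp: upper_mat_def)
      have "upper_mat N B"
        unfolding upper_mat_def
      proof (intro conjI allI impI)
        show "B r c = 0" if "r < N" "c < r" for r c
          using b[OF that] b[of r "\<pi> ca"] that cc by (auto simp: B_def)
        show "B c c \<noteq> 0" if "c < N" for c
          using b[of c "\<pi> ca"] b0[OF that] that cc t by (auto simp: B_def)
      qed
      define A where "A r c = B r (\<sigma> c)" for r c
      \<comment> \<open>Column \<open>cb\<close> of \<open>g t\<close> is the difference of the
        columns \<open>ca\<close> and \<open>cb\<close> of \<open>A\<close> divided by
        \<open>t\<close>. A space containing column \<open>cb\<close> contains both, as
        \<open>ca < cb\<close>.\<close>
      define X where "X k c = (if c = cb then (if k = ca then 1 / t else 0) + (if k = cb then - 1 / t else 0)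
        else if k = c then 1 else 0)" for k c
      have \<pi>ne: "\<pi> c \<noteq> \<pi> cb" if "c < N" "c \<noteq> cb" for c
        using bij_betw_imp_inj_on[OF bij] that cc by (auto dest: inj_onD)
      have "g t r c = mprod (dm j) A X r c" if j: "j \<in> {1..n}" and c: "c < dm j" for j r c
      proof (cases "c = cb")
        case True
        have "mprod (dm j) A X r c = (\<Sum>k<dm j. (if k = ca then A r k * (1 / t) else 0) + (if k = cb then A r k * (- 1 / t) else 0))"
          unfolding mprod_def by (intro sum.cong) (auto simp: X_def True)
        also have "\<dots> = A r ca * (1 / t) + A r cb * (- 1 / t)"
          using c cc True by (simp add: sum.distrib)
        also have "\<dots> = b r (\<pi> cb)"
          using t cc \<pi>ne[of ca] by (simp add: A_def B_def \<sigma> field_simps)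
        finally show ?thesis using True cc by (simp add: g_def)
      next
        case False
        have "mprod (dm j) A X r c = A r c * 1"
          by (rule mprod_delta_right[OF c]) (use False in \<open>auto simp: X_def\<close>)
        also have "\<dots> = g t r c"
        proof (cases "c = ca")
          case True
          then show ?thesis by (simp add: A_def B_def g_def \<sigma> mult.commute)
        next
          case False
          then show ?thesis
            using \<open>c \<noteq> cb\<close> \<pi>ne[of c] c dm_le[OF j] by (simp add: A_def B_def g_def \<sigma>)
        qed
        finally show ?thesis by simp
      qed
      then have "orbit_vec N n dm (g t) = (\<lambda>I. (\<Prod>j=1..n. fdet (dm j) X) * orbit_vec N n dm A I)"
        by (intro plv_mprod) auto
      moreover have "f (orbit_vec N n dm A) = 0"
        unfolding A_def by (rule IH) fact
      ultimately show ?thesis using hform_homogeneous[OF f] by simp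
    qed
    have "((\<lambda>t. f (orbit_vec N n dm (g t))) \<longlongrightarrow> f (orbit_vec N n dm (\<lambda>r c. b r (\<pi> c)))) (at 0)"
    proof (intro hform_tendsto[OF f] plv_tendsto)
      fix r c
      have "((\<lambda>t. g t r c) \<longlongrightarrow> b r (\<pi> c) + (if c = ca then b r (\<pi> cb) else 0) * 0) (at 0)"
        unfolding g_def by (intro tendsto_intros)
      then show "((\<lambda>t. g t r c) \<longlongrightarrow> b r (\<pi> c)) (at 0)" by simp
    qed
    moreover have "((\<lambda>t. f (orbit_vec N n dm (g t))) \<longlongrightarrow> 0) (at 0)"
    proof (rule tendsto_eventually)
      show "\<forall>\<^sub>F t in at 0. f (orbit_vec N n dm (g t)) = 0"
        using eventually_neq_at_within[of 0 0 UNIV] by (rule eventually_mono) (rule van)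
    qed
    ultimately show ?thesis by (rule tendsto_unique[OF at_neq_bot])
  qed
qed

text \<open>The point beyond \<open>bruhat_columns\<close> is that \<open>\<pi>\<close> inherits the
  bounds. The upper bound holds because a pivot entry is nonzero. For the lower one, among the
  columns combining to the unit vector at \<open>x\<close> the largest pivot survives, so it equals
  \<open>x\<close>.\<close>

lemma invertible_flag_to_fixed_point:
  assumes g: "fdet N g \<noteq> 0"
    and low: "\<And>j x. j \<in> {1..n} \<Longrightarrow> x < h j \<Longrightarrow> \<exists>z. \<forall>r<N. (\<Sum>l<dm j. g r l * z l) = (if r = x then 1 else 0)"
    and high: "\<And>j r c. j \<in> {1..n} \<Longrightarrow> h j + n + 1 \<le> r \<Longrightarrow> r < N \<Longrightarrow> c < dm j \<Longrightarrow> g r c = 0"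
  obtains b \<pi> s where "admissible \<pi>" "upper_mat N b" "s \<noteq> 0"
    "orbit_vec N n dm (\<lambda>r c. b r (\<pi> c)) = (\<lambda>I. s * orbit_vec N n dm g I)"
proof -
  obtain u \<pi> where u: "\<And>c. c < N \<Longrightarrow> u c c = 1" "\<And>c k. c < N \<Longrightarrow> c < k \<Longrightarrow> u k c = 0"
    and bij: "bij_betw \<pi> {..<N} {..<N}" and piv: "\<And>c. c < N \<Longrightarrow> mprod N g u (\<pi> c) c \<noteq> 0"
    "\<And>r c. r < N \<Longrightarrow> c < N \<Longrightarrow> \<pi> c < r \<Longrightarrow> mprod N g u r c = 0"
    using bruhat_columns[OF g] by metis
  define \<beta> where "\<beta> = mprod N g u"
  have \<pi>lt: "\<pi> c < N" if "c < N" for c using bij that by (auto simp: bij_betw_def)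
  have uu: "upper_mat d u" if "d \<le> N" for d
    using u that by (auto simp: upper_mat_def)
  have \<beta>: "\<beta> r c = mprod (dm j) g u r c" if "j \<in> {1..n}" "c < dm j" for j r c
    unfolding \<beta>_def mprod_def
    by (rule sum.mono_neutral_right) (use dm_le[OF that(1)] that u(2)[of c] in auto)
  have admpi: "{..<h j} \<subseteq> \<pi> ` {..<dm j}" "\<pi> ` {..<dm j} \<subseteq> {..<h j + n + 1}" if j: "j \<in> {1..n}" for j
  proof -
    show "\<pi> ` {..<dm j} \<subseteq> {..<h j + n + 1}"
    proof
      fix x assume "x \<in> \<pi> ` {..<dm j}"
      then obtain c where c: "c < dm j" "x = \<pi> c" by blast
      have cN: "c < N" using c dm_le[OF j] by simp
      show "x \<in> {..<h j + n + 1}"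
      proof (rule ccontr)
        assume "x \<notin> {..<h j + n + 1}"
        then have "\<beta> (\<pi> c) c = 0"
          unfolding \<beta>[OF j c(1)] using high[OF j _ \<pi>lt[OF cN]] c by (auto simp: mprod_def)
        then show False using piv(1)[OF cN] by (simp add: \<beta>_def)
      qed
    qed
    show "{..<h j} \<subseteq> \<pi> ` {..<dm j}"
    proof
      fix x assume x: "x \<in> {..<h j}"
      then obtain z where z: "\<And>r. r < N \<Longrightarrow> (\<Sum>l<dm j. g r l * z l) = (if r = x then 1 else 0)"
        using low[OF j] by blast
      obtain W where W: "\<And>X r c. r < dm j \<Longrightarrow> mprod (dm j) u (mprod (dm j) W X) r c = X r c"
        using mprod_right_cancel[OF fdet_upper_mat[OF uu[OF dm_le[OF j]]]] by metis
      define y where "y = mprod (dm j) W (\<lambda>l _. z l)"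
      have y: "(\<Sum>l<dm j. \<beta> r l * y l 0) = (if r = x then 1 else 0)" if r: "r < N" for r
      proof -
        have "(\<Sum>l<dm j. \<beta> r l * y l 0) = mprod (dm j) (mprod (dm j) g u) y r 0"
          unfolding mprod_def[of _ "mprod _ _ _"] by (intro sum.cong) (use \<beta>[OF j] in auto)
        also have "\<dots> = mprod (dm j) g (mprod (dm j) u y) r 0" by (rule mprod_assoc)
        also have "\<dots> = mprod (dm j) g (\<lambda>l _. z l) r 0"
          by (rule mprod_cong) (use W in \<open>auto simp: y_def\<close>)
        finally show ?thesis using z[OF r] by (simp add: mprod_def)
      qed
      define L where "L = {l. l < dm j \<and> y l 0 \<noteq> 0}"
      have xN: "x < N" using x window_le[OF j] by simp
      have "L \<noteq> {}"
      proof
        assume "L = {}"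
        then have "(\<Sum>l<dm j. \<beta> x l * y l 0) = 0" by (intro sum.neutral) (auto simp: L_def)
        then show False using y[OF xN] by simp
      qed
      moreover have "finite L" by (simp add: L_def)
      \<comment> \<open>Pivots are distinct, so in the row of the largest one only a single column
        contributes.\<close>
      ultimately have "Max (\<pi> ` L) \<in> \<pi> ` L" by (intro Max_in) auto
      then obtain l where l: "l \<in> L" "\<pi> l = Max (\<pi> ` L)" by auto
      have lN: "l < N" "l < dm j" using l dm_le[OF j] by (auto simp: L_def)
      have "\<beta> (\<pi> l) k * y k 0 = (if k = l then \<beta> (\<pi> l) l * y l 0 else 0)" if k: "k < dm j" for k
      proof (cases "k \<in> L \<and> k \<noteq> l")
        case True
        have kN: "k < N" using k dm_le[OF j] by simp
        have "\<pi> k \<le> \<pi> l" using l(2) True \<open>finite L\<close> by simp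
        moreover have "\<pi> k \<noteq> \<pi> l" using bij_betw_imp_inj_on[OF bij] True kN lN by (auto dest: inj_onD)
        ultimately have "\<pi> k < \<pi> l" by simp
        then have "\<beta> (\<pi> l) k = 0" unfolding \<beta>_def by (intro piv(2) \<pi>lt kN lN)
        then show ?thesis using True by simp
      qed (use k in \<open>auto simp: L_def\<close>)
      then have "(\<Sum>k<dm j. \<beta> (\<pi> l) k * y k 0) = (\<Sum>k<dm j. if k = l then \<beta> (\<pi> l) l * y l 0 else 0)"
        by (intro sum.cong) auto
      then have "(if \<pi> l = x then 1 else 0) = \<beta> (\<pi> l) l * y l 0"
        using y[OF \<pi>lt[OF lN(1)]] lN by simp
      moreover have "\<beta> (\<pi> l) l * y l 0 \<noteq> 0" using piv(1)[OF lN(1)] l(1) by (auto simp: \<beta>_def L_def)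
      ultimately have "\<pi> l = x" by (auto split: if_splits)
      then show "x \<in> \<pi> ` {..<dm j}" using lN by blast
    qed
  qed
  \<comment> \<open>Ordering the columns by their pivots makes the matrix upper triangular.\<close>
  define b where "b r s = \<beta> r (inv_into {..<N} \<pi> s)" for r s
  have b\<pi>: "b r (\<pi> c) = \<beta> r c" if "c < N" for r c
    using inv_into_f_f[OF bij_betw_imp_inj_on[OF bij]] that by (simp add: b_def)
  have preim: "\<exists>c<N. s = \<pi> c" if "s < N" for s
  proof -
    have "s \<in> \<pi> ` {..<N}" using that unfolding bij_betw_imp_surj_on[OF bij] by simp
    then show ?thesis by blast
  qed
  have "upper_mat N b"
    unfolding upper_mat_def
  proof (intro conjI allI impI)
    fix s assume "s < N"
    then obtain c where c: "c < N" "s = \<pi> c" using preim by blast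
    then show "b s s \<noteq> 0" using b\<pi> piv(1) by (simp add: \<beta>_def)
  next
    fix r s assume rs: "r < N" "s < r"
    then have "s < N" by simp
    then obtain c where c: "c < N" "s = \<pi> c" using preim by blast
    then show "b r s = 0" using b\<pi> piv(2) rs by (simp add: \<beta>_def)
  qed
  moreover have "admissible \<pi>" using bij admpi by (simp add: admissible_def)
  moreover have "orbit_vec N n dm (\<lambda>r c. b r (\<pi> c)) = (\<lambda>I. (\<Prod>j=1..n. fdet (dm j) u) * orbit_vec N n dm g I)"
  proof (rule plv_mprod)
    fix j r c assume j: "j \<in> {1..n}" and c: "c < dm j"
    then have "c < N" using dm_le[OF j] by simp
    then show "b r (\<pi> c) = mprod (dm j) g u r c" using b\<pi> \<beta>[OF j c] by simp
  qed
  moreover have "(\<Prod>j=1..n. fdet (dm j) u) \<noteq> 0"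
    using fdet_upper_mat[OF uu[OF dm_le]] by simp
  ultimately show ?thesis using that by blast
qed

text \<open>A closed set is cut out by forms; those vanishing on the cell vanish at
  \<open>T y\<close> by \<open>form_vanishes\<close>, since its line is in the
  \<open>B\<close>-orbit of an admissible coordinate flag. The second claim is what later locates
  the line among the cosets.\<close>

lemma T_deg_vecs_in_closure:
  assumes y: "y \<in> deg_vecs"
  shows "line (T y) \<in> zariski_closure (multi_index N n dm) cell_lines"
    and "\<exists>g. fdet N g \<noteq> 0 \<and> line (T y) = line (orbit_vec N n dm g)"
proof -
  obtain a where Ty: "T y = plv N n dm (\<lambda>j. flag_mat j (a j))" and fam: "flag_family (\<lambda>j. flag_mat j (a j))"
    using T_deg_vecs_flag_family[OF y] by metis
  obtain g X where g: "fdet N g \<noteq> 0" and X: "\<And>j. j \<in> {1..n} \<Longrightarrow> fdet (dm j) (X j) \<noteq> 0"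
    "\<And>j r c. j \<in> {1..n} \<Longrightarrow> r < N \<Longrightarrow> c < dm j \<Longrightarrow> flag_mat j (a j) r c = mprod (dm j) g (X j) r c"
    using flag_completion[OF fam n_pos] by blast
  define s where "s = (\<Prod>j=1..n. fdet (dm j) (X j))"
  have s: "s \<noteq> 0" using X(1) by (simp add: s_def)
  have Tg: "T y = (\<lambda>I. s * orbit_vec N n dm g I)"
    unfolding Ty s_def by (rule plv_mprod) (rule X(2))
  then have lineTg: "line (T y) = line (orbit_vec N n dm g)" using line_scale[OF s] by metis
  with g show "\<exists>g. fdet N g \<noteq> 0 \<and> line (T y) = line (orbit_vec N n dm g)" by blast
  have low: "\<exists>z. \<forall>r<N. (\<Sum>l<dm j. g r l * z l) = (if r = x then 1 else 0)" if j: "j \<in> {1..n}" and x: "x < h j" for j x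
  proof (intro exI[of _ "\<lambda>l. X j l x"] allI impI)
    fix r assume r: "r < N"
    have "(\<Sum>l<dm j. g r l * X j l x) = flag_mat j (a j) r x"
      using X(2)[OF j r, of x] x by (simp add: mprod_def dm_def)
    then show "(\<Sum>l<dm j. g r l * X j l x) = (if r = x then 1 else 0)"
      using x by (auto simp: flag_mat_def)
  qed
  have high: "g r c = 0" if j: "j \<in> {1..n}" and r: "h j + n + 1 \<le> r" "r < N" and c: "c < dm j" for j r c
  proof -
    obtain W where W: "\<And>b r c. c < dm j \<Longrightarrow> mprod (dm j) (mprod (dm j) b (X j)) W r c = b r c"
      using mprod_right_cancel[OF X(1)[OF j]] by metis
    have "g r c = mprod (dm j) (mprod (dm j) g (X j)) W r c" using W c by simp
    also have "\<dots> = mprod (dm j) (flag_mat j (a j)) W r c"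
      by (rule mprod_cong) (use X(2)[OF j r(2)] in auto)
    also have "\<dots> = 0" using r by (simp add: mprod_def flag_mat_def)
    finally show ?thesis .
  qed
  have "\<exists>b \<pi> q. admissible \<pi> \<and> upper_mat N b \<and> q \<noteq> 0 \<and>
    orbit_vec N n dm (\<lambda>r c. b r (\<pi> c)) = (\<lambda>I. q * orbit_vec N n dm g I)"
    by (rule invertible_flag_to_fixed_point[OF g low high]) (assumption+, blast)
  then obtain b \<pi> q where b: "admissible \<pi>" "upper_mat N b" "q \<noteq> 0"
    "orbit_vec N n dm (\<lambda>r c. b r (\<pi> c)) = (\<lambda>I. q * orbit_vec N n dm g I)"
    by blast
  let ?o = "orbit_vec N n dm (\<lambda>r c. b r (\<pi> c))"
  have lineo: "line (T y) = line ?o" unfolding lineTg b(4) by (rule line_scale[symmetric, OF b(3)])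
  have "T y \<noteq> (\<lambda>_. 0)"
    unfolding Tg using orbit_vec_nonzero[OF g dm_le_all] s by (auto simp: fun_eq_iff)
  then have proj: "line (T y) \<in> proj_space (multi_index N n dm)"
    unfolding proj_space_def Ty using plv_outside by blast
  show "line (T y) \<in> zariski_closure (multi_index N n dm) cell_lines"
    unfolding zariski_closure_def
  proof (rule InterI, clarify)
    fix C assume C: "zariski_closed (multi_index N n dm) C" "cell_lines \<subseteq> C"
    obtain F where F: "\<forall>f\<in>F. \<exists>d. hform (multi_index N n dm) d f"
      "C = {p \<in> proj_space (multi_index N n dm). \<forall>f\<in>F. \<forall>x\<in>p. f x = 0}"
      using C(1) unfolding zariski_closed_def by blast
    have "f x = 0" if f: "f \<in> F" and x: "x \<in> line (T y)" for f x
    proof -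
      obtain e where e: "hform (multi_index N n dm) e f" using F f by blast
      have "f ?o = 0"
      proof (rule form_vanishes[OF e _ b(1,2)])
        fix b assume "upper_mat N b"
        then have "line (orbit_vec N n dm (\<lambda>r c. b r (w c))) \<in> C" using upper_mat_in_cell C(2) by blast
        then show "f (orbit_vec N n dm (\<lambda>r c. b r (w c))) = 0"
          unfolding F(2) using f mem_line_self by blast
      qed
      moreover obtain c where "x = (\<lambda>I. c * ?o I)" using x unfolding lineo mem_line_iff by blast
      ultimately show ?thesis using hform_homogeneous[OF e] by simp
    qed
    then show "line (T y) \<in> C" unfolding F(2) using proj by blast
  qed
qed

theorem closure_cell_lines: "zariski_closure (multi_index N n dm) cell_lines = line ` T ` deg_vecs"
proof
  show "line ` T ` deg_vecs \<subseteq> zariski_closure (multi_index N n dm) cell_lines"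
    using T_deg_vecs_in_closure(1) by blast
  have "cell_lines \<subseteq> line ` T ` deg_vecs" using cell_in_T_deg_vecs by blast
  then show "zariski_closure (multi_index N n dm) cell_lines \<subseteq> line ` T ` deg_vecs"
    unfolding zariski_closure_def using zariski_closed_T by blast
qed

text \<open>The points of the Schubert variety are cosets; every line of the closure comes from an
  invertible matrix, hence from a coset by \<open>orbit_emb_lcosets\<close>.\<close>

lemma schubert_variety_image:
  "pv_emb (schubert_variety N n dm w) ` pv_points (schubert_variety N n dm w) = line ` T ` deg_vecs"
proof -
  let ?L = "lcosets\<^bsub>SL N\<^esub> (parabolic N n dm)"
  have sub: "line ` T ` deg_vecs \<subseteq> orbit_emb N n dm ` ?L"
  proof
    fix l assume "l \<in> line ` T ` deg_vecs"
    then obtain y where y: "y \<in> deg_vecs" "l = line (T y)" by blast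
    then obtain g where "fdet N g \<noteq> 0" "l = line (orbit_vec N n dm g)"
      using T_deg_vecs_in_closure(2)[OF y(1)] by blast
    then show "l \<in> orbit_emb N n dm ` ?L" using orbit_emb_lcosets[OF dm_le_all] by blast
  qed
  have "pv_emb (schubert_variety N n dm w) ` pv_points (schubert_variety N n dm w)
    = orbit_emb N n dm ` {C \<in> ?L. orbit_emb N n dm C \<in> line ` T ` deg_vecs}"
    unfolding schubert_variety_def
    by (simp only: pvar.select_convs orbit_emb_cell[OF dm_le_all] closure_cell_lines)
  also have "\<dots> = orbit_emb N n dm ` ?L \<inter> line ` T ` deg_vecs" by blast
  also have "\<dots> = line ` T ` deg_vecs" using sub by (simp only: Int_absorb1)
  finally show ?thesis .
qed

lemma schubert_variety_projective: "projective_variety (schubert_variety N n dm w)"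
proof -
  let ?X = "schubert_variety N n dm w"
  have sel: "pv_index ?X = multi_index N n dm" "pv_emb ?X = orbit_emb N n dm"
    "pv_points ?X \<subseteq> lcosets\<^bsub>SL N\<^esub> (parabolic N n dm)"
    by (auto simp: schubert_variety_def)
  have "inj_on (pv_emb ?X) (pv_points ?X)"
    unfolding sel(2) by (rule inj_on_subset[OF orbit_emb_inj[OF dm_le_all] sel(3)])
  then show ?thesis
    unfolding projective_variety_def schubert_variety_image sel(1)
    using finite_multi_index zariski_closed_T by blast
qed

end

section \<open>Degenerate flags in coordinates and linear isomorphisms\<close>

locale based_space = vector_space scale for scale :: "complex \<Rightarrow> 'v::ab_group_add \<Rightarrow> 'v" +
  fixes m :: nat and v :: "nat \<Rightarrow> 'v"
  assumes basis: "is_basis scale m v"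
begin

text \<open>Coordinates count from 0 and basis vectors from 1, hence the shift.\<close>

definition vec :: "(nat \<Rightarrow> complex) \<Rightarrow> 'v"
  where "vec z = (\<Sum>r<m. scale (z r) (v (Suc r)))"

definition colspace :: "nat \<Rightarrow> (nat \<Rightarrow> nat \<Rightarrow> complex) \<Rightarrow> 'v set"
  where "colspace d a = range (\<lambda>z. vec (\<lambda>r. \<Sum>k<d. a r k * z k))"

definition coords :: "'v \<Rightarrow> nat \<Rightarrow> complex"
  where "coords x r = coordinate scale m v (Suc r) x"

lemma v_inj: "inj_on v {1..m}" and v_indep: "independent (v ` {1..m})" and v_span: "span (v ` {1..m}) = UNIV"
  using basis by (auto simp: is_basis_def)

lemma sum_basis: "(\<Sum>b\<in>v ` {1..m}. f b) = (\<Sum>r<m. f (v (Suc r)))" for f :: "'v \<Rightarrow> 'v"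
proof -
  have "(\<Sum>b\<in>v ` {1..m}. f b) = (\<Sum>s\<in>{1..m}. f (v s))"
    unfolding sum.reindex[OF v_inj] comp_def ..
  also have "\<dots> = (\<Sum>s\<in>Suc ` {..<m}. f (v s))" by (simp add: image_Suc_lessThan)
  finally show ?thesis by (simp add: sum.reindex)
qed

lemma vec_coords: "vec (coords x) = x"
proof -
  have "(\<Sum>b\<in>v ` {1..m}. scale (representation (v ` {1..m}) x b) b) = x"
    by (rule sum_representation_eq[OF v_indep]) (simp_all only: v_span UNIV_I finite_imageI finite_atLeastAtMost subset_refl)
  then show ?thesis unfolding sum_basis by (simp add: vec_def coords_def coordinate_def)
qed

lemma vec_zero:
  assumes "vec z = 0" "r < m"
  shows "z r = 0"
proof -
  define u where "u b = z (inv_into {1..m} v b - 1)" for b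
  have u: "u (v (Suc s)) = z s" if "s < m" for s
    using inv_into_f_f[OF v_inj, of "Suc s"] that by (simp add: u_def)
  have sum: "(\<Sum>b\<in>v ` {1..m}. scale (u b) b) = vec z"
    unfolding sum_basis vec_def by (intro sum.cong) (auto simp: u)
  have "u (v (Suc r)) = 0"
  proof (rule independentD[OF v_indep _ subset_refl])
    show "(\<Sum>b\<in>v ` {1..m}. scale (u b) b) = 0" unfolding sum by (rule assms(1))
    show "v (Suc r) \<in> v ` {1..m}" using assms(2) by (intro imageI) auto
  qed simp
  then show ?thesis using u assms by simp
qed

lemma vec_diff: "vec (\<lambda>r. x r - y r) = vec x - vec y"
  by (simp add: vec_def scale_left_diff_distrib sum_subtractf)

lemma vec_eq_iff: "vec x = vec y \<longleftrightarrow> (\<forall>r<m. x r = y r)"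
proof
  assume "vec x = vec y"
  then show "\<forall>r<m. x r = y r" using vec_zero[of "\<lambda>r. x r - y r"] vec_diff[of x y] by auto
qed (auto simp: vec_def)

lemma coords_vec: "r < m \<Longrightarrow> coords (vec z) r = z r"
  using vec_coords[of "vec z"] unfolding vec_eq_iff by blast

lemma vec_combination: "vec (\<lambda>r. \<Sum>k<d. a r k * z k) = (\<Sum>k<d. scale (z k) (vec (\<lambda>r. a r k)))"
proof -
  have "vec (\<lambda>r. \<Sum>k<d. a r k * z k) = (\<Sum>r<m. \<Sum>k<d. scale (z k) (scale (a r k) (v (Suc r))))"
    by (simp add: vec_def scale_sum_left mult.commute)
  also have "\<dots> = (\<Sum>k<d. \<Sum>r<m. scale (z k) (scale (a r k) (v (Suc r))))" by (rule sum.swap)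
  finally show ?thesis by (simp only: vec_def scale_sum_right)
qed

lemma colspace_cong:
  assumes "\<And>r c. r < m \<Longrightarrow> c < d \<Longrightarrow> a r c = b r c"
  shows "colspace d a = colspace d b"
proof -
  have "vec (\<lambda>r. \<Sum>k<d. a r k * z k) = vec (\<lambda>r. \<Sum>k<d. b r k * z k)" for z
    unfolding vec_eq_iff using assms by (auto intro!: sum.cong)
  then show ?thesis by (simp add: colspace_def)
qed

text \<open>The columns of \<open>a\<close> are its values at unit vectors; their coefficients with
  respect to \<open>b\<close>, taken column by column, form \<open>X\<close>.\<close>

lemma colspace_subset_iff:
  "colspace d a \<subseteq> colspace e b \<longleftrightarrow> (\<exists>X. \<forall>r<m. \<forall>c<d. a r c = mprod e b X r c)"
proof
  assume sub: "colspace d a \<subseteq> colspace e b"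
  have "\<exists>x. \<forall>r<m. a r c = (\<Sum>k<e. b r k * x k)" if c: "c < d" for c
  proof -
    have "(\<Sum>k<d. a r k * (if k = c then 1 else 0)) = a r c" for r
    proof -
      have "(\<Sum>k<d. a r k * (if k = c then 1 else 0)) = (\<Sum>k<d. if k = c then a r k else 0)"
        by (intro sum.cong) auto
      then show ?thesis using c by simp
    qed
    then have "vec (\<lambda>r. a r c) = vec (\<lambda>r. \<Sum>k<d. a r k * (if k = c then 1 else 0))" by simp
    then have "vec (\<lambda>r. a r c) \<in> colspace e b" using sub unfolding colspace_def by auto
    then show ?thesis unfolding colspace_def by (auto simp: vec_eq_iff)
  qed
  then have "\<forall>c\<in>{..<d}. \<exists>x. \<forall>r<m. a r c = (\<Sum>k<e. b r k * x k)" by blast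
  then obtain x where "\<forall>c\<in>{..<d}. \<forall>r<m. a r c = (\<Sum>k<e. b r k * x c k)" by (rule bchoice[THEN exE])
  then show "\<exists>X. \<forall>r<m. \<forall>c<d. a r c = mprod e b X r c"
    by (intro exI[of _ "\<lambda>k c. x c k"]) (auto simp: mprod_def)
next
  assume "\<exists>X. \<forall>r<m. \<forall>c<d. a r c = mprod e b X r c"
  then obtain X where X: "\<And>r c. r < m \<Longrightarrow> c < d \<Longrightarrow> a r c = mprod e b X r c" by blast
  have "vec (\<lambda>r. \<Sum>k<d. a r k * z k) = vec (\<lambda>r. \<Sum>k<e. b r k * mprod d X (\<lambda>k _. z k) k 0)" for z
    unfolding vec_eq_iff
  proof (intro allI impI)
    fix r assume r: "r < m"
    have "(\<Sum>k<d. a r k * z k) = mprod d (mprod e b X) (\<lambda>k _. z k) r 0"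
      unfolding mprod_def[of d] using X[OF r] by (intro sum.cong) auto
    also have "\<dots> = mprod e b (mprod d X (\<lambda>k _. z k)) r 0" by (rule mprod_assoc)
    finally show "(\<Sum>k<d. a r k * z k) = (\<Sum>k<e. b r k * mprod d X (\<lambda>k _. z k) k 0)"
      by (simp only: mprod_def[of e])
  qed
  then show "colspace d a \<subseteq> colspace e b" unfolding colspace_def by auto
qed

abbreviation list_mat :: "'v list \<Rightarrow> nat \<Rightarrow> nat \<Rightarrow> complex"
  where "list_mat us \<equiv> \<lambda>r c. coords (us ! c) r"

lemma sum_nth_set:
  fixes f :: "'v \<Rightarrow> 'v"
  assumes "distinct us"
  shows "(\<Sum>x\<in>set us. f x) = (\<Sum>k<length us. f (us ! k))"
  using sum.reindex_bij_betw[OF bij_betw_nth[OF assms refl refl], of f] by simp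

lemma list_mat_basis:
  assumes us: "is_basis_of scale us U"
  shows "full_rank m (length us) (list_mat us)" "U = colspace (length us) (list_mat us)" "dim U = length us"
proof -
  have d: "distinct us" and indep: "independent (set us)" and span: "span (set us) = U"
    using us by (auto simp: is_basis_of_def)
  have comb: "vec (\<lambda>r. \<Sum>k<length us. list_mat us r k * z k) = (\<Sum>k<length us. scale (z k) (us ! k))" for z
    unfolding vec_combination vec_coords ..
  show "full_rank m (length us) (list_mat us)"
  proof (rule full_rankI)
    fix z k assume z: "\<And>r. r < m \<Longrightarrow> (\<Sum>k<length us. list_mat us r k * z k) = 0" and k: "k < length us"
    define u where "u x = z (inv_into {..<length us} (nth us) x)" for x
    have u: "u (us ! k) = z k" if "k < length us" for k
      using inv_into_f_f[OF inj_on_nth[OF d, of "{..<length us}"], of k] that by (simp add: u_def)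
    have "(\<Sum>x\<in>set us. scale (u x) x) = (\<Sum>k<length us. scale (z k) (us ! k))"
      unfolding sum_nth_set[OF d] by (intro sum.cong) (auto simp: u)
    also have "\<dots> = vec (\<lambda>r. \<Sum>k<length us. list_mat us r k * z k)" by (rule comb[symmetric])
    also have "\<dots> = vec (\<lambda>r. 0)" unfolding vec_eq_iff using z by simp
    also have "\<dots> = 0" by (simp add: vec_def)
    finally have "u (us ! k) = 0" using k by (intro independentD[OF indep, of "set us"]) auto
    then show "z k = 0" using u k by simp
  qed
  show "U = colspace (length us) (list_mat us)"
  proof
    show "U \<subseteq> colspace (length us) (list_mat us)"
    proof
      fix x assume "x \<in> U"
      then obtain u where "x = (\<Sum>y\<in>set us. scale (u y) y)" unfolding span[symmetric] span_finite[OF finite_set] by blast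
      then have "x = vec (\<lambda>r. \<Sum>k<length us. list_mat us r k * u (us ! k))"
        unfolding sum_nth_set[OF d] comb .
      then show "x \<in> colspace (length us) (list_mat us)" unfolding colspace_def by (rule range_eqI[where x = "\<lambda>k. u (us ! k)"])
    qed
    show "colspace (length us) (list_mat us) \<subseteq> U"
    proof -
      have "(\<Sum>k<length us. scale (z k) (us ! k)) \<in> span (set us)" for z
        by (intro span_sum span_scale span_base) simp
      then show ?thesis unfolding colspace_def comb span by blast
    qed
  qed
  show "dim U = length us"
    using dim_span_eq_card_independent[OF indep] span d by (simp add: distinct_card)
qed

lemma colspace_basis:
  assumes a: "full_rank m d a"
  obtains us where "is_basis_of scale us (colspace d a)" "length us = d"
    "\<And>r c. r < m \<Longrightarrow> c < d \<Longrightarrow> list_mat us r c = a r c"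
proof -
  define us where "us = map (\<lambda>c. vec (\<lambda>r. a r c)) [0..<d]"
  have nth: "us ! c = vec (\<lambda>r. a r c)" if "c < d" for c using that by (simp add: us_def)
  have len: "length us = d" by (simp add: us_def)
  have ker: "z k = 0" if "(\<Sum>k<d. scale (z k) (us ! k)) = 0" "k < d" for z k
  proof -
    have "vec (\<lambda>r. \<Sum>k<d. a r k * z k) = (\<Sum>k<d. scale (z k) (us ! k))"
      unfolding vec_combination by (intro sum.cong) (auto simp: nth)
    then have "\<And>r. r < m \<Longrightarrow> (\<Sum>k<d. a r k * z k) = 0" using that(1) vec_zero by simp
    then show ?thesis using full_rank_kernel[OF a _ that(2)] by blast
  qed
  have dist: "distinct us"
    unfolding distinct_conv_nth
  proof (intro allI impI)
    fix p q assume pq: "p < length us" "q < length us" "p \<noteq> q"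
    show "us ! p \<noteq> us ! q"
    proof
      assume eq: "us ! p = us ! q"
      \<comment> \<open>Two equal members of the list give a vanishing combination with coefficients
        1 and -1.\<close>
      define z where "z k = (if k = p then 1 else 0) + (if k = q then -1 else (0::complex))" for k
      have "(\<Sum>k<d. scale (z k) (us ! k)) = (\<Sum>k<d. (if k = p then us ! k else 0) + (if k = q then - (us ! k) else 0))"
        by (intro sum.cong) (auto simp: z_def pq)
      also have "\<dots> = 0" using pq eq by (simp add: sum.distrib len)
      finally have "z p = 0" using pq by (intro ker) (auto simp: len)
      then show False using pq by (simp add: z_def)
    qed
  qed
  have indep: "independent (set us)"
  proof (rule independent_if_scalars_zero)
    fix f x assume f: "(\<Sum>x\<in>set us. scale (f x) x) = 0" and x: "x \<in> set us"
    obtain k where k: "k < d" "x = us ! k" using x len by (auto simp: in_set_conv_nth)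
    show "f x = 0" unfolding k(2)
      by (rule ker[of "\<lambda>k. f (us ! k)"]) (use f k len in \<open>simp_all add: sum_nth_set[OF dist]\<close>)
  qed simp
  have lm: "list_mat us r c = a r c" if "r < m" "c < d" for r c
    using that by (simp add: nth coords_vec)
  have b: "is_basis_of scale us (span (set us))" using dist indep by (simp add: is_basis_of_def)
  have "span (set us) = colspace d (list_mat us)"
    using list_mat_basis(2)[OF b] by (simp only: len)
  also have "\<dots> = colspace d a" by (rule colspace_cong) (rule lm)
  finally show ?thesis using b that[of us] len lm by simp
qed

lemma subspace_basis:
  assumes "U \<in> Gr scale d"
  obtains us where "is_basis_of scale us U" "length us = d"
proof -
  interpret finite_dimensional_vector_space scale "v ` {1..m}"
    by unfold_locales (use v_indep v_span in auto)
  have U: "subspace U" "dim U = d" using assms by (auto simp: Gr_def)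
  obtain B where B: "finite B" "independent B" "span B = U" "card B = dim U"
    using basis_subspace_exists[OF U(1)] by metis
  obtain us where us: "set us = B" "distinct us" using finite_distinct_list[OF B(1)] by blast
  show ?thesis
    by (rule that[of us]) (use B U us distinct_card[OF us(2)] in \<open>auto simp: is_basis_of_def\<close>)
qed

lemma colspace_Gr:
  assumes "full_rank m d a"
  shows "colspace d a \<in> Gr scale d"
proof -
  obtain us where us: "is_basis_of scale us (colspace d a)" "length us = d"
    by (rule colspace_basis[OF assms])
  have "subspace (colspace d a)" using us(1) subspace_span[of "set us"] by (simp add: is_basis_of_def)
  then show ?thesis using list_mat_basis(3)[OF us(1)] us(2) by (simp add: Gr_def)
qed

text \<open>The definition is a union over all choices of bases. Each choice gives the same line, as
  its matrices differ from \<open>a\<close> by invertible factors, and a choice exists.\<close>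

lemma plucker_segre_plv:
  assumes U: "\<And>j. j \<in> {1..n} \<Longrightarrow> U j = colspace j (a j)" and a: "\<And>j. j \<in> {1..n} \<Longrightarrow> full_rank m j (a j)"
  shows "plucker_segre scale m n v U = line (plv m n (\<lambda>j. j) a)"
proof -
  have one: "line (\<lambda>I. if I \<in> multi_index m n (\<lambda>j. j)
       then \<Prod>j=1..n. det (submatrix (coord_mat scale m v (us j)) (I j) UNIV) else 0) = line (plv m n (\<lambda>j. j) a)"
    if us: "\<forall>j\<in>{1..n}. is_basis_of scale (us j) (U j)" for us
  proof -
    have len: "length (us j) = j" if j: "j \<in> {1..n}" for j
      using list_mat_basis(3)[OF bspec[OF us j]] colspace_Gr[OF a[OF j]] U[OF j] by (simp add: Gr_def)
    have "(\<lambda>I. if I \<in> multi_index m n (\<lambda>j. j)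
        then \<Prod>j=1..n. det (submatrix (coord_mat scale m v (us j)) (I j) UNIV) else 0)
      = plv m n (\<lambda>j. j) (\<lambda>j. list_mat (us j))"
    proof
      fix I
      have "det (submatrix (coord_mat scale m v (us j)) (I j) UNIV) = minor j (list_mat (us j)) (pick (I j))"
        if I: "I \<in> multi_index m n (\<lambda>j. j)" and j: "j \<in> {1..n}" for j
      proof -
        have "{r. r < m \<and> r \<in> I j} = I j" using multi_index_memD(1)[OF I j] by auto
        then have "submatrix (coord_mat scale m v (us j)) (I j) UNIV
          = mat j j (\<lambda>(r, c). list_mat (us j) (pick (I j) r) c)"
          using multi_index_memD(3)[OF I j] len[OF j] pick_less[OF I j]
          by (intro eq_matI) (auto simp: submatrix_def coord_mat_def pick_UNIV coords_def)
        then show ?thesis by (simp add: minor_def)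
      qed
      then show "(if I \<in> multi_index m n (\<lambda>j. j)
          then \<Prod>j=1..n. det (submatrix (coord_mat scale m v (us j)) (I j) UNIV) else 0)
        = plv m n (\<lambda>j. j) (\<lambda>j. list_mat (us j)) I"
        unfolding plv_def by (auto intro!: prod.cong)
    qed
    moreover have "line (plv m n (\<lambda>j. j) (\<lambda>j. list_mat (us j))) = line (plv m n (\<lambda>j. j) a)"
    proof -
      have "\<exists>X. \<forall>r<m. \<forall>c<j. list_mat (us j) r c = mprod j (a j) X r c" if j: "j \<in> {1..n}" for j
      proof -
        have "colspace j (list_mat (us j)) = colspace j (a j)"
          using list_mat_basis(2)[OF bspec[OF us j]] U[OF j] unfolding len[OF j] by simp
        then show ?thesis using colspace_subset_iff[of j "list_mat (us j)" j "a j"] by blast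
      qed
      then have "\<forall>j\<in>{1..n}. \<exists>X. \<forall>r<m. \<forall>c<j. list_mat (us j) r c = mprod j (a j) X r c" by blast
      then obtain X where "\<forall>j\<in>{1..n}. \<forall>r<m. \<forall>c<j. list_mat (us j) r c = mprod j (a j) (X j) r c"
        by (rule bchoice[THEN exE])
      then have X: "\<And>j r c. j \<in> {1..n} \<Longrightarrow> r < m \<Longrightarrow> c < j \<Longrightarrow> list_mat (us j) r c = mprod j (a j) (X j) r c"
        by blast
      have eq: "plv m n (\<lambda>j. j) (\<lambda>j. list_mat (us j)) = (\<lambda>I. (\<Prod>j=1..n. fdet j (X j)) * plv m n (\<lambda>j. j) a I)"
        by (rule plv_mprod) (rule X)
      have "full_rank m j (list_mat (us j))" if j: "j \<in> {1..n}" for j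
        using list_mat_basis(1)[OF bspec[OF us j]] unfolding len[OF j] .
      then have "plv m n (\<lambda>j. j) (\<lambda>j. list_mat (us j)) \<noteq> (\<lambda>_. 0)" by (simp add: plv_nonzero_iff)
      then have "(\<Prod>j=1..n. fdet j (X j)) \<noteq> 0" unfolding eq by (auto simp: fun_eq_iff)
      then show ?thesis unfolding eq by (rule line_scale)
    qed
    ultimately show ?thesis by simp
  qed
  have "\<forall>j\<in>{1..n}. \<exists>us. is_basis_of scale us (U j)"
  proof
    fix j assume j: "j \<in> {1..n}"
    show "\<exists>us. is_basis_of scale us (U j)" unfolding U[OF j] by (rule colspace_basis[OF a[OF j]]) blast
  qed
  then have "\<exists>us. \<forall>j\<in>{1..n}. is_basis_of scale (us j) (U j)" by (rule bchoice)
  then show ?thesis unfolding plucker_segre_def using one by blast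
qed

lemma colspace_eq_of_line_eq:
  assumes eq: "line (plv m n d a) = line (plv m n d b)" and a: "\<forall>j\<in>{1..n}. full_rank m (d j) (a j)"
    and j: "j \<in> {1..n}"
  shows "colspace (d j) (b j) \<subseteq> colspace (d j) (a j)"
proof -
  obtain X where "\<And>r c. r < m \<Longrightarrow> c < d j \<Longrightarrow> b j r c = mprod (d j) (a j) X r c"
    using plv_line_span[OF eq a j] by metis
  then show ?thesis unfolding colspace_subset_iff by blast
qed

end

lemma (in based_space) proj_seq_vec:
  assumes m: "m = n + 1"
  shows "proj_seq scale n v i j (vec z) = vec (\<lambda>r. if j \<in> set i \<and> r = j then 0 else z r)"
proof (cases "j \<in> set i")
  case True
  let ?f = "\<lambda>s. if s = j + 1 then 0 else scale (coordinate scale m v s (vec z)) (v s)"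
  have "proj_seq scale n v i j (vec z) = (\<Sum>s\<in>{1..m} - {j + 1}. ?f s)"
    using True unfolding m by (auto simp: proj_seq_def proj_along_def intro!: sum.cong)
  also have "\<dots> = (\<Sum>s\<in>{1..m}. ?f s)"
    by (rule sum.mono_neutral_left) auto
  also have "\<dots> = (\<Sum>s\<in>Suc ` {..<m}. ?f s)" by (simp add: image_Suc_lessThan)
  also have "\<dots> = (\<Sum>r<m. ?f (Suc r))" by (simp add: sum.reindex)
  also have "\<dots> = vec (\<lambda>r. if j \<in> set i \<and> r = j then 0 else z r)"
  proof -
    have "?f (Suc r) = scale (if j \<in> set i \<and> r = j then 0 else z r) (v (Suc r))" if "r < m" for r
      using True coords_vec[OF that, of z] by (simp add: coords_def)
    then show ?thesis unfolding vec_def[of "\<lambda>r. if j \<in> set i \<and> r = j then 0 else z r"] by (intro sum.cong) auto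
  qed
  finally show ?thesis .
qed (simp add: proj_seq_def)

text \<open>\<open>A j\<close> is any matrix acting on columns as \<open>f\<^sub>j\<close> does; it
  will be \<open>kill_mat j\<close>.\<close>

locale deg_flag_space = based_space scale "n + 1" v for scale :: "complex \<Rightarrow> 'v::ab_group_add \<Rightarrow> 'v" and n v +
  fixes i :: "nat list" and A :: "nat \<Rightarrow> nat \<Rightarrow> nat \<Rightarrow> complex"
  assumes A: "\<And>j a r c. r < n + 1 \<Longrightarrow> mprod (n + 1) (A j) a r c = (if j \<in> set i \<and> r = j then 0 else a r c)"
begin

lemma proj_colspace: "proj_seq scale n v i j ` colspace d a = colspace d (mprod (n + 1) (A j) a)"
proof -
  have "proj_seq scale n v i j (vec (\<lambda>r. \<Sum>k<d. a r k * z k)) = vec (\<lambda>r. \<Sum>k<d. mprod (n + 1) (A j) a r k * z k)" for z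
    unfolding proj_seq_vec[OF refl] vec_eq_iff
  proof (intro allI impI)
    fix r assume r: "r < n + 1"
    have eq: "mprod (n + 1) (A j) a r k = (if j \<in> set i \<and> r = j then 0 else a r k)" for k by (rule A[OF r])
    show "(if j \<in> set i \<and> r = j then 0 else \<Sum>k<d. a r k * z k) = (\<Sum>k<d. mprod (n + 1) (A j) a r k * z k)"
      unfolding eq by auto
  qed
  then show ?thesis unfolding colspace_def image_image by (simp only:)
qed

lemma proj_colspace_subset_iff:
  "proj_seq scale n v i j ` colspace d a \<subseteq> colspace e b \<longleftrightarrow>
    (\<exists>X. \<forall>r<n + 1. \<forall>c<d. mprod (n + 1) (A j) a r c = mprod e b X r c)"
  unfolding proj_colspace colspace_subset_iff ..

lemma deg_flags_matrix:
  assumes "U \<in> deg_flags scale n v i"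
  shows "\<exists>a. (\<forall>j\<in>{1..n}. full_rank (n + 1) j (a j) \<and> U j = colspace j (a j)) \<and> incident (n + 1) n (\<lambda>j. j) A a"
proof -
  have U: "U \<in> (\<Pi>\<^sub>E j\<in>{1..n}. Gr scale j)" and inc: "\<And>j. j \<in> {1..n-1} \<Longrightarrow> proj_seq scale n v i j ` U j \<subseteq> U (j + 1)"
    using assms by (auto simp: deg_flags_def)
  have "\<forall>j\<in>{1..n}. \<exists>a. full_rank (n + 1) j a \<and> U j = colspace j a"
  proof
    fix j assume j: "j \<in> {1..n}"
    have "U j \<in> Gr scale j" using U j by (auto simp: PiE_def Pi_def)
    then obtain us where us: "is_basis_of scale us (U j)" "length us = j" by (rule subspace_basis)
    show "\<exists>a. full_rank (n + 1) j a \<and> U j = colspace j a"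
      using list_mat_basis(1,2)[OF us(1)] unfolding us(2) by blast
  qed
  then obtain a where a: "\<And>j. j \<in> {1..n} \<Longrightarrow> full_rank (n + 1) j (a j)" "\<And>j. j \<in> {1..n} \<Longrightarrow> U j = colspace j (a j)"
    by (metis (no_types) bchoice)
  have inc_a: "incident (n + 1) n (\<lambda>j. j) A a"
    unfolding incident_def
  proof
    fix j assume j: "j \<in> {1..<n}"
    then have "j \<in> {1..n-1}" by auto
    then have "proj_seq scale n v i j ` U j \<subseteq> U (Suc j)" using inc[of j] by simp
    then have "proj_seq scale n v i j ` colspace j (a j) \<subseteq> colspace (Suc j) (a (Suc j))"
      using a(2)[of j] a(2)[of "Suc j"] j by simp
    then show "\<exists>X. \<forall>r<n + 1. \<forall>c<j. mprod (n + 1) (A j) (a j) r c = mprod (Suc j) (a (Suc j)) X r c"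
      unfolding proj_colspace_subset_iff .
  qed
  show ?thesis using a inc_a by blast
qed

lemma deg_flags_image:
  "plucker_segre scale (n + 1) n v ` deg_flags scale n v i = line ` flag_vecs (n + 1) n (\<lambda>j. j) A"
proof (intro equalityI subsetI)
  fix l assume "l \<in> plucker_segre scale (n + 1) n v ` deg_flags scale n v i"
  then obtain U where U: "U \<in> deg_flags scale n v i" "l = plucker_segre scale (n + 1) n v U" by blast
  obtain a where a: "\<And>j. j \<in> {1..n} \<Longrightarrow> full_rank (n + 1) j (a j)" "\<And>j. j \<in> {1..n} \<Longrightarrow> U j = colspace j (a j)"
    "incident (n + 1) n (\<lambda>j. j) A a" using deg_flags_matrix[OF U(1)] by blast
  have "l = line (plv (n + 1) n (\<lambda>j. j) a)" unfolding U(2) by (rule plucker_segre_plv[OF a(2,1)])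
  moreover have "plv (n + 1) n (\<lambda>j. j) a \<in> flag_vecs (n + 1) n (\<lambda>j. j) A"
    using a unfolding flag_vecs_def by blast
  ultimately show "l \<in> line ` flag_vecs (n + 1) n (\<lambda>j. j) A" by blast
next
  fix l assume "l \<in> line ` flag_vecs (n + 1) n (\<lambda>j. j) A"
  then obtain a where a: "l = line (plv (n + 1) n (\<lambda>j. j) a)" "\<And>j. j \<in> {1..n} \<Longrightarrow> full_rank (n + 1) j (a j)"
    "incident (n + 1) n (\<lambda>j. j) A a"
    unfolding flag_vecs_def by auto
  define U where "U = (\<lambda>j\<in>{1..n}. colspace j (a j))"
  have U: "U j = colspace j (a j)" if "j \<in> {1..n}" for j using that by (simp add: U_def)
  have "U \<in> (\<Pi>\<^sub>E j\<in>{1..n}. Gr scale j)"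
    using colspace_Gr[OF a(2)] by (auto simp: U_def)
  moreover have "proj_seq scale n v i j ` U j \<subseteq> U (j + 1)" if j: "j \<in> {1..n-1}" for j
  proof -
    have "1 \<le> j" "j < n" using j unfolding atLeastAtMost_iff by linarith+
    then have "j \<in> {1..n}" "j + 1 \<in> {1..n}" "j \<in> {1..<n}" by auto
    moreover have "proj_seq scale n v i j ` colspace j (a j) \<subseteq> colspace (Suc j) (a (Suc j))"
      unfolding proj_colspace_subset_iff using a(3) \<open>j \<in> {1..<n}\<close> unfolding incident_def by blast
    ultimately show ?thesis using U by simp
  qed
  ultimately have "U \<in> deg_flags scale n v i" by (simp add: deg_flags_def)
  moreover have "plucker_segre scale (n + 1) n v U = l"
    unfolding a(1) by (rule plucker_segre_plv[OF U a(2)])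
  ultimately show "l \<in> plucker_segre scale (n + 1) n v ` deg_flags scale n v i" by blast
qed

lemma plucker_segre_inj: "inj_on (plucker_segre scale (n + 1) n v) (deg_flags scale n v i)"
proof (rule inj_onI)
  fix U U' assume U: "U \<in> deg_flags scale n v i" and U': "U' \<in> deg_flags scale n v i"
    and eq: "plucker_segre scale (n + 1) n v U = plucker_segre scale (n + 1) n v U'"
  obtain a where a: "\<And>j. j \<in> {1..n} \<Longrightarrow> full_rank (n + 1) j (a j)" "\<And>j. j \<in> {1..n} \<Longrightarrow> U j = colspace j (a j)"
    "incident (n + 1) n (\<lambda>j. j) A a"
    using deg_flags_matrix[OF U] by blast
  obtain b where b: "\<And>j. j \<in> {1..n} \<Longrightarrow> full_rank (n + 1) j (b j)" "\<And>j. j \<in> {1..n} \<Longrightarrow> U' j = colspace j (b j)"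
    "incident (n + 1) n (\<lambda>j. j) A b"
    using deg_flags_matrix[OF U'] by blast
  have "plucker_segre scale (n + 1) n v U = line (plv (n + 1) n (\<lambda>j. j) a)"
    by (rule plucker_segre_plv[OF a(2,1)])
  moreover have "plucker_segre scale (n + 1) n v U' = line (plv (n + 1) n (\<lambda>j. j) b)"
    by (rule plucker_segre_plv[OF b(2,1)])
  ultimately have leq: "line (plv (n + 1) n (\<lambda>j. j) a) = line (plv (n + 1) n (\<lambda>j. j) b)" using eq by simp
  have "U j = U' j" if j: "j \<in> {1..n}" for j
    using colspace_eq_of_line_eq[OF leq _ j] colspace_eq_of_line_eq[OF leq[symmetric] _ j] a b j by blast
  then show "U = U'" using U U' by (intro PiE_ext[of U "{1..n}" "\<lambda>j. Gr scale j"]) (auto simp: deg_flags_def)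
qed

lemma deg_flag_variety_projective: "projective_variety (deg_flag_variety scale n v i)"
proof -
  have sel: "pv_index (deg_flag_variety scale n v i) = multi_index (n + 1) n (\<lambda>j. j)"
    "pv_emb (deg_flag_variety scale n v i) = plucker_segre scale (n + 1) n v"
    "pv_points (deg_flag_variety scale n v i) = deg_flags scale n v i"
    by (simp_all add: deg_flag_variety_def)
  show ?thesis
    unfolding projective_variety_def sel deg_flags_image
    using finite_multi_index plucker_segre_inj zariski_closed_flag_vecs by blast
qed

end

section \<open>Linear isomorphisms of projective varieties\<close>

lemma zariski_closed_empty: "zariski_closed A {}"
proof -
  have "p \<noteq> {}" if "p \<in> proj_space A" for p using that mem_line_self unfolding proj_space_def by blast
  then show ?thesis
    unfolding zariski_closed_def by (intro exI[of _ "{\<lambda>x. 1}"]) (auto intro: hform.const)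
qed

text \<open>One family of linear forms serves all points, so the closed set to be avoided is
  empty.\<close>

lemma pv_morphism_linear:
  assumes range: "\<phi> ` pv_points X \<subseteq> pv_points Y"
    and vecs: "\<And>p. p \<in> pv_points X \<Longrightarrow> \<exists>y. y \<noteq> (\<lambda>_. 0) \<and> pv_emb X p = line y \<and> pv_emb Y (\<phi> p) = line (T y) \<and> T y \<noteq> (\<lambda>_. 0)"
    and lin: "\<And>b. b \<in> pv_index Y \<Longrightarrow> hform (pv_index X) 1 (\<lambda>x. T x b)"
    and supp: "\<And>x b. b \<notin> pv_index Y \<Longrightarrow> T x b = 0"
    and Tscale: "\<And>c x. T (\<lambda>a. c * x a) = (\<lambda>b. c * T x b)"
  shows "pv_morphism X Y \<phi>"
  unfolding pv_morphism_def
proof (intro conjI ballI exI[of _ "{}"] exI[of _ 1] exI[of _ "\<lambda>b x. T x b"] impI allI range zariski_closed_empty lin)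
  fix q x assume q: "q \<in> pv_points X" and x: "x \<in> pv_emb X q" "x \<noteq> (\<lambda>_. 0)"
  obtain y where y: "pv_emb X q = line y" "pv_emb Y (\<phi> q) = line (T y)" "T y \<noteq> (\<lambda>_. 0)" using vecs[OF q] by blast
  obtain c where c: "x = (\<lambda>a. c * y a)" using x(1) unfolding y(1) mem_line_iff by blast
  have c0: "c \<noteq> 0" using c x(2) by auto
  have Tx: "T x = (\<lambda>b. c * T y b)" unfolding c by (rule Tscale)
  obtain b where b: "T y b \<noteq> 0" using y(3) by auto
  then have "b \<in> pv_index Y" using supp by blast
  then show "\<exists>b\<in>pv_index Y. T x b \<noteq> 0" unfolding Tx using b c0 by auto
  have eq: "(\<lambda>b. if b \<in> pv_index Y then T x b else 0) = T x" using supp by auto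
  show "pv_emb Y (\<phi> q) = line (\<lambda>b. if b \<in> pv_index Y then T x b else 0)"
    unfolding eq unfolding y(2) Tx line_scale[OF c0] ..
qed auto

text \<open>Points are matched through their lines. As \<open>T\<close> and \<open>T'\<close>
  respect proportionality, the matching does not depend on representatives, and injectivity of the
  embeddings turns equal lines into equal points.\<close>

lemma pv_isomorphism_linear:
  assumes injX: "inj_on (pv_emb X) (pv_points X)" and injY: "inj_on (pv_emb Y) (pv_points Y)"
    and imX: "pv_emb X ` pv_points X = line ` V" and imY: "pv_emb Y ` pv_points Y = line ` T ` V"
    and V: "\<And>y. y \<in> V \<Longrightarrow> y \<noteq> (\<lambda>_. 0)" and T'T: "\<And>y. y \<in> V \<Longrightarrow> T' (T y) = y"
    and T: "\<And>b. b \<in> pv_index Y \<Longrightarrow> hform (pv_index X) 1 (\<lambda>x. T x b)"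
      "\<And>x b. b \<notin> pv_index Y \<Longrightarrow> T x b = 0" "\<And>c x. T (\<lambda>a. c * x a) = (\<lambda>b. c * T x b)"
    and T': "\<And>a. a \<in> pv_index X \<Longrightarrow> hform (pv_index Y) 1 (\<lambda>x. T' x a)"
      "\<And>x a. a \<notin> pv_index X \<Longrightarrow> T' x a = 0" "\<And>c x. T' (\<lambda>b. c * x b) = (\<lambda>a. c * T' x a)"
  shows "\<exists>\<phi>. pv_isomorphism X Y \<phi>"
proof -
  have T0: "T y \<noteq> (\<lambda>_. 0)" if "y \<in> V" for y
  proof
    assume "T y = (\<lambda>_. 0)"
    then have "y = T' (\<lambda>b. 0 * 0)" using T'T[OF that] by simp
    also have "\<dots> = (\<lambda>a. 0)" unfolding T'(3) by simp
    finally show False using V[OF that] by simp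
  qed
  have "\<exists>q y. q \<in> pv_points Y \<and> y \<in> V \<and> pv_emb X p = line y \<and> pv_emb Y q = line (T y)" if p: "p \<in> pv_points X" for p
  proof -
    have "pv_emb X p \<in> line ` V" using p imX by blast
    then obtain y where y: "y \<in> V" "pv_emb X p = line y" by blast
    then have "line (T y) \<in> pv_emb Y ` pv_points Y" unfolding imY by blast
    then show ?thesis using y by force
  qed
  then obtain \<phi> y where \<phi>: "\<And>p. p \<in> pv_points X \<Longrightarrow> \<phi> p \<in> pv_points Y \<and> y p \<in> V \<and>
      pv_emb X p = line (y p) \<and> pv_emb Y (\<phi> p) = line (T (y p))" by metis
  have "\<exists>p y. p \<in> pv_points X \<and> y \<in> V \<and> pv_emb Y q = line (T y) \<and> pv_emb X p = line y" if q: "q \<in> pv_points Y" for q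
  proof -
    have "pv_emb Y q \<in> line ` T ` V" using q imY by blast
    then obtain y where y: "y \<in> V" "pv_emb Y q = line (T y)" by blast
    then have "line y \<in> pv_emb X ` pv_points X" unfolding imX by blast
    then show ?thesis using y by force
  qed
  then obtain \<psi> x where \<psi>: "\<And>q. q \<in> pv_points Y \<Longrightarrow> \<psi> q \<in> pv_points X \<and> x q \<in> V \<and>
      pv_emb Y q = line (T (x q)) \<and> pv_emb X (\<psi> q) = line (x q)" by metis
  have line_T: "line (T y) = line (T z)" if eq: "line y = line z" and y: "y \<in> V" for y z
  proof -
    obtain c where c: "c \<noteq> 0" "y = (\<lambda>a. c * z a)" using line_eqD[OF eq V[OF y]] by blast
    have "T y = (\<lambda>b. c * T z b)" unfolding c(2) by (rule T(3))
    then show ?thesis using line_scale[OF c(1)] by simp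
  qed
  have line_T': "line y = line z" if eq: "line (T y) = line (T z)" and y: "y \<in> V" and z: "z \<in> V" for y z
  proof -
    obtain c where c: "c \<noteq> 0" "T y = (\<lambda>a. c * T z a)" using line_eqD[OF eq T0[OF y]] by blast
    have "y = T' (T y)" using T'T[OF y] by simp
    also have "\<dots> = (\<lambda>a. c * T' (T z) a)" unfolding c(2) by (rule T'(3))
    also have "\<dots> = (\<lambda>a. c * z a)" unfolding T'T[OF z] ..
    finally show ?thesis using line_scale[OF c(1), of z] by simp
  qed
  have "pv_morphism X Y \<phi>"
  proof (rule pv_morphism_linear[where T = T])
    show "\<phi> ` pv_points X \<subseteq> pv_points Y" using \<phi> by blast
    show "\<exists>y. y \<noteq> (\<lambda>_. 0) \<and> pv_emb X p = line y \<and> pv_emb Y (\<phi> p) = line (T y) \<and> T y \<noteq> (\<lambda>_. 0)"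
      if "p \<in> pv_points X" for p
      using \<phi>[OF that] V T0 by (intro exI[of _ "y p"]) auto
  qed (use T in auto)
  moreover have "pv_morphism Y X \<psi>"
  proof (rule pv_morphism_linear[where T = T'])
    show "\<psi> ` pv_points Y \<subseteq> pv_points X" using \<psi> by blast
    show "\<exists>y. y \<noteq> (\<lambda>_. 0) \<and> pv_emb Y q = line y \<and> pv_emb X (\<psi> q) = line (T' y) \<and> T' y \<noteq> (\<lambda>_. 0)"
      if "q \<in> pv_points Y" for q
      using \<psi>[OF that] V T0 T'T by (intro exI[of _ "T (x q)"]) auto
  qed (use T' in auto)
  moreover have "\<psi> (\<phi> p) = p" if p: "p \<in> pv_points X" for p
  proof -
    have "line (y p) = line (x (\<phi> p))" using \<phi>[OF p] \<psi>[of "\<phi> p"] by (intro line_T') auto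
    then show ?thesis using \<phi>[OF p] \<psi>[of "\<phi> p"] p by (intro inj_onD[OF injX]) auto
  qed
  moreover have "\<phi> (\<psi> q) = q" if q: "q \<in> pv_points Y" for q
  proof -
    have "line (T (x q)) = line (T (y (\<psi> q)))" using \<psi>[OF q] \<phi>[of "\<psi> q"] by (intro line_T) auto
    then show ?thesis using \<psi>[OF q] \<phi>[of "\<psi> q"] q by (intro inj_onD[OF injY]) auto
  qed
  ultimately show ?thesis unfolding pv_isomorphism_def by blast
qed

section \<open>The windows and the Weyl group element\<close>

lemma downward_closed_lessThan:
  fixes A :: "nat set"
  assumes "finite A" "\<And>s t. t \<in> A \<Longrightarrow> s < t \<Longrightarrow> s \<in> A"
  shows "A = {..<card A}"
proof (cases "A = {}")
  case False
  define M where "M = Max A"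
  have "M \<in> A" using assms(1) False by (simp add: M_def)
  have "A = {..M}"
  proof
    show "A \<subseteq> {..M}" using assms(1) by (auto simp: M_def)
    show "{..M} \<subseteq> A" using assms(2)[OF \<open>M \<in> A\<close>] \<open>M \<in> A\<close> by (auto simp: le_less)
  qed
  then have "A = {..<Suc M}" by auto
  then show ?thesis by (metis card_lessThan)
qed simp

lemma foldr_comp_append: "foldr (\<circ>) fs g = foldr (\<circ>) fs id \<circ> g"
  by (induction fs) auto

text \<open>The rightmost reflection acts first. A position from \<open>a\<close> to
  \<open>a + l - 1\<close> is moved by one factor only, one step up, while \<open>a + l\<close> is
  carried down to \<open>a\<close> by all factors in turn.\<close>

lemma foldr_simple_refl:
  "foldr (\<circ>) (map simple_refl [a + 1..<a + l + 1]) id x =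
    (if a \<le> x \<and> x < a + l then x + 1 else if x = a + l then a else x)"
proof (induction l arbitrary: x)
  case (Suc l)
  have up: "[a + 1..<a + Suc l + 1] = [a + 1..<a + l + 1] @ [a + l + 1]" by simp
  have "foldr (\<circ>) (map simple_refl [a + 1..<a + Suc l + 1]) id
      = foldr (\<circ>) (map simple_refl [a + 1..<a + l + 1]) (simple_refl (a + l + 1))"
    unfolding up map_append foldr_append by (simp only: list.map foldr.simps o_apply id_apply comp_id)
  also have "\<dots> = foldr (\<circ>) (map simple_refl [a + 1..<a + l + 1]) id \<circ> simple_refl (a + l + 1)"
    by (rule foldr_comp_append)
  finally have eq: "foldr (\<circ>) (map simple_refl [a + 1..<a + Suc l + 1]) id
      = foldr (\<circ>) (map simple_refl [a + 1..<a + l + 1]) id \<circ> simple_refl (a + l + 1)" .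
  have "foldr (\<circ>) (map simple_refl [a + 1..<a + Suc l + 1]) id x
      = foldr (\<circ>) (map simple_refl [a + 1..<a + l + 1]) id (simple_refl (a + l + 1) x)"
    using fun_cong[OF eq, of x] by (simp only: o_apply)
  also have "\<dots> = (if a \<le> x \<and> x < a + Suc l then x + 1 else if x = a + Suc l then a else x)"
    unfolding Suc.IH by (auto simp: simple_refl_def transpose_def)
  finally show ?case .
qed simp

lemma foldr_comp_bij:
  assumes "\<And>f. f \<in> set fs \<Longrightarrow> bij_betw f S S"
  shows "bij_betw (foldr (\<circ>) fs id) S S"
  using assms
proof (induction fs)
  case (Cons f fs)
  have "bij_betw (foldr (\<circ>) fs id) S S"
    by (rule Cons.IH, rule Cons.prems) simp
  moreover have "bij_betw f S S" by (rule Cons.prems) simp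
  ultimately have "bij_betw (f \<circ> foldr (\<circ>) fs id) S S" by (rule bij_betw_trans)
  then show ?case unfolding foldr_Cons o_apply[of "(\<circ>) f"] .
qed (simp add: bij_betw_def)

lemma w_factor_apply:
  "w_factor i j x = (if h_num i j \<le> x \<and> x < h_num i j + j then x + 1 else if x = h_num i j + j then h_num i j else x)"
  unfolding w_factor_def by (rule foldr_simple_refl)

lemma w_factor_bij:
  assumes "h_num i j + j < b"
  shows "bij_betw (w_factor i j) {..<b} {..<b}"
  unfolding w_factor_def
proof (rule foldr_comp_bij)
  fix f assume "f \<in> set (map simple_refl [h_num i j + 1..<h_num i j + j + 1])"
  then have "f \<in> simple_refl ` {h_num i j + 1..<h_num i j + j + 1}" by (simp only: set_map set_upt)
  then obtain r where r: "f = simple_refl r" "1 \<le> r" "r < b" using assms by fastforce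
  then have "f permutes {..<b}" unfolding r(1) simple_refl_def by (intro permutes_swap_id) auto
  then show "bij_betw f {..<b} {..<b}" by (rule permutes_imp_bij)
qed

lemma w_elt_Suc: "w_elt (Suc m) i = w_factor i (Suc m) \<circ> w_elt m i"
  by (simp add: w_elt_def)

lemma w_elt_0: "w_elt 0 i = id"
  by (simp add: w_elt_def)

lemma w_elt_bij:
  assumes "\<And>j. j \<in> {1..m} \<Longrightarrow> h_num i j + j < b"
  shows "bij_betw (w_elt m i) {..<b} {..<b}"
  using assms
proof (induction m)
  case 0
  then show ?case by (simp add: w_elt_0 bij_betw_def)
next
  case (Suc m)
  show ?case unfolding w_elt_Suc
    by (rule bij_betw_trans[OF Suc.IH w_factor_bij]; rule Suc.prems) auto
qed

context
  fixes n :: nat and i :: "nat list"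
  assumes n: "1 \<le> n" and sorted: "sorted_wrt (<) i" and range: "set i \<subseteq> {1..n - 1}"
begin

lemma i_distinct: "distinct i"
  using sorted strict_sorted_iff by blast

lemma h_num_set: "{t. t < length i \<and> i ! t < j} = {..<h_num i j}"
  unfolding h_num_def
proof (rule downward_closed_lessThan)
  show "s \<in> {t. t < length i \<and> i ! t < j}" if "t \<in> {t. t < length i \<and> i ! t < j}" "s < t" for s t
    using sorted_wrt_nth_less[OF sorted that(2)] that by auto
qed simp

lemma h_num_le: "h_num i j \<le> length i"
proof -
  have "{..<h_num i j} \<subseteq> {..<length i}" unfolding h_num_set[symmetric] by auto
  then show ?thesis by simp
qed

text \<open>As \<open>i\<close> is strictly increasing, the entries less than \<open>j\<close> are
  precisely those before it.\<close>

lemma h_num_nth: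
  assumes "j \<in> set i"
  shows "h_num i j < length i" "i ! h_num i j = j" "h_num i (Suc j) = Suc (h_num i j)"
proof -
  obtain t where t: "t < length i" "i ! t = j" using assms by (auto simp: in_set_conv_nth)
  have less: "i ! s < j \<longleftrightarrow> s < t" if "s < length i" for s
    using sorted_wrt_nth_less[OF sorted, of s t] sorted_wrt_nth_less[OF sorted, of t s] that t
    by (cases s t rule: linorder_cases) auto
  have "{s. s < length i \<and> i ! s < j} = {..<t}" using less t by auto
  then have eq: "h_num i j = t" by (simp add: h_num_def)
  have "{s. s < length i \<and> i ! s < Suc j} = {..<Suc t}"
  proof -
    have "i ! s = j \<longleftrightarrow> s = t" if "s < length i" for s
      using nth_eq_iff_index_eq[OF i_distinct, of s t] that t by simp
    then show ?thesis using less t by (auto simp: less_Suc_eq)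
  qed
  then have "h_num i (Suc j) = Suc t" by (simp add: h_num_def)
  with eq t show "h_num i j < length i" "i ! h_num i j = j" "h_num i (Suc j) = Suc (h_num i j)" by auto
qed

lemma h_num_Suc_notin: "j \<notin> set i \<Longrightarrow> h_num i (Suc j) = h_num i j"
proof -
  assume j: "j \<notin> set i"
  have "i ! t < Suc j \<longleftrightarrow> i ! t < j" if "t < length i" for t
    using j nth_mem[OF that] by (auto simp: less_Suc_eq)
  then show ?thesis unfolding h_num_def by (metis (no_types, lifting))
qed

text \<open>The entries are distinct elements of a set of size \<open>n - 1\<close>. This puts the
  three ranges in the definition of \<open>win\<close> in order.\<close>

lemma length_i: "length i < n"
proof -
  have "length i = card (set i)" using distinct_card[OF i_distinct] by simp
  also have "\<dots> \<le> card {1..n - 1}" using range by (intro card_mono) auto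
  finally show ?thesis using n by simp
qed

text \<open>Positions and indices count from 0, so the projection along \<open>v (i ! t + 1)\<close> kills the index
  \<open>i ! t\<close>: it sits in position \<open>t\<close> and, after the window has passed, again in \<open>t + n + 1\<close>.\<close>

definition win :: "nat \<Rightarrow> nat"
  where "win x = (if x < length i then i ! x
    else if x < n + 1 then pick ({..n} - set i) (x - length i) else i ! (x - (n + 1)))"

lemma win_pick:
  assumes "length i \<le> x" "x < n + 1"
  shows "win x \<in> {..n} - set i" "win x = pick ({..n} - set i) (x - length i)" "x - length i < card ({..n} - set i)"
proof -
  have "set i \<subseteq> {..n}"
  proof
    fix x assume "x \<in> set i"
    then have "x \<in> {1..n - 1}" using range by blast
    then show "x \<in> {..n}" unfolding atLeastAtMost_iff atMost_iff by linarith
  qed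
  then have "card ({..n} - set i) = n + 1 - length i"
    using distinct_card[OF i_distinct] by (simp add: card_Diff_subset)
  then show "x - length i < card ({..n} - set i)" using assms by simp
  then show "win x \<in> {..n} - set i" "win x = pick ({..n} - set i) (x - length i)"
    using pick_in_set_le[of "x - length i" "{..n} - set i"] assms by (auto simp: win_def)
qed

lemma win_low: "x < length i \<Longrightarrow> win x = i ! x"
  by (simp add: win_def)

lemma win_high: "n + 1 \<le> x \<Longrightarrow> win x = i ! (x - (n + 1))"
  using length_i by (simp add: win_def)

text \<open>Each of the three ranges is mapped injectively, and the middle one takes values outside
  \<open>set i\<close>. Only the first and the last range share values, at distance
  \<open>n + 1\<close>, which is more than a window allows.\<close>

lemma win_inj:
  assumes "h \<le> length i" "x \<in> {h..<h + n + 1}" "y \<in> {h..<h + n + 1}" "x < y" 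
  shows "win x \<noteq> win y"
proof -
  consider "y < length i" | "x < length i" "length i \<le> y" "y < n + 1" | "x < length i" "n + 1 \<le> y"
    | "length i \<le> x" "y < n + 1" | "length i \<le> x" "x < n + 1" "n + 1 \<le> y" | "n + 1 \<le> x"
    by linarith
  then show ?thesis
  proof cases
    case 1
    then show ?thesis using assms nth_eq_iff_index_eq[OF i_distinct, of x y] by (simp add: win_low)
  next
    case 2
    then have "win x \<in> set i" by (simp add: win_low)
    then show ?thesis using win_pick(1)[of y] 2 by auto
  next
    case 3
    then show ?thesis using assms nth_eq_iff_index_eq[OF i_distinct, of x "y - (n + 1)"] by (auto simp: win_low win_high)
  next
    case 4
    let ?S = "{..n} - set i"
    have "pick ?S (x - length i) < pick ?S (y - length i)"
      using 4 win_pick(3)[of y] assms by (intro pick_mono_le) auto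
    then show ?thesis using 4 win_pick(2)[of x] win_pick(2)[of y] assms by simp
  next
    case 5
    then have "win y \<in> set i" using assms by (auto simp: win_high)
    then show ?thesis using win_pick(1)[of x] 5 by auto
  next
    case 6
    then show ?thesis using assms nth_eq_iff_index_eq[OF i_distinct, of "x - (n + 1)" "y - (n + 1)"] by (auto simp: win_high)
  qed
qed

lemma win_range:
  assumes "x < n + 1 + length i"
  shows "win x < n + 1"
proof -
  have lt: "s < n + 1" if "s \<in> set i" for s
  proof -
    have "s \<in> {1..n - 1}" using range that by blast
    then show ?thesis unfolding atLeastAtMost_iff by linarith
  qed
  consider "x < length i" | "length i \<le> x" "x < n + 1" | "n + 1 \<le> x" by linarith
  then show ?thesis
  proof cases
    case 1
    then show ?thesis using lt by (simp add: win_low)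
  next
    case 2
    then show ?thesis using win_pick(1)[of x] by auto
  next
    case 3
    then have "win x \<in> set i" using assms by (simp add: win_high)
    then show ?thesis using lt by blast
  qed
qed

lemma win_window: "window n (length i) (h_num i) win (set i)"
proof
  fix j assume j: "j \<in> {1..n}"
  show "h_num i j \<le> length i" by (rule h_num_le)
  let ?W = "{h_num i j..<h_num i j + n + 1}"
  have inj: "inj_on win ?W"
    using win_inj[OF h_num_le] by (intro linorder_inj_onI) auto
  have sub: "win ` ?W \<subseteq> {..<n + 1}" using win_range h_num_le[of j] by fastforce
  have "card (win ` ?W) = card {..<n + 1}" unfolding card_image[OF inj] by simp
  then have "win ` ?W = {..<n + 1}" by (rule card_subset_eq[OF finite_lessThan sub])
  with inj show "bij_betw win ?W {..<n + 1}" by (simp add: bij_betw_def)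
next
  fix j assume "j \<in> {1..<n}"
  show "h_num i (Suc j) = h_num i j + (if j \<in> set i then 1 else 0)"
    using h_num_nth(3)[of j] h_num_Suc_notin[of j] by auto
  assume "j \<in> set i"
  then show "win (h_num i j) = j \<and> win (h_num i j + n + 1) = j"
    using h_num_nth[of j] by (simp add: win_low win_high)
qed

interpretation W: window n "length i" "h_num i" win "set i"
  by (rule win_window)

lemma ell_dm: "ell i = W.dm"
  by (auto simp: ell_def W.dm_def)

text \<open>The first \<open>j - 1\<close> factors permute the first \<open>dm j\<close> positions
  among themselves. Each later factor fixes the first \<open>h_num i j\<close> positions and moves
  the block of \<open>j\<close> positions up by one: by \<open>W.h_mono\<close> its cycle starts
  neither before the end of the former nor after the start of the latter.\<close>

lemma w_elt_image:
  assumes j: "j \<in> {1..n}" and m: "j - 1 \<le> m" "m \<le> n"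
  shows "w_elt m i ` {..<W.dm j} = {..<h_num i j} \<union> {h_num i j + m + 1 - j..<h_num i j + m + 1}"
  using m
proof (induction m rule: dec_induct)
  case base
  have "bij_betw (w_elt (j - 1) i) {..<W.dm j} {..<W.dm j}"
  proof (rule w_elt_bij)
    fix l assume l: "l \<in> {1..j - 1}"
    then have "h_num i l \<le> h_num i j" using W.h_mono[of l j] j by auto
    then show "h_num i l + l < W.dm j" using l by (auto simp: W.dm_def)
  qed
  then have "w_elt (j - 1) i ` {..<W.dm j} = {..<W.dm j}" by (rule bij_betw_imp_surj_on)
  \<comment> \<open>For \<open>m = j - 1\<close> the block of \<open>j\<close> positions directly
    follows the fixed ones.\<close>
  also have "\<dots> = {..<h_num i j} \<union> {h_num i j + (j - 1) + 1 - j..<h_num i j + (j - 1) + 1}"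
    using j by (auto simp: W.dm_def)
  finally show ?case .
next
  case (step m)
  let ?h = "h_num i j" and ?H = "h_num i (Suc m)"
  have H: "?h \<le> ?H" "?H + j \<le> ?h + Suc m" using W.h_mono[of j "Suc m"] j step by auto
  have "w_elt (Suc m) i ` {..<W.dm j} = w_factor i (Suc m) ` ({..<?h} \<union> {?h + m + 1 - j..<?h + m + 1})"
    unfolding w_elt_Suc image_comp[symmetric] step.IH[OF Suc_leD[OF step.prems]] ..
  also have "\<dots> = w_factor i (Suc m) ` {..<?h} \<union> w_factor i (Suc m) ` {?h + m + 1 - j..<?h + m + 1}"
    by (rule image_Un)
  also have "w_factor i (Suc m) ` {..<?h} = (\<lambda>x. x) ` {..<?h}"
    by (rule image_cong[OF refl]) (use H in \<open>auto simp: w_factor_apply\<close>)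
  also have "w_factor i (Suc m) ` {?h + m + 1 - j..<?h + m + 1} = Suc ` {?h + m + 1 - j..<?h + m + 1}"
    by (rule image_cong[OF refl]) (use H step j in \<open>auto simp: w_factor_apply\<close>)
  also have "\<dots> = {?h + Suc m + 1 - j..<?h + Suc m + 1}"
    using step j by (auto simp: image_Suc_atLeastLessThan Suc_diff_le)
  finally show ?case by simp
qed

lemma schubert_window_w_elt: "schubert_window n (length i) (h_num i) win (set i) (w_elt n i)"
proof
  show "1 \<le> n" by (rule n)
  show "bij_betw (w_elt n i) {..<W.N} {..<W.N}"
  proof (rule w_elt_bij)
    fix j assume "j \<in> {1..n}"
    then show "h_num i j + j < W.N" using h_num_le[of j] by (auto simp: W.N_def)
  qed
  show "w_elt n i ` {..<W.dm j} = {..<h_num i j} \<union> {h_num i j + n + 1 - j..<h_num i j + n + 1}"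
    if "j \<in> {1..n}" for j
  proof -
    have "j - 1 \<le> n" using that by auto
    then show ?thesis by (rule w_elt_image[OF that _ order_refl])
  qed
qed

lemma deg_flag_variety_schubert:
  assumes vs: "vector_space scale" and basis: "is_basis scale (n + 1) v"
  shows "projective_variety (deg_flag_variety scale n v i)
    \<and> projective_variety (schubert_variety (n + 1 + length i) n (ell i) (w_elt n i))
    \<and> (\<exists>\<phi>. pv_isomorphism (deg_flag_variety scale n v i)
         (schubert_variety (n + 1 + length i) n (ell i) (w_elt n i)) \<phi>)"
proof -
  interpret V: vector_space scale by (rule vs)
  interpret S: schubert_window n "length i" "h_num i" win "set i" "w_elt n i"
    by (rule schubert_window_w_elt)
  interpret D: deg_flag_space scale n v i W.kill_mat
    by unfold_locales (rule basis, rule W.mprod_kill_mat)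
  let ?X = "deg_flag_variety scale n v i" and ?Y = "schubert_variety (n + 1 + length i) n (ell i) (w_elt n i)"
  have Y: "?Y = schubert_variety W.N n W.dm (w_elt n i)" by (simp add: W.N_def ell_dm)
  have X_proj: "projective_variety ?X" by (rule D.deg_flag_variety_projective)
  have Y_proj: "projective_variety ?Y" unfolding Y by (rule S.schubert_variety_projective)
  have "\<exists>\<phi>. pv_isomorphism ?X ?Y \<phi>"
  proof (rule pv_isomorphism_linear[where V = W.deg_vecs and T = W.T and T' = W.T'])
    show "inj_on (pv_emb ?X) (pv_points ?X)" "inj_on (pv_emb ?Y) (pv_points ?Y)"
      using X_proj Y_proj by (simp_all add: projective_variety_def)
    show "pv_emb ?X ` pv_points ?X = line ` W.deg_vecs"
      using D.deg_flags_image by (simp add: deg_flag_variety_def W.deg_vecs_def)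
    show "pv_emb ?Y ` pv_points ?Y = line ` W.T ` W.deg_vecs"
      unfolding Y by (rule S.schubert_variety_image)
    have iX: "pv_index ?X = multi_index (n + 1) n (\<lambda>j. j)" by (simp add: deg_flag_variety_def)
    have iY: "pv_index ?Y = multi_index W.N n W.dm" unfolding Y by (simp add: schubert_variety_def)
    show "y \<noteq> (\<lambda>_. 0)" if "y \<in> W.deg_vecs" for y using W.deg_vecs_props(1)[OF that] .
    show "W.T' (W.T y) = y" if "y \<in> W.deg_vecs" for y
      by (rule W.T'_T) (rule W.deg_vecs_props(2)[OF that])
    show "hform (pv_index ?X) 1 (\<lambda>x. W.T x b)" for b unfolding iX by (rule W.hform_T)
    show "W.T x b = 0" if "b \<notin> pv_index ?Y" for x b
      using that unfolding iY by (auto simp: W.T_def W.good_def)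
    show "W.T (\<lambda>a. c * x a) = (\<lambda>b. c * W.T x b)" for c x by (rule W.T_scale)
    show "hform (pv_index ?Y) 1 (\<lambda>x. W.T' x a)" if "a \<in> pv_index ?X" for a
      using that unfolding iX iY by (rule W.hform_T')
    show "W.T' x a = 0" if "a \<notin> pv_index ?X" for x a
      using that unfolding iX by (simp add: W.T'_def)
    show "W.T' (\<lambda>b. c * x b) = (\<lambda>a. c * W.T' x a)" for c x by (rule W.T'_scale)
  qed
  with X_proj Y_proj show ?thesis by blast
qed

end

theorem theorem6:
  fixes scale :: "complex \<Rightarrow> 'v \<Rightarrow> 'v::ab_group_add"
    and v :: "nat \<Rightarrow> 'v" and n :: nat and i :: "nat list"
  assumes "vector_space scale" and "is_basis scale (n + 1) v"
    and "n \<ge> 1" and "sorted_wrt (<) i" and "set i \<subseteq> {1..n - 1}"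
  shows "projective_variety (deg_flag_variety scale n v i)
    \<and> projective_variety (schubert_variety (n + 1 + length i) n (ell i) (w_elt n i))
    \<and> (\<exists>\<phi>. pv_isomorphism (deg_flag_variety scale n v i)
         (schubert_variety (n + 1 + length i) n (ell i) (w_elt n i)) \<phi>)"
  using deg_flag_variety_schubert[OF assms(3-5,1,2)] .

end
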